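(* Let $T>0$, let $E$ be a real Banach space, $\Omega\subset E$ a non-empty open subset, $\xi_0\in\Omega$, $U$ a Hausdorff topological space, $m,q\ge 1$ integers, and let $f:[0,T]\times\Omega\times U\to E$, $g^\alpha:\Omega\to\mathbb R$ ($0\le\alpha\le m$), $h^\beta:\Omega\to\mathbb R$ ($1\le\beta\le q$) be functions. Let $(x_0,u_0)$ be a solution of the Mayer problem $(\mathcal M)$ (defined in the context). Assume: (1) $f\in C^0([0,T]\times\Omega\times U,E)$; $D_{G,2}f(t,\xi,\zeta)$ exists for all $(t,\xi,\zeta)\in[0,T]\times\Omega\times U$; $D_{F,2}f(t,x_0(t),\zeta)$ exists for all $(t,\zeta)\in[0,T]\times U$ and $[(t,\zeta)\mapsto D_{F,2}f(t,x_0(t),\zeta)]\in C^0([0,T]\times U,\mathcal L(E,E))$; and for all non-empty compact $K\subset\Omega$, $M\subset U$, $\sup_{[0,T]\times K\times M}\|D_{G,2}f\|<+\infty$; (2) $g^\alpha$ is Hadamard differentiable at $x_0(T)$ for $0\le\alpha\le m$; for $1\le\beta\le q$, $h^\beta$ is continuous on a neighborhood of $x_0(T)$ and Hadamard differentiable at $x_0(T)$. For $i\in\{0,1\}$ consider the condition $(QC,i)$: if $(c_\alpha)_{i\le\alpha\le m}\in\mathbb R_+^{1-i+m}$ and $(d_\beta)_{1\le\beta\le q}\in\mathbb R^q$ satisfy $c_\alpha g^\alpha(x_0(T))=0$ for all $\alpha\in\{1,\dots,m\}$ and $\sum_{\alpha=i}^mc_\alpha D_Gg^\alpha(x_0(T))+\sum_{\beta=1}^qd_\beta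 D_Gh^\beta(x_0(T))=0$, then $c_\alpha=0$ for all $\alpha\in\{i,\dots,m\}$ and $d_\beta=0$ for all $\beta\in\{1,\dots,q\}$; and the conditions (Surj) $U$ is a subset of a real normed vector space $Y$, and there exists $\hat t\in[0,T]$ such that $U$ is a neighborhood of $u_0(\hat t)$ in $Y$, and $D_{G,3}f(\hat t,x_0(\hat t),u_0(\hat t))$ exists and is surjective; (LI) $U$ is a subset of a real normed vector space $Y$, $U$ is a neighborhood of $u_0(T)$ in $Y$, $D_{G,3}f(T,x_0(T),u_0(T))$ exists, and the family consisting of $D_Hg^\alpha(x_0(T))\circ D_{G,3}f(T,x_0(T),u_0(T))$ ($1\le\alpha\le m$) and $D_Hh^\beta(x_0(T))\circ D_{G,3}f(T,x_0(T),u_0(T))$ ($1\le\beta\le q$) is linearly independent. Then, with Pontryagin triples as defined in the context: (i) Under $(QC,1)$, every Pontryagin triple satisfies $(\lambda_0,p(t))\ne0$ for all $t\in[0,T]$. (ii) Under $(QC,0)$, every Pontryagin triple satisfies $p(t)\neq0$ for all $t\in[0,T]$. (iii) Under $(QC,1)$ and (Surj), there is a Pontryagin triple with $\lambda_0=1$. (iv) Under (LI), the Pontryagin triple with $\lambda_0=1$ is unique.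
   Context: Function spaces. For a Hausdorff topological space $W$, $PC^0([0,T],W)$ is the set of $x:[0,T]\to W$ which are continuous, or for which there is a subdivision $0=\tau_0<\tau_1<\dots<\tau_{k+1}=T$ such that $x$ is continuous at every $t\notin\{\tau_i\}$, the right limit $x(\tau_i+)$ exists in $W$ for $0\le i\le k$ and the left limit $x(\tau_i-)$ exists in $W$ for $1\le i\le k+1$. $NPC^0_R([0,T],W)$ is the set of $x\in PC^0([0,T],W)$ which are right-continuous on $[0,T[$ and left-continuous at $T$. For $W$ a subset of a real normed space, $PC^1([0,T],W)$ is the set of continuous $x:[0,T]\to W$ which are continuously differentiable, or for which there is a subdivision $0=\tau_0<\tau_1<\dots<\tau_{k+1}=T$ such that $x$ is continuously differentiable at every $t\notin\{\tau_i\}$, the right derivative $x'_R(\tau_i)=x'(\tau_i+)$ exists for $0\le i\le k$ and the left derivative $x'_L(\tau_i)=x'(\tau_i-)$ exists for $1\le i\le k+1$. The extended derivative is $\underline d x(t):=x'(t)$ if $t\notin\{\tau_i\}$, $\underline d x(\tau_i):=x'_R(\tau_i)$ for $0\le i\le k$, $\underline d x(T):=x'_L(T)$. Differentials. $D_G\mathfrak f(x)$, $D_H\mathfrak f(x)$, $D_F\mathfrak f(x)$ are the Gâteaux, Hadamard, Fréchet differentials (continuous linear maps). $D_G\mathfrak f(x)\cdot v=\lim_{\theta\to0+}(\mathfrak f(x+\theta v)-\mathfrak f(x))/\theta$ for all $v$; $\mathfrak f$ is Hadamard differentiable at $x$ when moreover $\lim_{\theta\to0+,\,w\to v}(\mathfrak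 f(x+\theta w)-\mathfrak f(x))/\theta=D_H\mathfrak f(x)\cdot v$ for all $v$. A subscript $i$, as in $D_{G,i},D_{H,i},D_{F,i}$, denotes the partial differential with respect to the $i$-th variable. Problem $(\mathcal M)$: maximize $g^0(x(T))$ over the admissible processes, i.e. the pairs $(x,u)\in PC^1([0,T],\Omega)\times NPC^0_R([0,T],U)$ with $\underline d x(t)=f(t,x(t),u(t))$ for all $t\in[0,T]$, $x(0)=\xi_0$, $g^\alpha(x(T))\ge0$ for $1\le\alpha\le m$, and $h^\beta(x(T))=0$ for $1\le\beta\le q$. A solution is an admissible process attaining the maximum. Pontryagin triple: with $H_M(t,\xi,\zeta,p):=p\cdot f(t,\xi,\zeta)$, a Pontryagin triple (for $(x_0,u_0)$) is $((\lambda_\alpha)_{0\le\alpha\le m},(\mu_\beta)_{1\le\beta\le q},p)\in\mathbb R^{1+m}\times\mathbb R^q\times PC^1([0,T],E^* )$ such that: $((\lambda_\alpha),(\mu_\beta))\neq0$; $\lambda_\alpha\ge0$ for $0\le\alpha\le m$; $\lambda_\alpha g^\alpha(x_0(T))=0$ for $1\le\alpha\le m$; $\sum_{\alpha=0}^m\lambda_\alpha D_Hg^\alpha(x_0(T))+\sum_{\beta=1}^q\mu_\beta D_Hh^\beta(x_0(T))=p(T)$; $\underline d p(t)=-D_{F,2}H_M(t,x_0(t),u_0(t),p(t))$ for all $t\in[0,T]$; $H_M(t,x_0(t),u_0(t),p(t))\ge H_M(t,x_0(t),\zeta,p(t))$ for all $t\in[0,T]$, $\zeta\in U$; and $[t\mapsto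 H_M(t,x_0(t),u_0(t),p(t))]\in C^0([0,T],\mathbb R)$. *)

theory Defs
  imports "HOL-Analysis.Analysis"
begin

text \<open>Functions on \<open>[0,T]\<close>, on \<open>\<Omega>\<close> or on \<open>U\<close> are total functions whose values outside these sets
  are never used. A Hausdorff space \<open>U\<close> is a subset of a type of class \<^class>\<open>t2_space\<close> with the
  subspace topology; in particular, limits are required to lie in the subset.\<close>

section \<open>Piecewise continuous and piecewise continuously differentiable functions\<close>

definition subdivision :: "real \<Rightarrow> nat \<Rightarrow> (nat \<Rightarrow> real) \<Rightarrow> bool" where
  "subdivision T k \<tau> \<longleftrightarrow> \<tau> 0 = 0 \<and> \<tau> (Suc k) = T \<and> (\<forall>i\<le>k. \<tau> i < \<tau> (Suc i))"

definition PC0 :: "real \<Rightarrow> 'a::t2_space set \<Rightarrow> (real \<Rightarrow> 'a) set" where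
  "PC0 T W = {x. x ` {0..T} \<subseteq> W \<and>
     (continuous_on {0..T} x \<or>
      (\<exists>k \<tau>. subdivision T k \<tau> \<and>
         (\<forall>t\<in>{0..T} - \<tau> ` {..Suc k}. isCont x t) \<and>
         (\<forall>i\<in>{0..k}. \<exists>l\<in>W. (x \<longlongrightarrow> l) (at_right (\<tau> i))) \<and>
         (\<forall>i\<in>{1..Suc k}. \<exists>l\<in>W. (x \<longlongrightarrow> l) (at_left (\<tau> i)))))}"

definition NPC0R :: "real \<Rightarrow> 'a::t2_space set \<Rightarrow> (real \<Rightarrow> 'a) set" where
  "NPC0R T W = {x \<in> PC0 T W. (\<forall>t\<in>{0..<T}. continuous (at_right t) x) \<and> continuous (at_left T) x}"

text \<open>The points of \<open>[0,T]\<close> outside a subdivision form an open set, on which \<^const>\<open>C1_differentiable_on\<close>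
  is the usual notion. In the first alternative, the derivatives at \<open>0\<close> and \<open>T\<close> are one-sided.\<close>

definition PC1 :: "real \<Rightarrow> 'a::real_normed_vector set \<Rightarrow> (real \<Rightarrow> 'a) set" where
  "PC1 T W = {x. x ` {0..T} \<subseteq> W \<and> continuous_on {0..T} x \<and>
     ((\<exists>x'. (\<forall>t\<in>{0..T}. (x has_vector_derivative x' t) (at t within {0..T})) \<and> continuous_on {0..T} x') \<or>
      (\<exists>k \<tau>. subdivision T k \<tau> \<and>
         x C1_differentiable_on ({0..T} - \<tau> ` {..Suc k}) \<and>
         (\<forall>i\<in>{0..k}. \<exists>d. (x has_vector_derivative d) (at (\<tau> i) within {\<tau> i..T}) \<and>
                          ((\<lambda>t. vector_derivative x (at t)) \<longlongrightarrow> d) (at_right (\<tau> i))) \<and>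
         (\<forall>i\<in>{1..Suc k}. \<exists>d. (x has_vector_derivative d) (at (\<tau> i) within {0..\<tau> i}) \<and>
                          ((\<lambda>t. vector_derivative x (at t)) \<longlongrightarrow> d) (at_left (\<tau> i)))))}"

text \<open>The extended derivative: the right derivative on \<open>[0,T[\<close> and the left derivative at \<open>T\<close>.
  Where \<open>x\<close> is differentiable in \<open>]0,T[\<close>, the right derivative is \<open>x'(t)\<close>, so that this is the
  function built from any subdivision adapted to \<open>x\<close>; see \<open>ext_deriv_subdivision\<close> below.\<close>

definition ext_deriv :: "real \<Rightarrow> (real \<Rightarrow> 'a::real_normed_vector) \<Rightarrow> real \<Rightarrow> 'a" where
  "ext_deriv T x t = (if t < T then vector_derivative x (at t within {t..T})
                      else vector_derivative x (at t within {0..t}))"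

lemma subdivision_mono:
  assumes "subdivision T k \<tau>" "i < j" "j \<le> Suc k"
  shows "\<tau> i < \<tau> j"
  using assms(2,3)
proof (induction j)
  case (Suc j)
  have "\<tau> j < \<tau> (Suc j)"
    using assms(1) Suc.prems by (auto simp: subdivision_def)
  then show ?case
    using Suc by (cases "i = j") auto
qed simp

lemma ext_deriv_subdivision:
  assumes sub: "subdivision T k \<tau>"
    and C1: "x C1_differentiable_on ({0..T} - \<tau> ` {..Suc k})"
  shows "t \<in> {0..T} - \<tau> ` {..Suc k} \<Longrightarrow> ext_deriv T x t = vector_derivative x (at t)"
    and "i \<le> k \<Longrightarrow> ext_deriv T x (\<tau> i) = vector_derivative x (at (\<tau> i) within {\<tau> i..T})"
    and "ext_deriv T x T = vector_derivative x (at T within {0..T})"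
proof -
  assume t: "t \<in> {0..T} - \<tau> ` {..Suc k}"
  have "\<tau> (Suc k) = T"
    using sub by (simp add: subdivision_def)
  then have lt: "t < T"
    using t by (force simp: less_le)
  obtain D where D: "(x has_vector_derivative D) (at t)"
    using C1 t unfolding C1_differentiable_on_def by blast
  have "vector_derivative x (at t within {t..T}) = D"
    using D lt by (intro vector_derivative_within_cbox[of t T t x D, simplified])
      (auto intro: has_vector_derivative_at_within)
  then show "ext_deriv T x t = vector_derivative x (at t)"
    using lt vector_derivative_at[OF D] by (simp add: ext_deriv_def)
next
  assume "i \<le> k"
  then have "\<tau> i < T"
    using subdivision_mono[OF sub, of i "Suc k"] sub by (simp add: subdivision_def)
  then show "ext_deriv T x (\<tau> i) = vector_derivative x (at (\<tau> i) within {\<tau> i..T})"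
    by (simp add: ext_deriv_def)
qed (simp add: ext_deriv_def)


section \<open>Differentials\<close>

definition has_gateaux ::
  "('a::real_normed_vector \<Rightarrow> 'b::real_normed_vector) \<Rightarrow> ('a \<Rightarrow>\<^sub>L 'b) \<Rightarrow> 'a \<Rightarrow> bool" where
  "has_gateaux F L x \<longleftrightarrow>
     (\<forall>v. ((\<lambda>\<theta>. (F (x + \<theta> *\<^sub>R v) - F x) /\<^sub>R \<theta>) \<longlongrightarrow> L v) (at_right 0))"

definition has_hadamard ::
  "('a::real_normed_vector \<Rightarrow> 'b::real_normed_vector) \<Rightarrow> ('a \<Rightarrow>\<^sub>L 'b) \<Rightarrow> 'a \<Rightarrow> bool" where
  "has_hadamard F L x \<longleftrightarrow> has_gateaux F L x \<and>
     (\<forall>v. ((\<lambda>(\<theta>, w). (F (x + \<theta> *\<^sub>R w) - F x) /\<^sub>R \<theta>) \<longlongrightarrow> L v) (at_right 0 \<times>\<^sub>F nhds v))"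

definition gateaux_differentiable ::
  "('a::real_normed_vector \<Rightarrow> 'b::real_normed_vector) \<Rightarrow> 'a \<Rightarrow> bool" where
  "gateaux_differentiable F x \<longleftrightarrow> (\<exists>L. has_gateaux F L x)"

definition hadamard_differentiable ::
  "('a::real_normed_vector \<Rightarrow> 'b::real_normed_vector) \<Rightarrow> 'a \<Rightarrow> bool" where
  "hadamard_differentiable F x \<longleftrightarrow> (\<exists>L. has_hadamard F L x)"

definition DG :: "('a::real_normed_vector \<Rightarrow> 'b::real_normed_vector) \<Rightarrow> 'a \<Rightarrow> ('a \<Rightarrow>\<^sub>L 'b)" where
  "DG F x = (THE L. has_gateaux F L x)"

definition DH :: "('a::real_normed_vector \<Rightarrow> 'b::real_normed_vector) \<Rightarrow> 'a \<Rightarrow> ('a \<Rightarrow>\<^sub>L 'b)" where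
  "DH F x = (THE L. has_hadamard F L x)"

definition DF :: "('a::real_normed_vector \<Rightarrow> 'b::real_normed_vector) \<Rightarrow> 'a \<Rightarrow> ('a \<Rightarrow>\<^sub>L 'b)" where
  "DF F x = Blinfun (frechet_derivative F (at x))"

lemma has_gateaux_unique:
  assumes "has_gateaux F L x" "has_gateaux F M x"
  shows "L = M"
proof (rule blinfun_eqI)
  show "L v = M v" for v
    using assms unfolding has_gateaux_def by (meson tendsto_unique trivial_limit_at_right_real)
qed

lemma DG_eq: "has_gateaux F L x \<Longrightarrow> DG F x = L"
  unfolding DG_def by (blast intro: has_gateaux_unique)

lemma DH_eq: "has_hadamard F L x \<Longrightarrow> DH F x = L"
  unfolding DH_def has_hadamard_def by (blast intro: has_gateaux_unique)

lemma DF_eq: "(F has_derivative blinfun_apply L) (at x) \<Longrightarrow> DF F x = L"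
  unfolding DF_def by (metis blinfun_apply_inverse frechet_derivative_at)


section \<open>The Mayer problem\<close>

definition admissible ::
  "real \<Rightarrow> 'e::real_normed_vector set \<Rightarrow> 'u::t2_space set \<Rightarrow> 'e \<Rightarrow> (real \<Rightarrow> 'e \<Rightarrow> 'u \<Rightarrow> 'e) \<Rightarrow>
   nat \<Rightarrow> nat \<Rightarrow> (nat \<Rightarrow> 'e \<Rightarrow> real) \<Rightarrow> (nat \<Rightarrow> 'e \<Rightarrow> real) \<Rightarrow> (real \<Rightarrow> 'e) \<Rightarrow> (real \<Rightarrow> 'u) \<Rightarrow> bool" where
  "admissible T \<Omega> U \<xi>\<^sub>0 f m q g h x u \<longleftrightarrow>
     x \<in> PC1 T \<Omega> \<and> u \<in> NPC0R T U \<and>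
     (\<forall>t\<in>{0..T}. ext_deriv T x t = f t (x t) (u t)) \<and>
     x 0 = \<xi>\<^sub>0 \<and>
     (\<forall>\<alpha>\<in>{1..m}. g \<alpha> (x T) \<ge> 0) \<and>
     (\<forall>\<beta>\<in>{1..q}. h \<beta> (x T) = 0)"

definition mayer_solution ::
  "real \<Rightarrow> 'e::real_normed_vector set \<Rightarrow> 'u::t2_space set \<Rightarrow> 'e \<Rightarrow> (real \<Rightarrow> 'e \<Rightarrow> 'u \<Rightarrow> 'e) \<Rightarrow>
   nat \<Rightarrow> nat \<Rightarrow> (nat \<Rightarrow> 'e \<Rightarrow> real) \<Rightarrow> (nat \<Rightarrow> 'e \<Rightarrow> real) \<Rightarrow> (real \<Rightarrow> 'e) \<Rightarrow> (real \<Rightarrow> 'u) \<Rightarrow> bool" where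
  "mayer_solution T \<Omega> U \<xi>\<^sub>0 f m q g h x\<^sub>0 u\<^sub>0 \<longleftrightarrow>
     admissible T \<Omega> U \<xi>\<^sub>0 f m q g h x\<^sub>0 u\<^sub>0 \<and>
     (\<forall>x u. admissible T \<Omega> U \<xi>\<^sub>0 f m q g h x u \<longrightarrow> g 0 (x T) \<le> g 0 (x\<^sub>0 T))"

definition H\<^sub>M :: "(real \<Rightarrow> 'e::real_normed_vector \<Rightarrow> 'u \<Rightarrow> 'e) \<Rightarrow> real \<Rightarrow> 'e \<Rightarrow> 'u \<Rightarrow> ('e \<Rightarrow>\<^sub>L real) \<Rightarrow> real" where
  "H\<^sub>M f t \<xi> \<zeta> p = p (f t \<xi> \<zeta>)"

definition pontryagin_triple ::
  "real \<Rightarrow> 'u::t2_space set \<Rightarrow> (real \<Rightarrow> 'e::real_normed_vector \<Rightarrow> 'u \<Rightarrow> 'e) \<Rightarrow>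
   nat \<Rightarrow> nat \<Rightarrow> (nat \<Rightarrow> 'e \<Rightarrow> real) \<Rightarrow> (nat \<Rightarrow> 'e \<Rightarrow> real) \<Rightarrow> (real \<Rightarrow> 'e) \<Rightarrow> (real \<Rightarrow> 'u) \<Rightarrow>
   (nat \<Rightarrow> real) \<Rightarrow> (nat \<Rightarrow> real) \<Rightarrow> (real \<Rightarrow> 'e \<Rightarrow>\<^sub>L real) \<Rightarrow> bool" where
  "pontryagin_triple T U f m q g h x\<^sub>0 u\<^sub>0 lam \<mu> p \<longleftrightarrow>
     p \<in> PC1 T UNIV \<and>
     ((\<exists>\<alpha>\<in>{0..m}. lam \<alpha> \<noteq> 0) \<or> (\<exists>\<beta>\<in>{1..q}. \<mu> \<beta> \<noteq> 0)) \<and>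
     (\<forall>\<alpha>\<in>{0..m}. lam \<alpha> \<ge> 0) \<and>
     (\<forall>\<alpha>\<in>{1..m}. lam \<alpha> * g \<alpha> (x\<^sub>0 T) = 0) \<and>
     (\<Sum>\<alpha>=0..m. lam \<alpha> *\<^sub>R DH (g \<alpha>) (x\<^sub>0 T)) + (\<Sum>\<beta>=1..q. \<mu> \<beta> *\<^sub>R DH (h \<beta>) (x\<^sub>0 T)) = p T \<and>
     (\<forall>t\<in>{0..T}. ext_deriv T p t = - DF (\<lambda>\<xi>. H\<^sub>M f t \<xi> (u\<^sub>0 t) (p t)) (x\<^sub>0 t)) \<and>
     (\<forall>t\<in>{0..T}. \<forall>\<zeta>\<in>U. H\<^sub>M f t (x\<^sub>0 t) (u\<^sub>0 t) (p t) \<ge> H\<^sub>M f t (x\<^sub>0 t) \<zeta> (p t)) \<and>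
     continuous_on {0..T} (\<lambda>t. H\<^sub>M f t (x\<^sub>0 t) (u\<^sub>0 t) (p t))"


section \<open>Qualification conditions\<close>

definition QC ::
  "nat \<Rightarrow> nat \<Rightarrow> nat \<Rightarrow> (nat \<Rightarrow> 'e::real_normed_vector \<Rightarrow> real) \<Rightarrow> (nat \<Rightarrow> 'e \<Rightarrow> real) \<Rightarrow> 'e \<Rightarrow> bool" where
  "QC i m q g h xT \<longleftrightarrow>
     (\<forall>c d :: nat \<Rightarrow> real.
        (\<forall>\<alpha>\<in>{i..m}. c \<alpha> \<ge> 0) \<and>
        (\<forall>\<alpha>\<in>{1..m}. c \<alpha> * g \<alpha> xT = 0) \<and>
        (\<Sum>\<alpha>=i..m. c \<alpha> *\<^sub>R DG (g \<alpha>) xT) + (\<Sum>\<beta>=1..q. d \<beta> *\<^sub>R DG (h \<beta>) xT) = 0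
        \<longrightarrow> (\<forall>\<alpha>\<in>{i..m}. c \<alpha> = 0) \<and> (\<forall>\<beta>\<in>{1..q}. d \<beta> = 0))"

definition lin_indep_family :: "'i set \<Rightarrow> ('i \<Rightarrow> 'a::real_vector) \<Rightarrow> bool" where
  "lin_indep_family I v \<longleftrightarrow>
     (\<forall>J c. finite J \<and> J \<subseteq> I \<and> (\<Sum>i\<in>J. c i *\<^sub>R v i) = 0 \<longrightarrow> (\<forall>i\<in>J. c i = 0))"

text \<open>"\<open>U\<close> is a subset of a normed space \<open>Y\<close>" means that the topological space \<open>U\<close> is identified
  with a subset \<open>V\<close> of \<open>Y\<close> by a homeomorphism \<open>\<phi>\<close> with inverse \<open>\<psi>\<close>; for \<open>U \<subseteq> Y\<close> take \<open>V = U\<close>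
  and both maps the identity. The differential with respect to the third variable is taken after
  this identification. Existence of \<open>Y\<close>, \<open>V\<close>, \<open>\<phi>\<close>, \<open>\<psi>\<close> in a hypothesis amounts to universal
  quantification over them outside the implication.\<close>

definition Surj ::
  "real \<Rightarrow> 'u::t2_space set \<Rightarrow> (real \<Rightarrow> 'e::real_normed_vector \<Rightarrow> 'u \<Rightarrow> 'e) \<Rightarrow> (real \<Rightarrow> 'e) \<Rightarrow> (real \<Rightarrow> 'u) \<Rightarrow>
   'y::real_normed_vector set \<Rightarrow> ('u \<Rightarrow> 'y) \<Rightarrow> ('y \<Rightarrow> 'u) \<Rightarrow> bool" where
  "Surj T U f x\<^sub>0 u\<^sub>0 V \<phi> \<psi> \<longleftrightarrow> homeomorphism U V \<phi> \<psi> \<and>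
     (\<exists>t\<in>{0..T}. \<phi> (u\<^sub>0 t) \<in> interior V \<and>
        gateaux_differentiable (\<lambda>y. f t (x\<^sub>0 t) (\<psi> y)) (\<phi> (u\<^sub>0 t)) \<and>
        surj (blinfun_apply (DG (\<lambda>y. f t (x\<^sub>0 t) (\<psi> y)) (\<phi> (u\<^sub>0 t)))))"

definition LI ::
  "real \<Rightarrow> 'u::t2_space set \<Rightarrow> (real \<Rightarrow> 'e::real_normed_vector \<Rightarrow> 'u \<Rightarrow> 'e) \<Rightarrow>
   nat \<Rightarrow> nat \<Rightarrow> (nat \<Rightarrow> 'e \<Rightarrow> real) \<Rightarrow> (nat \<Rightarrow> 'e \<Rightarrow> real) \<Rightarrow> (real \<Rightarrow> 'e) \<Rightarrow> (real \<Rightarrow> 'u) \<Rightarrow>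
   'y::real_normed_vector set \<Rightarrow> ('u \<Rightarrow> 'y) \<Rightarrow> ('y \<Rightarrow> 'u) \<Rightarrow> bool" where
  "LI T U f m q g h x\<^sub>0 u\<^sub>0 V \<phi> \<psi> \<longleftrightarrow> homeomorphism U V \<phi> \<psi> \<and>
     \<phi> (u\<^sub>0 T) \<in> interior V \<and>
     gateaux_differentiable (\<lambda>y. f T (x\<^sub>0 T) (\<psi> y)) (\<phi> (u\<^sub>0 T)) \<and>
     (let D3 = DG (\<lambda>y. f T (x\<^sub>0 T) (\<psi> y)) (\<phi> (u\<^sub>0 T)) in
      lin_indep_family ({1..m} <+> {1..q})
        (case_sum (\<lambda>\<alpha>. DH (g \<alpha>) (x\<^sub>0 T) o\<^sub>L D3) (\<lambda>\<beta>. DH (h \<beta>) (x\<^sub>0 T) o\<^sub>L D3)))"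

end

theory Submission
  imports Defs
begin

text \<open>Parts (i) and (ii) hold because the adjoint equation is linear: a costate that vanishes at one time
  vanishes at all times (\<open>adjoint_zero\<close>), so that \<open>p t = 0\<close> forces \<open>p T = 0\<close>, and the transversality
  condition becomes a relation between the differentials of the constraints that the qualification
  condition excludes. If the control \<open>u\<^sub>0 t\<close> lies in the interior of the control set, then the
  Hamiltonian is stationary there, that is, \<open>p t \<circ> D\<^sub>3 f = 0\<close> (\<open>interior_maximum\<close>). Under (Surj) this
  gives \<open>p t = 0\<close> for some \<open>t\<close>, and then \<open>\<lambda>\<^sub>0 \<noteq> 0\<close> by (i). Under (LI) it shows that \<open>\<lambda>\<^sub>0 \<noteq> 0\<close>, and also
  that two triples with \<open>\<lambda>\<^sub>0 = 1\<close> have the same multipliers; their costates then solve the same linear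
  equation with the same end value. Dividing the multipliers by \<open>\<lambda>\<^sub>0\<close> gives the normalised triple.

  What remains is the existence of some Pontryagin triple, the maximum principle itself, which is proved
  with needle variations. Given finitely many pairs of a time and a control value, the control \<open>u\<^sub>0\<close> is
  replaced by the \<open>i\<close>-th value on an interval of length \<open>a\<^sub>i\<close> right after the \<open>i\<close>-th time. The endpoint
  of the resulting trajectory depends continuously on \<open>a \<ge> 0\<close> (\<open>endpoint_continuous\<close>), and at \<open>a = 0\<close> it
  has the one-sided derivative \<open>\<Sum>i. a\<^sub>i S(t\<^sub>i) (f(t\<^sub>i, x\<^sub>0, \<zeta>\<^sub>i) - f(t\<^sub>i, x\<^sub>0, u\<^sub>0))\<close>, where \<open>S\<close> is the resolvent of
  the linearised equation with \<open>S T = id\<close> (\<open>endpoint_differentiable\<close>).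

  The first-order changes of the objective, the active inequality constraints and the equality
  constraints that can be produced in this way form a convex cone in a finite-dimensional space. If this
  cone, enlarged by lowering the inequality coordinates, were the whole space, then one could prescribe
  every small change of the equality constraints while increasing the objective and the active
  inequalities at a definite rate. A fixed point argument would then yield an admissible process that
  is better than the optimal one (\<open>better_endpoint\<close>). The fixed point theorem is needed because the endpoint map and the
  constraints are differentiable at one point only, which excludes the inverse function theorem; it is
  derived from Kuhn's lemma in a form where the dimension is a variable (\<open>cube_zero\<close>). So the cone is not
  the whole space, and a functional that is nonpositive on it (\<open>cone_separation\<close>) supplies the
  multipliers. Evaluated on a single needle, it says that the costate \<open>p t = p T \<circ> S t\<close> satisfies the
  maximum condition.

  The Gateaux differential of \<open>f\<close> is bounded on compact sets only. A sequence argument turns this into a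
  Lipschitz condition on a tube around \<open>x\<^sub>0\<close> (\<open>tube_lipschitz\<close>), and truncating the state in this tube makes
  all trajectories exist on \<open>[0, T]\<close>.\<close>

section \<open>Piecewise continuous functions\<close>

lemma subdivision_of_finite_set:
  fixes T :: real
  assumes "T > 0" "finite S"
  obtains k \<tau> where "subdivision T k \<tau>" "\<tau> ` {..Suc k} = insert 0 (insert T (S \<inter> {0<..<T}))"
proof -
  define l where "l = sorted_list_of_set (insert 0 (insert T (S \<inter> {0<..<T})))"
  have setl: "set l = insert 0 (insert T (S \<inter> {0<..<T}))"
    unfolding l_def using assms by (intro set_sorted_list_of_set finite.insertI finite_Int) auto
  have sl: "sorted_wrt (<) l" unfolding l_def by (rule strict_sorted_list_of_set)
  have len: "length l \<ge> 2"
  proof -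
    have "card {0,T} \<le> card (set l)" by (rule card_mono[OF finite_set]) (auto simp: setl)
    then show ?thesis using \<open>T>0\<close> by (metis card_2_iff card_length le_trans less_irrefl)
  qed
  define k where "k = length l - 2"
  have lk: "length l = Suc (Suc k)" using len by (simp add: k_def)
  have img: "(\<lambda>i. l ! i) ` {..Suc k} = set l"
    using lk by (metis atLeast_upt lessThan_Suc_atMost map_nth set_map)
  have le: "l ! i \<le> l ! j" if "i \<le> j" "j \<le> Suc k" for i j
    using sl that lk by (cases "i = j") (auto simp: sorted_wrt_iff_nth_less less_imp_le)
  have bnd: "0 \<le> y \<and> y \<le> T" if "y \<in> set l" for y using that setl \<open>T>0\<close> by auto
  have "l ! 0 = 0"
  proof -
    obtain i where "i \<le> Suc k" "l ! i = 0" using img setl by (metis atMost_iff image_iff insertI1)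
    then have "l ! 0 \<le> 0" using le[of 0 i] by simp
    moreover have "0 \<le> l!0" using bnd lk by simp
    ultimately show ?thesis by simp
  qed
  moreover have "l ! Suc k = T"
  proof -
    obtain i where "i \<le> Suc k" "l ! i = T" using img setl by (metis atMost_iff image_iff insertI1 insertI2)
    then have "T \<le> l ! Suc k" using le[of i "Suc k"] by simp
    moreover have "l!Suc k \<le> T" using bnd lk by simp
    ultimately show ?thesis by simp
  qed
  moreover have "l ! i < l ! Suc i" if "i \<le> k" for i
    using sl that lk by (auto simp: sorted_wrt_iff_nth_less)
  ultimately show thesis using that[of k "\<lambda>i. l ! i"] img setl by (simp add: subdivision_def)
qed

lemma subdivision_bounds:
  assumes "subdivision T k \<tau>"
  shows "i \<in> {0..k} \<Longrightarrow> \<tau> i \<in> {0..<T}" and "i \<in> {1..Suc k} \<Longrightarrow> \<tau> i \<in> {0<..T}"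
  using assms subdivision_mono[OF assms, of 0 i] subdivision_mono[OF assms, of i "Suc k"]
  by (cases "i = 0"; cases "i = Suc k"; auto simp: subdivision_def)+

lemma continuous_on_Icc_one_sided:
  fixes x :: "real \<Rightarrow> 'a::topological_space"
  assumes "continuous_on {0..T} x"
  shows "t \<in> {0..<T} \<Longrightarrow> (x \<longlongrightarrow> x t) (at_right t)" and "t \<in> {0<..T} \<Longrightarrow> (x \<longlongrightarrow> x t) (at_left t)"
  using continuous_on_Icc_at_rightD[OF continuous_on_subset[OF assms, of "{t..T}"]]
    continuous_on_Icc_at_leftD[OF continuous_on_subset[OF assms, of "{0..t}"]] by auto

text \<open>A normalised piecewise continuous function, described by one finite exceptional set instead of an
  indexed subdivision: such sets can be enlarged and united freely, which is what pairing two functions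
  or overriding one of them on an interval requires.\<close>

definition pw_cont :: "real \<Rightarrow> 'a::t2_space set \<Rightarrow> (real \<Rightarrow> 'a) \<Rightarrow> bool" where
  "pw_cont T W u \<longleftrightarrow> u ` {0..T} \<subseteq> W \<and> (\<exists>S. finite S \<and> (\<forall>t\<in>{0<..<T} - S. isCont u t)) \<and>
     (\<forall>t\<in>{0..<T}. continuous (at_right t) u) \<and> (\<forall>t\<in>{0<..T}. \<exists>l\<in>W. (u \<longlongrightarrow> l) (at_left t)) \<and>
     continuous (at_left T) u"

lemma pw_cont_exceptE:
  assumes "pw_cont T W u"
  obtains S where "finite S" "\<And>t. t\<in>{0<..<T} - S \<Longrightarrow> isCont u t"
  using assms unfolding pw_cont_def by blast

text \<open>The two alternatives in the definition of \<^const>\<open>PC0\<close> are one: a continuous function satisfies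
  the second with the trivial subdivision \<open>0 < T\<close>.\<close>

lemma PC0_subdivision:
  assumes "T > 0" "x \<in> PC0 T W"
  obtains k \<tau> where "subdivision T k \<tau>" "\<forall>t\<in>{0..T} - \<tau> ` {..Suc k}. isCont x t"
     "\<forall>i\<in>{0..k}. \<exists>l\<in>W. (x \<longlongrightarrow> l) (at_right (\<tau> i))"
     "\<forall>i\<in>{1..Suc k}. \<exists>l\<in>W. (x \<longlongrightarrow> l) (at_left (\<tau> i))"
proof (cases "continuous_on {0..T} x")
  case True
  have W: "x ` {0..T} \<subseteq> W" using assms by (simp add: PC0_def)
  obtain k \<tau> where k: "subdivision T k \<tau>" and im: "\<tau> ` {..Suc k} = {0,T}"
    using subdivision_of_finite_set[OF assms(1), of "{}"] by auto
  show thesis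
  proof (rule that[OF k])
    show "\<forall>t\<in>{0..T} - \<tau> ` {..Suc k}. isCont x t"
      unfolding im using True continuous_on_interior[OF True] by auto
    show "\<forall>i\<in>{0..k}. \<exists>l\<in>W. (x \<longlongrightarrow> l) (at_right (\<tau> i))"
      using continuous_on_Icc_one_sided(1)[OF True subdivision_bounds(1)[OF k]] subdivision_bounds(1)[OF k] W by force
    show "\<forall>i\<in>{1..Suc k}. \<exists>l\<in>W. (x \<longlongrightarrow> l) (at_left (\<tau> i))"
      using continuous_on_Icc_one_sided(2)[OF True subdivision_bounds(2)[OF k]] subdivision_bounds(2)[OF k] W by force
  qed
next
  case False
  then show thesis using assms that unfolding PC0_def by blast
qed

lemma NPC0R_iff:
  assumes "T > 0"
  shows "u \<in> NPC0R T W \<longleftrightarrow> pw_cont T W u"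
proof
  assume u: "u \<in> NPC0R T W"
  then have P: "u \<in> PC0 T W" by (simp add: NPC0R_def)
  have W: "u ` {0..T} \<subseteq> W" using P by (simp add: PC0_def)
  obtain k \<tau> where k: "subdivision T k \<tau>" and c: "\<forall>t\<in>{0..T} - \<tau> ` {..Suc k}. isCont u t"
     and l: "\<forall>i\<in>{1..Suc k}. \<exists>l\<in>W. (u \<longlongrightarrow> l) (at_left (\<tau> i))"
    using PC0_subdivision[OF assms P] by metis
  have "\<exists>l\<in>W. (u \<longlongrightarrow> l) (at_left t)" if t: "t \<in> {0<..T}" for t
  proof (cases "t \<in> \<tau> ` {..Suc k}")
    case True
    then obtain i where i: "t = \<tau> i" "i \<le> Suc k" by auto
    moreover have "i \<noteq> 0" using i k t by (intro notI) (simp add: subdivision_def)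
    ultimately show ?thesis using l by auto
  next
    case False
    then have "isCont u t" using c t by auto
    then have "(u \<longlongrightarrow> u t) (at_left t)" by (simp add: isCont_def filterlim_at_split)
    then show ?thesis using W t by (intro bexI[of _ "u t"]) auto
  qed
  moreover have "\<exists>S. finite S \<and> (\<forall>t\<in>{0<..<T} - S. isCont u t)"
    using c by (intro exI[of _ "\<tau> ` {..Suc k}"]) auto
  ultimately show "pw_cont T W u" using u W by (auto simp: pw_cont_def NPC0R_def)
next
  assume u: "pw_cont T W u"
  then obtain S where S: "finite S" "\<And>t. t\<in>{0<..<T} - S \<Longrightarrow> isCont u t" by (auto simp: pw_cont_def)
  obtain k \<tau> where k: "subdivision T k \<tau>" and im: "\<tau> ` {..Suc k} = insert 0 (insert T (S \<inter> {0<..<T}))"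
    using subdivision_of_finite_set[OF assms S(1)] by metis
  have "isCont u t" if "t\<in>{0..T} - \<tau> ` {..Suc k}" for t
    using that S(2)[of t] unfolding im by fastforce
  moreover have "\<exists>l\<in>W. (u \<longlongrightarrow> l) (at_right (\<tau> i))" if i: "i\<in>{0..k}" for i
  proof -
    have "\<tau> i \<in> {0..<T}" by (rule subdivision_bounds(1)[OF k i])
    then have "(u \<longlongrightarrow> u (\<tau> i)) (at_right (\<tau> i))" "u (\<tau> i) \<in> W"
      using u by (auto simp: pw_cont_def continuous_within)
    then show ?thesis by auto
  qed
  moreover have "\<exists>l\<in>W. (u \<longlongrightarrow> l) (at_left (\<tau> i))" if i: "i\<in>{1..Suc k}" for i
  proof -
    have "\<tau> i \<in> {0<..T}" by (rule subdivision_bounds(2)[OF k i])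
    then show ?thesis using u by (auto simp: pw_cont_def)
  qed
  ultimately have "u \<in> PC0 T W" using u k unfolding PC0_def pw_cont_def by blast
  then show "u \<in> NPC0R T W" using u by (simp add: pw_cont_def NPC0R_def)
qed

text \<open>The reason why left limits are required to lie in \<open>W\<close>: the map \<open>G\<close> is continuous only on \<open>W\<close>,
  so a left limit outside \<open>W\<close> would not be carried to a left limit of the composition.\<close>

lemma pw_cont_compose:
  assumes T: "T > 0" and u: "pw_cont T W u" and G: "continuous_on ({0..T} \<times> W) (\<lambda>(t, z). G t z)"
  shows "pw_cont T UNIV (\<lambda>t. G t (u t))"
proof -
  have W: "\<And>t. t \<in> {0..T} \<Longrightarrow> u t \<in> W" using u by (auto simp: pw_cont_def)
  have key: "((\<lambda>t. G t (u t)) \<longlongrightarrow> G s l) F"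
    if "(u \<longlongrightarrow> l) F" "F \<le> nhds s" "l \<in> W" "s \<in> {0..T}" "eventually (\<lambda>t. t \<in> {0..T}) F" for F s l
  proof -
    have "((\<lambda>t. (\<lambda>(t, z). G t z) (t, u t)) \<longlongrightarrow> (\<lambda>(t, z). G t z) (s, l)) F"
      using that W by (intro continuous_on_tendsto_compose[OF G] tendsto_Pair) 
        (auto simp: filterlim_def elim: eventually_mono)
    then show ?thesis by simp
  qed
  obtain S where S: "finite S" "\<And>t. t\<in>{0<..<T} - S \<Longrightarrow> isCont u t" using u by (auto simp: pw_cont_def)
  have evR: "eventually (\<lambda>r. r \<in> {0..T}) (at_right t)" if "t \<in> {0..<T}" for t
    using that by (subst eventually_at_right[of t T]) (auto intro!: exI[of _ T])
  have evL: "eventually (\<lambda>r. r \<in> {0..T}) (at_left t)" if "t \<in> {0<..T}" for t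
    using that by (subst eventually_at_left[of 0 t]) (auto intro!: exI[of _ 0])
  have nh: "at t within X \<le> nhds t" for t :: real and X by (simp add: at_within_def)
  have "isCont (\<lambda>t. G t (u t)) t" if "t\<in>{0<..<T} - S" for t
    unfolding isCont_def using that S(2)[of t] W
    by (intro key) (auto simp: isCont_def nh eventually_at_filter intro!: eventually_mono[OF eventually_nhds_in_open[of "{0<..<T}" t]])
  moreover have "continuous (at_right t) (\<lambda>t. G t (u t))" if "t\<in>{0..<T}" for t
    unfolding continuous_within using that u W
    by (intro key nh evR) (auto simp: pw_cont_def continuous_within)
  moreover have "\<exists>l. ((\<lambda>t. G t (u t)) \<longlongrightarrow> l) (at_left t)" if t: "t\<in>{0<..T}" for t
  proof -
    obtain l where "l \<in> W" "(u \<longlongrightarrow> l) (at_left t)" using u t unfolding pw_cont_def by blast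
    then have "((\<lambda>t. G t (u t)) \<longlongrightarrow> G t l) (at_left t)" using t by (intro key nh evL) auto
    then show ?thesis ..
  qed
  moreover have "continuous (at_left T) (\<lambda>t. G t (u t))"
    unfolding continuous_within using u W T
    by (intro key nh evL) (auto simp: pw_cont_def continuous_within)
  ultimately show ?thesis using S(1) unfolding pw_cont_def by (intro conjI) auto
qed


lemma pw_cont_mono: "pw_cont T W u \<Longrightarrow> W \<subseteq> W' \<Longrightarrow> pw_cont T W' u"
  unfolding pw_cont_def by blast

text \<open>Properties that pass to a union of two adjacent intervals need only be checked on intervals whose
  interior avoids a given finite set. This replaces induction over the pieces of a subdivision.\<close>

lemma interval_induct_finite:
  fixes a b :: real
  assumes "finite S" "a < b"
    and base: "\<And>c d. a \<le> c \<Longrightarrow> d \<le> b \<Longrightarrow> c < d \<Longrightarrow> {c<..<d} \<inter> S = {} \<Longrightarrow> P c d"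
    and join: "\<And>c d e. a \<le> c \<Longrightarrow> e \<le> b \<Longrightarrow> c < d \<Longrightarrow> d < e \<Longrightarrow> P c d \<Longrightarrow> P d e \<Longrightarrow> P c e"
  shows "P a b"
proof -
  have "P c d" if "a \<le> c" "d \<le> b" "c < d" for c d
    using that
  proof (induction "card ({c<..<d} \<inter> S)" arbitrary: c d rule: less_induct)
    case less
    show ?case
    proof (cases "{c<..<d} \<inter> S = {}")
      case True
      then show ?thesis using base less by blast
    next
      case False
      then obtain e where e: "e \<in> S" "c < e" "e < d" by auto
      have "card ({c<..<e} \<inter> S) < card ({c<..<d} \<inter> S)" "card ({e<..<d} \<inter> S) < card ({c<..<d} \<inter> S)"
        using e assms(1) by (auto intro!: psubset_card_mono)
      then show ?thesis using less e join[of c d e] by simp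
    qed
  qed
  then show ?thesis using assms(2) by simp
qed

text \<open>On a piece without interior exceptional points, replacing the value at the right end by the left
  limit gives a continuous function on a compact interval.\<close>

lemma pw_cont_piece:
  assumes u: "pw_cont T W u" and S: "\<And>t. t\<in>{0<..<T} - S \<Longrightarrow> isCont u t"
    and cd: "0 \<le> c" "d \<le> T" "c < d" "{c<..<d} \<inter> S = {}"
  obtains v where "continuous_on {c..d} v" "v ` {c..d} \<subseteq> W" "\<And>t. c \<le> t \<Longrightarrow> t < d \<Longrightarrow> v t = u t"
proof -
  obtain l where l: "l \<in> W" "(u \<longlongrightarrow> l) (at_left d)"
    using u cd unfolding pw_cont_def by (metis atLeastAtMost_iff greaterThanAtMost_iff le_less_trans)
  define v where "v = u(d := l)"
  have veq: "v t = u t" if "t < d" for t using that by (simp add: v_def)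
  have "continuous_on {c..d} v"
  proof (rule continuous_on_IccI)
    have "(u \<longlongrightarrow> u c) (at_right c)" using u cd by (auto simp: pw_cont_def continuous_within)
    then show "(v \<longlongrightarrow> v c) (at_right c)"
      using cd(3) unfolding veq[OF cd(3)]
      by (rule_tac Lim_transform_eventually) (auto simp: eventually_at_right veq intro: exI[of _ d])
    show "(v \<longlongrightarrow> v d) (at_left d)"
      using l(2) cd(3) by (rule_tac Lim_transform_eventually)
         (auto simp: v_def eventually_at_left intro: exI[of _ c])
    fix t assume t: "c < t" "t < d"
    then have "u \<midarrow>t\<rightarrow> u t" using S[of t] cd unfolding isCont_def by (metis DiffI IntI empty_iff greaterThanLessThan_iff le_less_trans less_le_trans)
    then show "v \<midarrow>t\<rightarrow> v t" unfolding veq[OF t(2)]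
      by (rule Lim_transform_eventually)
        (use t in \<open>auto simp: veq eventually_at_filter intro!: eventually_mono[OF eventually_nhds_in_open[of "{..<d}" t]]\<close>)
  qed (fact cd)
  moreover have "v ` {c..d} \<subseteq> W"
    using u cd l by (auto simp: v_def pw_cont_def)
  ultimately show thesis using that veq by blast
qed

text \<open>The range is covered by the images of finitely many compact pieces. This compact set is the one on
  which the bounds for \<open>f\<close> are used; left limits belong to it because it is closed.\<close>

lemma pw_cont_compact_range:
  assumes T: "T > 0" and u: "pw_cont T W u"
  obtains M where "compact M" "M \<subseteq> W" "pw_cont T M u"
proof -
  obtain S where S: "finite S" "\<And>t. t\<in>{0<..<T} - S \<Longrightarrow> isCont u t" using u by (auto simp: pw_cont_def)
  define P where "P c d \<longleftrightarrow> (\<exists>M. compact M \<and> M \<subseteq> W \<and> u ` {c..<d} \<subseteq> M)" for c d :: real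
  have "P 0 T"
  proof (rule interval_induct_finite[OF S(1) T])
    fix c d assume cd: "0 \<le> c" "d \<le> T" "c < d" "{c<..<d} \<inter> S = {}"
    obtain v where v: "continuous_on {c..d} v" "v ` {c..d} \<subseteq> W" "\<And>t. c \<le> t \<Longrightarrow> t < d \<Longrightarrow> v t = u t"
      using pw_cont_piece[OF u S(2) cd] by metis
    have "u ` {c..<d} \<subseteq> v ` {c..d}" using v(3) by (force simp: image_iff)
    then show "P c d" using v compact_continuous_image[OF v(1)] unfolding P_def by blast
  next
    fix c d e assume *: "P c d" "P d e" "c < d" "d < e" 
    then obtain M N where "compact M" "M \<subseteq> W" "u ` {c..<d} \<subseteq> M" "compact N" "N \<subseteq> W" "u ` {d..<e} \<subseteq> N"
      unfolding P_def by blast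
    moreover have "{c..<e} = {c..<d} \<union> {d..<e}" using * by auto
    ultimately show "P c e" unfolding P_def by (intro exI[of _ "M \<union> N"]) auto
  qed
  then obtain M0 where M0: "compact M0" "M0 \<subseteq> W" "u ` {0..<T} \<subseteq> M0" unfolding P_def by auto
  define M where "M = insert (u T) M0"
  have "compact M" by (simp add: M_def M0)
  moreover have "M \<subseteq> W" using M0 u T by (auto simp: M_def pw_cont_def)
  moreover have uM: "u ` {0..T} \<subseteq> M"
  proof
    fix y assume "y \<in> u ` {0..T}"
    then obtain t where "y = u t" "0 \<le> t" "t \<le> T" by auto
    then show "y \<in> M" using M0(3) by (cases "t = T") (auto simp: M_def image_subset_iff)
  qed
  moreover have "\<exists>l\<in>M. (u \<longlongrightarrow> l) (at_left t)" if t: "t\<in>{0<..T}" for t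
  proof -
    obtain l where l: "l \<in> W" "(u \<longlongrightarrow> l) (at_left t)" using u t unfolding pw_cont_def by blast
    have "eventually (\<lambda>s. u s \<in> M) (at_left t)"
      using t uM by (subst eventually_at_left[of 0 t]) (auto intro!: exI[of _ 0])
    then have "l \<in> M"
      using Lim_in_closed_set[OF compact_imp_closed[OF \<open>compact M\<close>] _ _ l(2)] by simp
    then show ?thesis using l(2) by blast
  qed
  ultimately have "pw_cont T M u" using u unfolding pw_cont_def by (intro conjI ballI) simp_all
  with \<open>compact M\<close> \<open>M \<subseteq> W\<close> show thesis by (rule that)
qed

lemma pw_cont_bounded:
  fixes v :: "real \<Rightarrow> 'a::real_normed_vector"
  assumes T: "T > 0" and u: "pw_cont T W v"
  obtains B where "B > 0" "\<And>t. t \<in> {0..T} \<Longrightarrow> norm (v t) \<le> B"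
proof -
  obtain M where "compact M" "pw_cont T M v" using pw_cont_compact_range[OF assms] by metis
  then obtain B where "B > 0" "\<forall>x\<in>M. norm x \<le> B"
    using compact_imp_bounded bounded_pos by metis
  then show thesis using that[of B] \<open>pw_cont T M v\<close> by (auto simp: pw_cont_def image_subset_iff)
qed

lemma pw_cont_integrable:
  fixes v :: "real \<Rightarrow> 'a::banach"
  assumes T: "T > 0" and u: "pw_cont T W v"
  shows "v integrable_on {0..T}"
proof -
  obtain S where S: "finite S" "\<And>t. t\<in>{0<..<T} - S \<Longrightarrow> isCont v t" using u by (auto simp: pw_cont_def)
  show ?thesis
  proof (rule interval_induct_finite[OF S(1) T, where P = "\<lambda>c d. v integrable_on {c..d}"])
    fix c d assume cd: "0 \<le> c" "d \<le> T" "c < d" "{c<..<d} \<inter> S = {}"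
    obtain w where w: "continuous_on {c..d} w" "\<And>t. c \<le> t \<Longrightarrow> t < d \<Longrightarrow> w t = v t"
      using pw_cont_piece[OF u S(2) cd] by metis
    show "v integrable_on {c..d}"
      by (rule integrable_spike_finite[OF _ _ integrable_continuous_real[OF w(1)], of "{d}"]) (auto simp: w)
  next
    fix c d e assume "v integrable_on {c..d}" "v integrable_on {d..e}" "c < d" "d < e"
    then show "v integrable_on {c..e}" by (intro Henstock_Kurzweil_Integration.integrable_combine[where a=c and b=e and c=d]) auto
  qed
qed

lemma pw_cont_integrable':
  fixes v :: "real \<Rightarrow> 'a::banach"
  assumes "T > 0" "pw_cont T W v" "0 \<le> a" "b \<le> T"
  shows "v integrable_on {a..b}"
  by (rule integrable_subinterval_real[OF pw_cont_integrable[OF assms(1,2)]]) (use assms in auto)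

text \<open>The primitive of \<open>v\<close> has right derivative \<open>v t\<close> by right continuity and left derivative the left
  limit of \<open>v\<close>: changing \<open>v\<close> at the single point \<open>t\<close> does not change the integral. Thus the ordinary
  differential equation in the sense of the extended derivative is equivalent to an integral
  equation; the converse direction is \<open>PC1_integral\<close>.\<close>

lemma integral_pw_cont:
  fixes v :: "real \<Rightarrow> 'a::banach"
  assumes T: "T > 0" and v: "pw_cont T UNIV v"
    and x: "\<And>t. t \<in> {0..T} \<Longrightarrow> x t = c + integral {0..t} v"
  shows "x ` {0..T} \<subseteq> W \<Longrightarrow> x \<in> PC1 T W"
    and "t \<in> {0..T} \<Longrightarrow> ext_deriv T x t = v t"
    and "t \<in> {0<..<T} \<Longrightarrow> isCont v t \<Longrightarrow> (x has_vector_derivative v t) (at t)"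
proof -
  note int = pw_cont_integrable[OF T v]
  have cont: "continuous_on {0..T} x"
    using continuous_on_add[OF continuous_on_const indefinite_integral_continuous_1[OF int]]
    by (rule continuous_on_eq) (use x in auto)
  have shift: "x r = x a + integral {a..r} v" if "0 \<le> a" "a \<le> r" "r \<le> T" for a r
  proof -
    have "integral {0..a} v + integral {a..r} v = integral {0..r} v"
      using that by (intro Henstock_Kurzweil_Integration.integral_combine pw_cont_integrable'[OF T v]) auto
    then show ?thesis using x[of r] x[of a] that by (simp add: algebra_simps)
  qed
  have R: "(x has_vector_derivative v t) (at t within {t..T})" if t: "0 \<le> t" "t < T" for t
  proof -
    have "((\<lambda>r. integral {t..r} v) has_vector_derivative v t) (at t within {t..T} - {})"
      using t v by (intro integral_has_vector_derivative_continuous_at pw_cont_integrable'[OF T v])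
        (auto simp: pw_cont_def at_within_Icc_at_right)
    then have "((\<lambda>r. x t + integral {t..r} v) has_vector_derivative v t) (at t within {t..T})"
      by (auto intro: derivative_eq_intros)
    then show ?thesis
      by (rule has_vector_derivative_transform[rotated 2]) (use t in \<open>auto intro: shift[of t]\<close>)
  qed
  have L: "(x has_vector_derivative l) (at t within {0..t})" if t: "0 < t" "t \<le> T" and l: "(v \<longlongrightarrow> l) (at_left t)" for t l
  proof -
    define w where "w = v(t := l)"
    have w: "integral {0..r} w = integral {0..r} v" for r
      by (rule integral_spike[of "{t}"]) (auto simp: w_def)
    have wi: "w integrable_on {0..t}"
      using pw_cont_integrable'[OF T v, of 0 t] t by (rule_tac integrable_spike[of v "{0..t}" "{t}"]) (auto simp: w_def)
    have "(w \<longlongrightarrow> w t) (at_left t)"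
      using l t by (rule_tac Lim_transform_eventually)
         (auto simp: w_def eventually_at_left intro: exI[of _ 0])
    then have "((\<lambda>r. integral {0..r} w) has_vector_derivative w t) (at t within {0..t} - {})"
      using t wi by (intro integral_has_vector_derivative_continuous_at)
        (auto simp: continuous_within at_within_Icc_at_left)
    then have "((\<lambda>r. c + integral {0..r} v) has_vector_derivative l) (at t within {0..t})"
      unfolding w by (auto simp: w_def intro: derivative_eq_intros)
    then show ?thesis
      by (rule has_vector_derivative_transform[rotated 2]) (use t x in auto)
  qed
  have D: "(x has_vector_derivative v t) (at t)" if t: "t \<in> {0<..<T}" "isCont v t" for t
  proof -
    have "((\<lambda>r. integral {0..r} v) has_vector_derivative v t) (at t within {0..T} - {})"
      using t by (intro integral_has_vector_derivative_continuous_at int)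
        (auto intro: continuous_at_imp_continuous_at_within)
    then have "((\<lambda>r. c + integral {0..r} v) has_vector_derivative v t) (at t within {0..T})"
      by (auto intro: derivative_eq_intros)
    then have "(x has_vector_derivative v t) (at t within {0..T})"
      by (rule has_vector_derivative_transform[rotated 2]) (use t x in auto)
    then show ?thesis using t(1) by (simp add: at_within_Icc_at)
  qed
  show "(x has_vector_derivative v t) (at t)" if "t \<in> {0<..<T}" "isCont v t" by (rule D[OF that])
  show "ext_deriv T x t = v t" if t: "t \<in> {0..T}"
  proof (cases "t < T")
    case True
    then show ?thesis using vector_derivative_within_cbox[of t T t x "v t"] R[of t] t by (simp add: ext_deriv_def)
  next
    case False
    then have "t = T" using t by simp
    have "(v \<longlongrightarrow> v T) (at_left T)" using v by (simp add: pw_cont_def continuous_within)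
    then show ?thesis using vector_derivative_within_cbox[of 0 T T x "v T"] L[of T "v T"] T \<open>t = T\<close> by (simp add: ext_deriv_def)
  qed
  obtain S where S: "finite S" "\<And>t. t\<in>{0<..<T} - S \<Longrightarrow> isCont v t" using v by (auto simp: pw_cont_def)
  obtain k \<tau> where k: "subdivision T k \<tau>" and im: "\<tau> ` {..Suc k} = insert 0 (insert T (S \<inter> {0<..<T}))"
    using subdivision_of_finite_set[OF T S(1)] by metis
  have D': "(x has_vector_derivative v t) (at t)" "isCont v t" if "t \<in> {0..T} - \<tau> ` {..Suc k}" for t
  proof -
    have "t \<in> {0<..<T} - S" using that unfolding im by fastforce
    then show "(x has_vector_derivative v t) (at t)" "isCont v t" using D S(2) by auto
  qed
  have fin: "finite (\<tau> ` {..Suc k})" by simp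
  have C1: "x C1_differentiable_on ({0..T} - \<tau> ` {..Suc k})"
    unfolding C1_differentiable_on_def using D' by (intro exI[of _ v]) (auto intro: continuous_at_imp_continuous_on)
  have evR: "eventually (\<lambda>s. vector_derivative x (at s) = v s) (at_right t)" if "t \<in> {0..<T}" for t
  proof -
    have "eventually (\<lambda>s. s \<in> {..<T} - (\<tau> ` {..Suc k} - {t})) (nhds t)"
      using that fin by (intro eventually_nhds_in_open open_Diff finite_imp_closed) auto
    then show ?thesis unfolding eventually_at_filter
      by (rule eventually_mono) (use that in \<open>auto intro!: vector_derivative_at D'(1)\<close>)
  qed
  have evL: "eventually (\<lambda>s. vector_derivative x (at s) = v s) (at_left t)" if "t \<in> {0<..T}" for t
  proof -
    have "eventually (\<lambda>s. s \<in> {0<..} - (\<tau> ` {..Suc k} - {t})) (nhds t)"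
      using that fin by (intro eventually_nhds_in_open open_Diff finite_imp_closed) auto
    then show ?thesis unfolding eventually_at_filter
      by (rule eventually_mono) (use that in \<open>auto intro!: vector_derivative_at D'(1)\<close>)
  qed
  have R': "\<exists>d. (x has_vector_derivative d) (at (\<tau> i) within {\<tau> i..T}) \<and>
                ((\<lambda>t. vector_derivative x (at t)) \<longlongrightarrow> d) (at_right (\<tau> i))" if i: "i \<in> {0..k}" for i
  proof -
    have t: "\<tau> i \<in> {0..<T}" by (rule subdivision_bounds(1)[OF k i])
    then have "(v \<longlongrightarrow> v (\<tau> i)) (at_right (\<tau> i))"
      using v by (auto simp: pw_cont_def continuous_within)
    then have "((\<lambda>t. vector_derivative x (at t)) \<longlongrightarrow> v (\<tau> i)) (at_right (\<tau> i))"
      by (rule Lim_transform_eventually) (use evR[OF t] in \<open>auto elim: eventually_mono\<close>)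
    then show ?thesis using R[of "\<tau> i"] t by auto
  qed
  have L': "\<exists>d. (x has_vector_derivative d) (at (\<tau> i) within {0..\<tau> i}) \<and>
                ((\<lambda>t. vector_derivative x (at t)) \<longlongrightarrow> d) (at_left (\<tau> i))" if i: "i \<in> {1..Suc k}" for i
  proof -
    have t: "\<tau> i \<in> {0<..T}" by (rule subdivision_bounds(2)[OF k i])
    then obtain l where l: "(v \<longlongrightarrow> l) (at_left (\<tau> i))"
      using v unfolding pw_cont_def by blast
    then have "((\<lambda>t. vector_derivative x (at t)) \<longlongrightarrow> l) (at_left (\<tau> i))"
      by (rule Lim_transform_eventually) (use evL[OF t] in \<open>auto elim: eventually_mono\<close>)
    then show ?thesis using L[OF _ _ l] t by auto
  qed
  show "x \<in> PC1 T W" if "x ` {0..T} \<subseteq> W"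
    using that cont k C1 R' L' unfolding PC1_def by blast
qed

lemma PC1_integral:
  fixes x :: "real \<Rightarrow> 'a::banach"
  assumes T: "T > 0" and x: "x \<in> PC1 T W" and st: "0 \<le> s" "s \<le> t" "t \<le> T"
  shows "(ext_deriv T x has_integral (x t - x s)) {s..t}" "continuous_on {0..T} x"
proof -
  show c: "continuous_on {0..T} x" using x by (simp add: PC1_def)
  have "\<exists>S. finite S \<and> (\<forall>t\<in>{0<..<T}-S. (x has_vector_derivative ext_deriv T x t) (at t))"
  proof (cases "\<exists>x'. (\<forall>t\<in>{0..T}. (x has_vector_derivative x' t) (at t within {0..T})) \<and> continuous_on {0..T} x'")
    case True
    then obtain x' where x': "\<And>t. t\<in>{0..T} \<Longrightarrow> (x has_vector_derivative x' t) (at t within {0..T})" by blast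
    have "(x has_vector_derivative ext_deriv T x t) (at t)" if t: "t \<in> {0<..<T}" for t
    proof -
      have "(x has_vector_derivative x' t) (at t within {t..T})"
        by (rule has_vector_derivative_within_subset[OF x']) (use t in auto)
      then have "ext_deriv T x t = x' t"
        using vector_derivative_within_cbox[of t T t x "x' t"] t by (simp add: ext_deriv_def)
      then show ?thesis using x'[of t] t by (simp add: at_within_Icc_at)
    qed
    then show ?thesis by (intro exI[of _ "{}"]) auto
  next
    case False
    then obtain k \<tau> where k: "subdivision T k \<tau>" and C1: "x C1_differentiable_on ({0..T} - \<tau> ` {..Suc k})"
      using x unfolding PC1_def by blast
    have "(x has_vector_derivative ext_deriv T x t) (at t)" if t: "t \<in> {0<..<T} - \<tau> ` {..Suc k}" for t
    proof -
      have t': "t \<in> {0..T} - \<tau> ` {..Suc k}" using t by auto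
      then show ?thesis using C1 ext_deriv_subdivision(1)[OF k C1 t'] unfolding C1_differentiable_on_def
        by (metis vector_derivative_at)
    qed
    then show ?thesis by (intro exI[of _ "\<tau> ` {..Suc k}"]) auto
  qed
  then obtain S where "finite S" "\<And>t. t\<in>{0<..<T}-S \<Longrightarrow> (x has_vector_derivative ext_deriv T x t) (at t)" by auto
  then show "(ext_deriv T x has_integral (x t - x s)) {s..t}"
    using st by (intro fundamental_theorem_of_calculus_interior_strong[of S]) (auto intro: continuous_on_subset[OF c])
qed

lemma pw_cont_continuous:
  assumes T: "T > 0" and x: "continuous_on {0..T} x" "x ` {0..T} \<subseteq> W"
  shows "pw_cont T W x"
proof -
  note R = continuous_on_Icc_one_sided(1)[OF x(1)] and L = continuous_on_Icc_one_sided(2)[OF x(1)]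
  have "isCont x t" if "t \<in> {0<..<T}" for t using continuous_on_interior[OF x(1)] that by auto
  moreover have "\<exists>l\<in>W. (x \<longlongrightarrow> l) (at_left t)" if "t \<in> {0<..T}" for t
    using L[OF that] x(2) that by (intro bexI[of _ "x t"]) auto
  ultimately show ?thesis
    using R L T x(2) unfolding pw_cont_def by (intro conjI exI[of _ "{}"]) (auto simp: continuous_within)
qed

lemma pw_cont_Pair:
  assumes "pw_cont T W a" "pw_cont T W' b"
  shows "pw_cont T (W \<times> W') (\<lambda>t. (a t, b t))"
proof -
  obtain S where S: "finite S" "\<And>t. t\<in>{0<..<T} - S \<Longrightarrow> isCont a t"
    using pw_cont_exceptE[OF assms(1)] by metis
  obtain S' where S': "finite S'" "\<And>t. t\<in>{0<..<T} - S' \<Longrightarrow> isCont b t"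
    using pw_cont_exceptE[OF assms(2)] by metis
  have "\<exists>S. finite S \<and> (\<forall>t\<in>{0<..<T} - S. isCont (\<lambda>t. (a t, b t)) t)"
    using S S' by (intro exI[of _ "S \<union> S'"]) (auto intro!: continuous_Pair)
  moreover have "\<exists>l\<in>W \<times> W'. ((\<lambda>t. (a t, b t)) \<longlongrightarrow> l) (at_left t)" if t: "t\<in>{0<..T}" for t
  proof -
    obtain l l' where "l \<in> W" "(a \<longlongrightarrow> l) (at_left t)" "l' \<in> W'" "(b \<longlongrightarrow> l') (at_left t)"
      using assms t unfolding pw_cont_def by blast
    then show ?thesis by (intro bexI[of _ "(l, l')"] tendsto_Pair) auto
  qed
  ultimately show ?thesis using assms unfolding pw_cont_def
    by (intro conjI) (auto intro!: continuous_Pair)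
qed

lemma pw_cont_binop:
  assumes "T > 0" "pw_cont T W a" "pw_cont T W' b" "continuous_on (W \<times> W') (\<lambda>(x, y). op x y)"
  shows "pw_cont T UNIV (\<lambda>t. op (a t) (b t))"
  using pw_cont_compose[OF assms(1) pw_cont_Pair[OF assms(2,3)], of "\<lambda>t (x, y). op x y"]
    continuous_on_compose2[OF assms(4), of "{0..T} \<times> W \<times> W'" snd]
  by (auto simp: case_prod_unfold continuous_on_snd)

lemma
  fixes a b :: "real \<Rightarrow> 'a::real_normed_vector"
  assumes T: "T > 0" and a: "pw_cont T W a" 
  shows pw_cont_diff: "pw_cont T W' b \<Longrightarrow> pw_cont T UNIV (\<lambda>t. a t - b t)"
    and pw_cont_norm: "pw_cont T UNIV (\<lambda>t. norm (a t))"
    and pw_cont_minus: "pw_cont T UNIV (\<lambda>t. - a t)"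
proof -
  show "pw_cont T W' b \<Longrightarrow> pw_cont T UNIV (\<lambda>t. a t - b t)"
    by (rule pw_cont_binop[OF T a]) (auto simp: case_prod_unfold intro!: continuous_intros)
  show "pw_cont T UNIV (\<lambda>t. norm (a t))" "pw_cont T UNIV (\<lambda>t. - a t)"
    by (rule pw_cont_compose[OF T a]; auto simp: case_prod_unfold intro!: continuous_intros)+
qed

lemma pw_cont_blinfun_apply:
  fixes S :: "real \<Rightarrow> 'a::real_normed_vector \<Rightarrow>\<^sub>L 'b::real_normed_vector"
  shows "T > 0 \<Longrightarrow> pw_cont T W S \<Longrightarrow> pw_cont T W' a \<Longrightarrow> pw_cont T UNIV (\<lambda>t. blinfun_apply (S t) (a t))"
  by (rule pw_cont_binop) (auto simp: case_prod_unfold intro!: continuous_intros)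

lemma pw_cont_compose_blinfun:
  fixes S :: "real \<Rightarrow> 'a::real_normed_vector \<Rightarrow>\<^sub>L 'b::real_normed_vector"
  shows "T > 0 \<Longrightarrow> pw_cont T W S \<Longrightarrow> pw_cont T W' a \<Longrightarrow> pw_cont T UNIV (\<lambda>t. S t o\<^sub>L a t)"
  by (rule pw_cont_binop) (auto simp: case_prod_unfold intro!: continuous_intros)

text \<open>Overriding on \<open>[c, d[\<close> keeps right continuity because the interval is closed on the left and open
  on the right, and keeps left continuity at \<open>T\<close> because \<open>d < T\<close>. This makes needle variations of a
  normalised control normalised again.\<close>

lemma pw_cont_override:
  assumes u: "pw_cont T W u" and z: "z \<in> W" and cd: "0 \<le> c" "d < T"
  shows "pw_cont T W (\<lambda>t. if t \<in> {c..<d} then z else u t)"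
proof -
  let ?v = "\<lambda>t. if t \<in> {c..<d} then z else u t"
  obtain S where S: "finite S" "\<And>t. t\<in>{0<..<T} - S \<Longrightarrow> isCont u t" using u unfolding pw_cont_def by metis
  have near: "eventually (\<lambda>s. ?v s = z) F \<Longrightarrow> (?v \<longlongrightarrow> z) F"
    "eventually (\<lambda>s. ?v s = u s) F \<Longrightarrow> (u \<longlongrightarrow> l) F \<Longrightarrow> (?v \<longlongrightarrow> l) F" for F l
    by (rule Lim_transform_eventually[OF tendsto_const]; auto elim: eventually_mono)
       (rule Lim_transform_eventually; auto elim: eventually_mono)
  have right: "eventually (\<lambda>s. s \<in> {c..<d}) (at_right t)" if "t \<in> {c..<d}" for t
    using that by (auto simp: eventually_at_right[of t d] intro!: exI[of _ d])
  have right': "eventually (\<lambda>s. s \<notin> {c..<d}) (at_right t)" if "t \<notin> {c..<d}" for t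
  proof (cases "t < c")
    case True then show ?thesis by (auto simp: eventually_at_right[of t c] intro!: exI[of _ c])
  next
    case False then show ?thesis using that by (auto simp: eventually_at_right[of t "t + 1"] intro!: exI[of _ "t + 1"])
  qed
  have left: "eventually (\<lambda>s. s \<in> {c..<d}) (at_left t)" if "t \<in> {c<..d}" for t
    using that by (auto simp: eventually_at_left[of c t] intro!: exI[of _ c])
  have left': "eventually (\<lambda>s. s \<notin> {c..<d}) (at_left t)" if "t \<notin> {c<..d}" for t
  proof (cases "d < t")
    case True then show ?thesis by (auto simp: eventually_at_left[of d t] intro!: exI[of _ d])
  next
    case False then show ?thesis using that by (auto simp: eventually_at_left[of "t - 1" t] intro!: exI[of _ "t - 1"])
  qed
  have "isCont ?v t" if "t \<in> {0<..<T} - (S \<union> {c,d})" for t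
  proof (cases "t \<in> {c..<d}")
    case True
    then have "eventually (\<lambda>s. ?v s = z) (at t)"
      using that left[of t] right[of t] unfolding eventually_at_split by (auto elim: eventually_mono)
    then show ?thesis using near(1) True by (simp add: isCont_def)
  next
    case False
    then have "eventually (\<lambda>s. s \<notin> {c..<d}) (at t)"
      using that left'[of t] right'[of t] unfolding eventually_at_split by (auto elim: eventually_mono)
    then have "eventually (\<lambda>s. ?v s = u s) (at t)" by (auto elim: eventually_mono)
    then show ?thesis using near(2) False S(2)[of t] that by (auto simp: isCont_def)
  qed
  moreover have "continuous (at_right t) ?v" if "t \<in> {0..<T}" for t
  proof (cases "t \<in> {c..<d}")
    case True
    then have "eventually (\<lambda>s. ?v s = z) (at_right t)"
      using right[of t] by (auto elim: eventually_mono)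
    then show ?thesis using near(1) True by (simp add: continuous_within)
  next
    case False
    then have "eventually (\<lambda>s. ?v s = u s) (at_right t)"
      using right'[of t] by (auto elim: eventually_mono)
    then show ?thesis using near(2)[of "at_right t" "u t"] False u that by (auto simp: continuous_within pw_cont_def)
  qed
  moreover have "\<exists>l\<in>W. (?v \<longlongrightarrow> l) (at_left t)" if t: "t \<in> {0<..T}" for t
  proof (cases "t \<in> {c<..d}")
    case True
    then have "eventually (\<lambda>s. ?v s = z) (at_left t)"
      using left[of t] by (auto elim: eventually_mono)
    then show ?thesis using near(1) z by blast
  next
    case False
    then have *: "eventually (\<lambda>s. ?v s = u s) (at_left t)"
      using left'[of t] by (auto elim: eventually_mono)
    obtain l where "l \<in> W" "(u \<longlongrightarrow> l) (at_left t)" using u t unfolding pw_cont_def by metis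
    then show ?thesis using near(2)[OF *] by blast
  qed
  moreover have "continuous (at_left T) ?v"
  proof -
    have "eventually (\<lambda>s. ?v s = u s) (at_left T)"
      using left'[of T] cd by (auto elim: eventually_mono)
    then show ?thesis using near(2)[of "at_left T" "u T"] cd u by (auto simp: continuous_within pw_cont_def)
  qed
  moreover have "?v ` {0..T} \<subseteq> W" using u z by (auto simp: pw_cont_def)
  ultimately show ?thesis using S(1) unfolding pw_cont_def by (intro conjI ballI exI[of _ "S \<union> {c,d}"]) auto
qed

lemma has_integral_indicator_Ico:
  fixes v :: "real \<Rightarrow> 'b::banach"
  assumes "v integrable_on {c..d}" "a \<le> c" "d \<le> b"
  shows "((\<lambda>s. indicat_real {c..<d} s *\<^sub>R v s) has_integral integral {c..d} v) {a..b}"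
proof -
  have "((\<lambda>s. if s \<in> {c..d} then v s else 0) has_integral integral {c..d} v) {a..b}"
    using assms by (subst has_integral_restrict) (auto intro: integrable_integral)
  then show ?thesis
    by (rule has_integral_spike_finite[of "{d}", rotated 2]) (auto simp: indicator_def)
qed

text \<open>Intervals that shrink to \<open>t\<close> from the right see only the right limit \<open>G t\<close>; it does not matter
  that they may start strictly after \<open>t\<close>.\<close>

lemma average_over_shrinking_interval:
  fixes G :: "real \<Rightarrow> 'b::banach"
  assumes T: "T > 0" and G: "pw_cont T UNIV G" and t: "0 \<le> t" "t < T"
    and c: "c \<longlonglongrightarrow> t" "\<And>k. c k \<ge> t" and l: "l \<longlonglongrightarrow> a" "\<And>k. l k \<ge> 0"
    and e: "e \<longlonglongrightarrow> 0" "\<And>k. e k > 0" and le: "\<And>k. c k + e k * l k \<le> T"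
  shows "(\<lambda>k. (1 / e k) *\<^sub>R integral {c k..c k + e k * l k} G) \<longlonglongrightarrow> a *\<^sub>R G t"
proof -
  obtain B where B: "B > 0" "\<And>k. l k \<le> B"
    using convergent_imp_Bseq[OF convergentI[OF l(1)]] unfolding Bseq_def by (metis abs_le_D1 real_norm_def)
  have "(\<lambda>k. (1 / e k) *\<^sub>R integral {c k..c k + e k * l k} G - l k *\<^sub>R G t) \<longlonglongrightarrow> 0"
  proof (rule metric_LIMSEQ_I, goal_cases)
    case (1 \<epsilon>)
    define \<epsilon>' where "\<epsilon>' = \<epsilon> / (2 * B)"
    have \<epsilon>': "\<epsilon>' > 0" using 1 B by (simp add: \<epsilon>'_def)
    have "(G \<longlongrightarrow> G t) (at_right t)" using G t by (auto simp: pw_cont_def continuous_within)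
    then have "eventually (\<lambda>s. dist (G s) (G t) < \<epsilon>') (at_right t)" using \<epsilon>' by (rule tendstoD)
    then obtain \<delta> where d: "\<delta> > t" "\<And>s. t < s \<Longrightarrow> s < \<delta> \<Longrightarrow> dist (G s) (G t) < \<epsilon>'"
      by (subst (asm) eventually_at_right[of t "t + 1"]) auto
    have "(\<lambda>k. c k + e k * l k) \<longlonglongrightarrow> t + 0 * a" by (intro tendsto_intros c e l)
    then have "eventually (\<lambda>k. c k + e k * l k < \<delta>) sequentially" using d by (intro order_tendstoD) auto
    then obtain n where n: "\<And>k. k \<ge> n \<Longrightarrow> c k + e k * l k < \<delta>" by (auto simp: eventually_sequentially)
    have "dist ((1 / e k) *\<^sub>R integral {c k..c k + e k * l k} G - l k *\<^sub>R G t) 0 < \<epsilon>" if k: "k \<ge> n" for k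
    proof -
      have cc: "c k \<le> c k + e k * l k" using e(2)[of k] l(2)[of k] by simp
      have int: "G integrable_on {c k..c k + e k * l k}"
        using c(2)[of k] t le[of k] by (intro pw_cont_integrable'[OF T G]) auto
      have "integral {c k..c k + e k * l k} G - (e k * l k) *\<^sub>R G t = integral {c k..c k + e k * l k} (\<lambda>s. G s - G t)"
        using int cc by (subst integral_diff) auto
      also have "norm \<dots> \<le> integral {c k..c k + e k * l k} (\<lambda>s. \<epsilon>')"
      proof (rule integral_norm_bound_integral)
        show "(\<lambda>s. G s - G t) integrable_on {c k..c k + e k * l k}" using int by (intro integrable_diff) auto
        fix s assume s: "s \<in> {c k..c k + e k * l k}"
        show "norm (G s - G t) \<le> \<epsilon>'"
          using d(2)[of s] s n[OF k] c(2)[of k] \<epsilon>' by (cases "s = t") (auto simp: dist_norm less_imp_le)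
      qed auto
      also have "\<dots> = \<epsilon>' * (e k * l k)" using cc by simp
      finally have *: "norm (integral {c k..c k + e k * l k} G - (e k * l k) *\<^sub>R G t) \<le> \<epsilon>' * (e k * l k)" .
      have "(1 / e k) *\<^sub>R integral {c k..c k + e k * l k} G - l k *\<^sub>R G t
         = (1 / e k) *\<^sub>R (integral {c k..c k + e k * l k} G - (e k * l k) *\<^sub>R G t)"
        using e(2)[of k] by (simp add: scaleR_diff_right)
      then have "norm ((1 / e k) *\<^sub>R integral {c k..c k + e k * l k} G - l k *\<^sub>R G t)
         = (1 / e k) * norm (integral {c k..c k + e k * l k} G - (e k * l k) *\<^sub>R G t)"
        using e(2)[of k] by simp
      also have "\<dots> \<le> (1 / e k) * (\<epsilon>' * (e k * l k))" using e(2)[of k] by (intro mult_left_mono *) auto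
      also have "\<dots> = \<epsilon>' * l k" using e(2)[of k] by simp
      also have "\<dots> \<le> \<epsilon>' * B" using \<epsilon>' B by (intro mult_left_mono) auto
      also have "\<dots> < \<epsilon>" using 1 B by (simp add: \<epsilon>'_def)
      finally show ?thesis by simp
    qed
    then show ?case by blast
  qed
  from tendsto_add[OF this tendsto_scaleR[OF l(1) tendsto_const[of "G t"]]] show ?thesis by simp
qed

section \<open>Integral equations\<close>

lemma has_integral_exp:
  fixes k c :: real
  assumes "k \<noteq> 0" "c \<le> t"
  shows "((\<lambda>s. exp (k * (s - c))) has_integral ((exp (k * (t - c)) - 1) / k)) {c..t}"
proof -
  have "((\<lambda>s. exp (k * (s - c)) / k) has_vector_derivative exp (k * (s - c))) (at s within {c..t})" for s
    using assms(1) by (auto intro!: derivative_eq_intros simp: has_real_derivative_iff_has_vector_derivative[symmetric])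
  from fundamental_theorem_of_calculus[OF assms(2) this] show ?thesis
    by (simp add: diff_divide_distrib)
qed

text \<open>Weighting \<open>\<phi>\<close> by \<open>exp (- 2 L (t - c))\<close> and looking at the maximum \<open>K\<close> of the weighted function
  turns the integral inequality into \<open>K \<le> a + K / 2\<close>. The factors \<open>2\<close> are the price for arguing at a
  maximum instead of differentiating.\<close>

lemma gronwall:
  fixes \<phi> :: "real \<Rightarrow> real"
  assumes cont: "continuous_on {c..d} \<phi>" and L: "L > 0" and a: "a \<ge> 0"
    and ineq: "\<And>t. t \<in> {c..d} \<Longrightarrow> \<phi> t \<le> a + L * integral {c..t} \<phi>"
    and t: "t \<in> {c..d}"
  shows "\<phi> t \<le> 2 * a * exp (2 * L * (t - c))"
proof -
  define \<psi> where "\<psi> t = exp (- (2 * L * (t - c))) * \<phi> t" for t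
  have phi: "\<phi> t = exp (2 * L * (t - c)) * \<psi> t" for t by (simp add: \<psi>_def exp_minus)
  have "continuous_on {c..d} \<psi>" unfolding \<psi>_def by (intro continuous_intros cont)
  then obtain u where u: "u \<in> {c..d}" and mx: "\<And>s. s \<in> {c..d} \<Longrightarrow> \<psi> s \<le> \<psi> u"
    using continuous_attains_sup[of "{c..d}" \<psi>] t by auto
  define K where "K = \<psi> u"
  define e where "e = exp (2 * L * (u - c))"
  have e: "e \<ge> 1" using u L by (auto simp: e_def)
  have "K \<le> 2 * a"
  proof (rule ccontr)
    assume "\<not> K \<le> 2 * a"
    then have K: "K > 2 * a" "K > 0" using a by auto
    have "integral {c..u} \<phi> \<le> integral {c..u} (\<lambda>s. K * exp (2 * L * (s - c)))"
    proof (rule integral_le)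
      show "\<phi> integrable_on {c..u}"
        using u by (intro integrable_continuous_real continuous_on_subset[OF cont]) auto
      show "(\<lambda>s. K * exp (2 * L * (s - c))) integrable_on {c..u}"
        by (intro integrable_continuous_real continuous_intros)
      show "\<phi> s \<le> K * exp (2 * L * (s - c))" if "s \<in> {c..u}" for s
        using mx[of s] that u by (simp add: phi K_def mult.commute)
    qed
    also have "\<dots> = K * ((e - 1) / (2 * L))"
      unfolding e_def using has_integral_exp[of "2*L" c u] L u
      by (intro integral_unique has_integral_mult_right) auto
    finally have "L * integral {c..u} \<phi> \<le> L * (K * ((e - 1) / (2 * L)))" using L by (intro mult_left_mono) auto
    also have "\<dots> = K * (e - 1) / 2" using L by simp
    finally have "e * K \<le> a + K * (e - 1) / 2"
      using ineq[OF u] by (simp add: phi[of u] K_def e_def)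
    then have "K * e + K \<le> 2 * a" by (simp add: field_simps)
    moreover have "K * e \<ge> 0" using K e by simp
    ultimately show False using K by simp
  qed
  then have "\<psi> t \<le> 2 * a" using mx[OF t] by (simp add: K_def)
  then show ?thesis unfolding phi using mult_left_mono[of "\<psi> t" "2*a" "exp (2 * L * (t - c))"]
    by (simp add: algebra_simps)
qed

text \<open>Banach's fixed point theorem for \<open>y t = exp (- k t) x t\<close>: in this weighted variable the Picard
  operator has Lipschitz constant at most \<open>\<Lambda> / k \<le> 1 / 2\<close> on all of \<open>[0, T]\<close> at once. Asking for
  integrability of \<open>s \<mapsto> F s (y s)\<close>, and not for continuity, allows for discontinuous controls.\<close>

lemma volterra_solution:
  fixes F :: "real \<Rightarrow> 'b::banach \<Rightarrow> 'b"
  assumes T: "T \<ge> 0" and L: "\<Lambda> \<ge> 0"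
    and int: "\<And>y. continuous_on {0..T} y \<Longrightarrow> (\<lambda>s. F s (y s)) integrable_on {0..T}"
    and lip: "\<And>s y z. s \<in> {0..T} \<Longrightarrow> norm (F s y - F s z) \<le> \<Lambda> * norm (y - z)"
  obtains x where "continuous_on {0..T} x" "\<And>t. t \<in> {0..T} \<Longrightarrow> x t = c + integral {0..t} (\<lambda>s. F s (x s))"
proof -
  \<comment> \<open>the summand \<open>1\<close> keeps \<open>k\<close> positive when \<open>\<Lambda> = 0\<close>\<close>
  define k where "k = 2 * \<Lambda> + 1"
  have k: "k > 0" using L by (simp add: k_def)
  define G where "G y t = exp (- (k * t)) *\<^sub>R (c + integral {0..t} (\<lambda>s. F s (exp (k * s) *\<^sub>R y s)))" for y t
  define cl where "cl t = max 0 (min T t)" for t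
  have cl: "cl t \<in> {0..T}" for t using T by (auto simp: cl_def)
  have contG: "continuous_on {0..T} (G y)" if "continuous_on {0..T} y" for y
    unfolding G_def using that
    by (intro continuous_intros indefinite_integral_continuous_1 int)
  have bc: "(\<lambda>t. G y (cl t)) \<in> bcontfun" if "continuous_on {0..T} y" for y
  proof -
    have "continuous_on UNIV (\<lambda>t. G y (cl t))"
      by (rule continuous_on_compose2[OF contG[OF that]])
         (use cl in \<open>auto simp: cl_def intro!: continuous_intros\<close>)
    moreover have "bounded (range (\<lambda>t. G y (cl t)))"
      by (rule bounded_subset[OF compact_imp_bounded[OF compact_continuous_image[OF contG[OF that] compact_Icc]]])
         (use cl in auto)
    ultimately show ?thesis by (simp add: bcontfun_def)
  qed
  define \<Gamma> :: "(real \<Rightarrow>\<^sub>C 'b) \<Rightarrow> (real \<Rightarrow>\<^sub>C 'b)" where "\<Gamma> y = Bcontfun (\<lambda>t. G (apply_bcontfun y) (cl t))" for y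
  have cy: "continuous_on X (apply_bcontfun y)" for y :: "real \<Rightarrow>\<^sub>C 'b" and X
    using apply_bcontfun[of y] by (auto simp: bcontfun_def intro: continuous_on_subset)
  have app: "apply_bcontfun (\<Gamma> y) t = G (apply_bcontfun y) (cl t)" for y t
    unfolding \<Gamma>_def by (subst Bcontfun_inverse[OF bc[OF cy]]) simp
  have "dist (\<Gamma> y) (\<Gamma> z) \<le> 1/2 * dist y z" for y z
  proof (rule dist_bound)
    fix r
    define t where "t = cl r"
    have t: "t \<in> {0..T}" using cl t_def by simp
    have iy: "(\<lambda>s. F s (exp (k * s) *\<^sub>R y s)) integrable_on {0..t}" for y :: "real \<Rightarrow>\<^sub>C 'b"
      by (rule integrable_subinterval_real[OF int]) (use t in \<open>auto intro!: continuous_intros cy\<close>)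
    have "norm (integral {0..t} (\<lambda>s. F s (exp (k * s) *\<^sub>R y s)) - integral {0..t} (\<lambda>s. F s (exp (k * s) *\<^sub>R z s)))
       = norm (integral {0..t} (\<lambda>s. F s (exp (k * s) *\<^sub>R y s) - F s (exp (k * s) *\<^sub>R z s)))"
      by (subst integral_diff[OF iy iy]) simp
    also have "\<dots> \<le> integral {0..t} (\<lambda>s. \<Lambda> * dist y z * exp (k * (s - 0)))"
    proof (rule integral_norm_bound_integral)
      show "(\<lambda>s. F s (exp (k * s) *\<^sub>R y s) - F s (exp (k * s) *\<^sub>R z s)) integrable_on {0..t}"
        by (intro integrable_diff iy)
      show "(\<lambda>s. \<Lambda> * dist y z * exp (k * (s - 0))) integrable_on {0..t}"
        by (intro integrable_continuous_real continuous_intros)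
      fix s assume s: "s \<in> {0..t}"
      have "norm (F s (exp (k * s) *\<^sub>R y s) - F s (exp (k * s) *\<^sub>R z s))
         \<le> \<Lambda> * norm (exp (k * s) *\<^sub>R y s - exp (k * s) *\<^sub>R z s)"
        using s t by (intro lip) auto
      also have "\<dots> = \<Lambda> * (exp (k * s) * dist (y s) (z s))"
        by (simp add: dist_norm flip: scaleR_diff_right)
      also have "\<dots> \<le> \<Lambda> * (exp (k * s) * dist y z)"
        by (intro mult_left_mono dist_bounded L) auto
      finally show "norm (F s (exp (k * s) *\<^sub>R y s) - F s (exp (k * s) *\<^sub>R z s)) \<le> \<Lambda> * dist y z * exp (k * (s - 0))"
        by (simp add: mult_ac)
    qed
    also have "\<dots> = \<Lambda> * dist y z * ((exp (k * (t - 0)) - 1) / k)"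
      using k t by (intro integral_unique has_integral_mult_right has_integral_exp) auto
    also have "\<dots> \<le> \<Lambda> * dist y z * (exp (k * t) / k)"
      using k L by (intro mult_left_mono divide_right_mono) auto
    also have "\<dots> = exp (k * t) * ((\<Lambda> / k) * dist y z)" by simp
    also have "\<dots> \<le> exp (k * t) * (1 / 2 * dist y z)"
      using k L by (intro mult_left_mono mult_right_mono) (auto simp: k_def field_simps)
    finally have *: "norm (integral {0..t} (\<lambda>s. F s (exp (k * s) *\<^sub>R y s)) - integral {0..t} (\<lambda>s. F s (exp (k * s) *\<^sub>R z s)))
       \<le> exp (k * t) * (1 / 2 * dist y z)" .
    have "dist (\<Gamma> y r) (\<Gamma> z r) = exp (- (k * t)) * norm (integral {0..t} (\<lambda>s. F s (exp (k * s) *\<^sub>R y s)) - integral {0..t} (\<lambda>s. F s (exp (k * s) *\<^sub>R z s)))"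
      by (simp add: app dist_norm G_def t_def flip: scaleR_diff_right)
    also have "\<dots> \<le> exp (- (k * t)) * (exp (k * t) * (1 / 2 * dist y z))"
      using * by (intro mult_left_mono) auto
    also have "\<dots> = 1/2 * dist y z" by (simp add: exp_minus)
    finally show "dist (\<Gamma> y r) (\<Gamma> z r) \<le> 1/2 * dist y z" .
  qed
  then obtain y where y: "\<Gamma> y = y" using banach_fix_type[of "1/2" \<Gamma>] by auto
  define x where "x t = exp (k * t) *\<^sub>R y t" for t
  show thesis
  proof (rule that)
    show "continuous_on {0..T} x" unfolding x_def by (intro continuous_intros cy)
    fix t assume t: "t \<in> {0..T}"
    then have "cl t = t" by (auto simp: cl_def)
    then have "y t = G y t" using app[of y t] y by simp
    then show "x t = c + integral {0..t} (\<lambda>s. F s (x s))"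
      unfolding x_def by (simp add: G_def flip: exp_add)
  qed
qed

lemma has_integral_flip:
  fixes v :: "real \<Rightarrow> 'b::banach"
  assumes "(v has_integral i) {a..b}"
  shows "((\<lambda>s. v (T - s)) has_integral i) {T - b..T - a}"
proof -
  have im: "(\<lambda>x. (1 / -1) *\<^sub>R x + - ((1 / -1) *\<^sub>R T)) ` {a..b} = {T - b..T - a}"
    by (auto simp: image_iff intro!: bexI[of _ "T - _"])
  show ?thesis
    using has_integral_affinity[of v i a b "-1" T] assms unfolding im[symmetric] by simp
qed

text \<open>The resolvent of the linear equation \<open>x' = A x\<close>, normalised at the final time: \<open>S t\<close> transports a
  perturbation at time \<open>t\<close> to time \<open>T\<close>, and \<open>p\<^sub>T \<circ> S t\<close> solves the adjoint equation \<open>p' = - p A\<close> with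
  end value \<open>p\<^sub>T\<close>. Because of the normalisation at \<open>T\<close>, \<open>S\<close> itself and not the inverse
  of a fundamental solution enters Duhamel's formula.\<close>

lemma backward_solution:
  fixes A :: "real \<Rightarrow> 'e::banach \<Rightarrow>\<^sub>L 'e"
  assumes T: "T > 0" and A: "pw_cont T UNIV A"
  obtains S :: "real \<Rightarrow> 'e \<Rightarrow>\<^sub>L 'e" where "continuous_on {0..T} S" "S T = id_blinfun"
    "\<And>t. t \<in> {0..T} \<Longrightarrow> S t = S 0 + integral {0..t} (\<lambda>s. - (S s o\<^sub>L A s))"
proof -
  obtain B where B: "B > 0" "\<And>t. t \<in> {0..T} \<Longrightarrow> norm (A t) \<le> B" using pw_cont_bounded[OF T A] by metis
  have pc: "pw_cont T UNIV (\<lambda>s. y s o\<^sub>L A s)" if "continuous_on {0..T} y" for y :: "real \<Rightarrow> 'e \<Rightarrow>\<^sub>L 'e"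
    by (rule pw_cont_compose[OF T A])
       (auto simp: case_prod_unfold intro!: continuous_intros continuous_on_compose2[OF that])
  have flip: "continuous_on {0..T} (\<lambda>s. y (T - s))" if "continuous_on {0..T} y" for y :: "real \<Rightarrow> 'e \<Rightarrow>\<^sub>L 'e"
    by (intro continuous_on_compose2[OF that]) (auto intro!: continuous_intros)
  have "\<exists>x. continuous_on {0..T} x \<and> (\<forall>t\<in>{0..T}. x t = id_blinfun + integral {0..t} (\<lambda>s. x s o\<^sub>L A (T - s)))"
  proof (rule volterra_solution[where T=T and \<Lambda>=B and c="id_blinfun" and F = "\<lambda>s Y. Y o\<^sub>L A (T - s)"])
    show "(\<lambda>s. y s o\<^sub>L A (T - s)) integrable_on {0..T}" if "continuous_on {0..T} y" for y :: "real \<Rightarrow> 'e \<Rightarrow>\<^sub>L 'e"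
      using has_integral_flip[OF integrable_integral[OF pw_cont_integrable[OF T pc[OF flip[OF that]]]], of T]
      by (auto simp: integrable_on_def)
    show "norm ((Y o\<^sub>L A (T - s)) - (Z o\<^sub>L A (T - s))) \<le> B * norm (Y - Z)" if "s \<in> {0..T}" for s Y Z
    proof -
      have "(Y o\<^sub>L A (T - s)) - (Z o\<^sub>L A (T - s)) = (Y - Z) o\<^sub>L A (T - s)"
        by (rule blinfun_eqI) (simp add: blinfun.diff_left)
      also have "norm \<dots> \<le> norm (Y - Z) * norm (A (T - s))" by (rule norm_blinfun_compose)
      also have "\<dots> \<le> norm (Y - Z) * B" using that by (intro mult_left_mono B) auto
      finally show ?thesis by (simp add: mult.commute)
    qed
  qed (use T B in auto)
  then obtain x where cx: "continuous_on {0..T} x"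
    and x: "\<And>t. t \<in> {0..T} \<Longrightarrow> x t = id_blinfun + integral {0..t} (\<lambda>s. x s o\<^sub>L A (T - s))" by blast
  define S where "S t = x (T - t)" for t
  have cS: "continuous_on {0..T} S" unfolding S_def by (rule flip[OF cx])
  have int: "(\<lambda>s. S s o\<^sub>L A s) integrable_on {a..b}" if "0 \<le> a" "b \<le> T" for a b
    by (rule pw_cont_integrable'[OF T pc[OF cS] that])
  have S: "S t = id_blinfun + integral {t..T} (\<lambda>s. S s o\<^sub>L A s)" if t: "t \<in> {0..T}" for t
  proof -
    have "((\<lambda>s. S (T - s) o\<^sub>L A (T - s)) has_integral (integral {t..T} (\<lambda>s. S s o\<^sub>L A s))) {T - T..T - t}"
      using t by (intro has_integral_flip integrable_integral int) auto
    then have "integral {0..T - t} (\<lambda>s. x s o\<^sub>L A (T - s)) = integral {t..T} (\<lambda>s. S s o\<^sub>L A s)"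
      by (simp add: S_def integral_unique)
    then show ?thesis using x[of "T - t"] t by (simp add: S_def)
  qed
  show thesis
  proof (rule that[OF cS])
    show "S T = id_blinfun" using S[of T] T by simp
    fix t assume t: "t \<in> {0..T}"
    have "integral {0..t} (\<lambda>s. S s o\<^sub>L A s) + integral {t..T} (\<lambda>s. S s o\<^sub>L A s) = integral {0..T} (\<lambda>s. S s o\<^sub>L A s)"
      using t by (intro Henstock_Kurzweil_Integration.integral_combine int) auto
    then show "S t = S 0 + integral {0..t} (\<lambda>s. - (S s o\<^sub>L A s))"
      using S[OF t] S[of 0] T by (simp add: algebra_simps)
  qed
qed

text \<open>Gronwall's lemma with \<open>a = 0\<close>, forwards and backwards from the zero \<open>c\<close>.\<close>

lemma adjoint_zero:
  fixes A :: "real \<Rightarrow> 'e::banach \<Rightarrow>\<^sub>L 'e" and p :: "real \<Rightarrow> 'e \<Rightarrow>\<^sub>L 'c::banach"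
  assumes T: "T > 0" and A: "pw_cont T UNIV A" and cont: "continuous_on {0..T} p"
    and p: "\<And>s t. 0 \<le> s \<Longrightarrow> s \<le> t \<Longrightarrow> t \<le> T \<Longrightarrow> ((\<lambda>r. - (p r o\<^sub>L A r)) has_integral (p t - p s)) {s..t}"
    and z: "p c = 0" and c: "c \<in> {0..T}" and t: "t \<in> {0..T}"
  shows "p t = 0"
proof -
  obtain B where B: "B > 0" "\<And>t. t \<in> {0..T} \<Longrightarrow> norm (A t) \<le> B" using pw_cont_bounded[OF T A] by metis
  have bound: "norm (p t - p s) \<le> B * integral {s..t} (\<lambda>r. norm (p r))" if st: "0 \<le> s" "s \<le> t" "t \<le> T" for s t
  proof -
    have "norm (p t - p s) = norm (integral {s..t} (\<lambda>r. - (p r o\<^sub>L A r)))"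
      by (simp only: integral_unique[OF p[OF st]])
    also have "\<dots> \<le> integral {s..t} (\<lambda>r. B * norm (p r))"
    proof (rule integral_norm_bound_integral)
      show "(\<lambda>r. - (p r o\<^sub>L A r)) integrable_on {s..t}" using p[OF st] by (auto simp: integrable_on_def)
      show "(\<lambda>r. B * norm (p r)) integrable_on {s..t}"
        using st by (intro integrable_continuous_real continuous_intros continuous_on_subset[OF cont]) auto
      fix r assume r: "r \<in> {s..t}"
      have "norm (- (p r o\<^sub>L A r)) \<le> norm (p r) * norm (A r)" by (simp add: norm_blinfun_compose)
      also have "\<dots> \<le> norm (p r) * B" using r st by (intro mult_left_mono B) auto
      finally show "norm (- (p r o\<^sub>L A r)) \<le> B * norm (p r)" by (simp add: mult.commute)
    qed
    finally show ?thesis by simp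
  qed
  show ?thesis
  proof (cases "c \<le> t")
    case True
    have "norm (p t) \<le> 2 * 0 * exp (2 * B * (t - c))"
    proof (rule gronwall[where d = T])
      show "continuous_on {c..T} (\<lambda>t. norm (p t))"
        using c by (intro continuous_intros continuous_on_subset[OF cont]) auto
      show "norm (p t) \<le> 0 + B * integral {c..t} (\<lambda>r. norm (p r))" if "t \<in> {c..T}" for t
        using bound[of c t] that c z by simp
    qed (use B t True in auto)
    then show ?thesis by simp
  next
    case False
    have "norm (p (c - (c - t))) \<le> 2 * 0 * exp (2 * B * ((c - t) - 0))"
    proof (rule gronwall[where d = c and \<phi> = "\<lambda>r. norm (p (c - r))"])
      show "continuous_on {0..c} (\<lambda>t. norm (p (c - t)))"
        using c by (intro continuous_intros continuous_on_compose2[OF cont]) auto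
      show "norm (p (c - t)) \<le> 0 + B * integral {0..t} (\<lambda>r. norm (p (c - r)))" if t: "t \<in> {0..c}" for t
      proof -
        have "((\<lambda>r. norm (p (c - r))) has_integral (integral {c - t..c} (\<lambda>r. norm (p r)))) {c - c..c - (c - t)}"
          using t c by (intro has_integral_flip integrable_integral integrable_continuous_real continuous_intros continuous_on_subset[OF cont]) auto
        then have "integral {0..t} (\<lambda>r. norm (p (c - r))) = integral {c - t..c} (\<lambda>r. norm (p r))"
          by (simp add: integral_unique)
        then show ?thesis using bound[of "c - t" c] t c z by (simp add: norm_minus_commute)
      qed
    qed (use B t False c in auto)
    then show ?thesis by simp
  qed
qed

section \<open>Needle variations\<close>

text \<open>A control system that is globally Lipschitz in the state, with controls in a compact set \<open>M\<close>, and a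
  reference trajectory along which it is Frechet differentiable. The given \<open>f\<close> is put into this form
  by truncating the state in a tube around \<open>x\<^sub>0\<close>.\<close>

locale controlled_system =
  fixes T :: real and F :: "real \<Rightarrow> 'e::banach \<Rightarrow> 'u::t2_space \<Rightarrow> 'e" and M :: "'u set" and \<Lambda> :: real
    and x\<^sub>0 :: "real \<Rightarrow> 'e" and u\<^sub>0 :: "real \<Rightarrow> 'u" and A :: "real \<Rightarrow> 'e \<Rightarrow>\<^sub>L 'e"
  assumes T: "T > 0"
    and F_cont: "continuous_on ({0..T} \<times> UNIV \<times> M) (\<lambda>(t, \<xi>, \<zeta>). F t \<xi> \<zeta>)"
    and \<Lambda>: "\<Lambda> > 0"
    and lip: "\<And>t \<xi> \<xi>' \<zeta>. t \<in> {0..T} \<Longrightarrow> \<zeta> \<in> M \<Longrightarrow> norm (F t \<xi> \<zeta> - F t \<xi>' \<zeta>) \<le> \<Lambda> * norm (\<xi> - \<xi>')"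
    and M: "compact M"
    and u0: "pw_cont T M u\<^sub>0"
    and x0_cont: "continuous_on {0..T} x\<^sub>0"
    and x0: "\<And>t. t \<in> {0..T} \<Longrightarrow> x\<^sub>0 t = x\<^sub>0 0 + integral {0..t} (\<lambda>s. F s (x\<^sub>0 s) (u\<^sub>0 s))"
    and A: "pw_cont T UNIV A"
    and deriv: "\<And>t. t \<in> {0..T} \<Longrightarrow> ((\<lambda>\<xi>. F t \<xi> (u\<^sub>0 t)) has_derivative blinfun_apply (A t)) (at (x\<^sub>0 t))"
begin

lemma F_continuous_on:
  assumes "continuous_on X a" "continuous_on X y" "continuous_on X w" "a ` X \<subseteq> {0..T}" "w ` X \<subseteq> M"
  shows "continuous_on X (\<lambda>p. F (a p) (y p) (w p))"
proof -
  have "continuous_on X (\<lambda>p. (a p, y p, w p))" by (intro continuous_intros assms)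
  from continuous_on_compose2[OF F_cont this] assms(4,5) show ?thesis by auto
qed

lemma F_pw_cont:
  assumes "pw_cont T M u" "continuous_on {0..T} y"
  shows "pw_cont T UNIV (\<lambda>s. F s (y s) (u s))"
proof (rule pw_cont_compose[OF T assms(1)])
  have "continuous_on ({0..T} \<times> M) (\<lambda>p. F (fst p) (y (fst p)) (snd p))"
    by (intro F_continuous_on continuous_intros continuous_on_compose2[OF assms(2)]) auto
  then show "continuous_on ({0..T} \<times> M) (\<lambda>(t, z). F t (y t) z)" by (simp add: case_prod_unfold)
qed

lemma F_bounded:
  assumes "continuous_on {0..T} y"
  obtains B where "B > 0" "\<And>s \<zeta>. s \<in> {0..T} \<Longrightarrow> \<zeta> \<in> M \<Longrightarrow> norm (F s (y s) \<zeta>) \<le> B"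
proof -
  have "continuous_on ({0..T} \<times> M) (\<lambda>p. F (fst p) (y (fst p)) (snd p))"
    by (intro F_continuous_on continuous_intros continuous_on_compose2[OF assms]) auto
  then have "bounded ((\<lambda>p. F (fst p) (y (fst p)) (snd p)) ` ({0..T} \<times> M))"
    by (intro compact_imp_bounded compact_continuous_image compact_Times M) auto
  then obtain B where "B > 0" "\<forall>x\<in>(\<lambda>p. F (fst p) (y (fst p)) (snd p)) ` ({0..T} \<times> M). norm x \<le> B"
    using bounded_pos by metis
  then show thesis using that[of B] by fastforce
qed

definition is_traj :: "(real \<Rightarrow> 'u) \<Rightarrow> (real \<Rightarrow> 'e) \<Rightarrow> bool" where
  "is_traj u x \<longleftrightarrow> continuous_on {0..T} x \<and>
     (\<forall>t\<in>{0..T}. x t = x\<^sub>0 0 + integral {0..t} (\<lambda>s. F s (x s) (u s)))"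

lemma is_traj_x0: "is_traj u\<^sub>0 x\<^sub>0"
  unfolding is_traj_def using x0_cont by (blast intro: x0)

definition traj :: "(real \<Rightarrow> 'u) \<Rightarrow> real \<Rightarrow> 'e" where
  "traj u = (SOME x. is_traj u x)"

lemma is_traj_traj:
  assumes "pw_cont T M u"
  shows "is_traj u (traj u)"
proof -
  have "\<exists>x. continuous_on {0..T} x \<and> (\<forall>t\<in>{0..T}. x t = x\<^sub>0 0 + integral {0..t} (\<lambda>s. F s (x s) (u s)))"
  proof (rule volterra_solution[where T=T and \<Lambda>=\<Lambda> and F="\<lambda>s y. F s y (u s)" and c="x\<^sub>0 0"])
    show "(\<lambda>s. F s (y s) (u s)) integrable_on {0..T}" if "continuous_on {0..T} y" for y
      by (rule pw_cont_integrable[OF T F_pw_cont[OF assms that]])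
    show "norm (F s y (u s) - F s z (u s)) \<le> \<Lambda> * norm (y - z)" if "s \<in> {0..T}" for s y z
      using that assms by (intro lip) (auto simp: pw_cont_def)
  qed (use T \<Lambda> in auto)
  then show ?thesis unfolding traj_def is_traj_def[symmetric] by (rule someI_ex)
qed

text \<open>The distance of two trajectories is controlled by the integral of the difference of the two
  velocities along one of them. All estimates for needle variations come from this inequality.\<close>

lemma traj_stability:
  assumes u: "pw_cont T M u" and v: "pw_cont T M v" and x: "is_traj u x" and y: "is_traj v y" and t: "t \<in> {0..T}"
  shows "norm (x t - y t) \<le> 2 * exp (2 * \<Lambda> * T) * integral {0..T} (\<lambda>s. norm (F s (y s) (u s) - F s (y s) (v s)))"
proof -
  have cx: "continuous_on {0..T} x" and cy: "continuous_on {0..T} y" using x y by (auto simp: is_traj_def)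
  define \<delta> where "\<delta> s = norm (F s (y s) (u s) - F s (y s) (v s))" for s
  have pwd: "pw_cont T UNIV \<delta>"
    unfolding \<delta>_def by (rule pw_cont_norm[OF T pw_cont_diff[OF T F_pw_cont[OF u cy] F_pw_cont[OF v cy]]])
  define a where "a = integral {0..T} \<delta>"
  have a: "a \<ge> 0" unfolding a_def by (rule integral_nonneg[OF pw_cont_integrable[OF T pwd]]) (simp add: \<delta>_def)
  have le: "norm (x t - y t) \<le> a + \<Lambda> * integral {0..t} (\<lambda>s. norm (x s - y s))" if t: "t \<in> {0..T}" for t
  proof -
    have ix: "(\<lambda>s. F s (x s) (u s)) integrable_on {0..t}" and iy: "(\<lambda>s. F s (y s) (v s)) integrable_on {0..t}"
      using t by (auto intro!: pw_cont_integrable'[OF T F_pw_cont] u v cx cy)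
    have id: "\<delta> integrable_on {0..t}" using t by (intro pw_cont_integrable'[OF T pwd]) auto
    have in': "(\<lambda>s. \<Lambda> * norm (x s - y s)) integrable_on {0..t}"
      using t by (intro integrable_continuous_real continuous_intros continuous_on_subset[OF cx] continuous_on_subset[OF cy]) auto
    have "x t - y t = integral {0..t} (\<lambda>s. F s (x s) (u s)) - integral {0..t} (\<lambda>s. F s (y s) (v s))"
      using x y t by (simp add: is_traj_def)
    also have "\<dots> = integral {0..t} (\<lambda>s. F s (x s) (u s) - F s (y s) (v s))"
      using ix iy by (simp add: integral_diff)
    also have "norm \<dots> \<le> integral {0..t} (\<lambda>s. \<delta> s + \<Lambda> * norm (x s - y s))"
    proof (rule integral_norm_bound_integral)
      show "(\<lambda>s. F s (x s) (u s) - F s (y s) (v s)) integrable_on {0..t}" by (intro integrable_diff ix iy)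
      show "(\<lambda>s. \<delta> s + \<Lambda> * norm (x s - y s)) integrable_on {0..t}" by (intro integrable_add id in')
      fix s assume s: "s \<in> {0..t}"
      have "u s \<in> M" using s t u by (auto simp: pw_cont_def)
      then have "norm (F s (x s) (u s) - F s (y s) (u s)) \<le> \<Lambda> * norm (x s - y s)"
        using s t by (intro lip) auto
      then show "norm (F s (x s) (u s) - F s (y s) (v s)) \<le> \<delta> s + \<Lambda> * norm (x s - y s)"
        using norm_triangle_ineq[of "F s (x s) (u s) - F s (y s) (u s)" "F s (y s) (u s) - F s (y s) (v s)"]
        by (simp add: \<delta>_def)
    qed
    also have "\<dots> = integral {0..t} \<delta> + \<Lambda> * integral {0..t} (\<lambda>s. norm (x s - y s))"
      by (subst integral_add[OF id in']) simp
    also have "integral {0..t} \<delta> \<le> a"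
      unfolding a_def using t by (intro integral_subset_le id pw_cont_integrable[OF T pwd]) (auto simp: \<delta>_def)
    finally show ?thesis by simp
  qed
  have "norm (x t - y t) \<le> 2 * a * exp (2 * \<Lambda> * (t - 0))"
    by (rule gronwall[where d=T]) (use le \<Lambda> a t in \<open>auto intro!: continuous_intros cx cy\<close>)
  also have "\<dots> \<le> 2 * a * exp (2 * \<Lambda> * T)" using t a \<Lambda> by (intro mult_left_mono) auto
  finally have "norm (x t - y t) \<le> 2 * exp (2 * \<Lambda> * T) * a" by (simp add: mult_ac)
  then show ?thesis by (simp only: a_def \<delta>_def[abs_def])
qed

text \<open>Duhamel's formula, with the resolvent of the linearised equation.\<close>

lemma duhamel:
  assumes S: "continuous_on {0..T} S" "S T = id_blinfun"
      "\<And>t. t \<in> {0..T} \<Longrightarrow> S t = S 0 + integral {0..t} (\<lambda>s. - (S s o\<^sub>L A s))"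
    and u: "pw_cont T M u" and x: "is_traj u x"
  shows "((\<lambda>s. S s (F s (x s) (u s) - F s (x\<^sub>0 s) (u\<^sub>0 s) - A s (x s - x\<^sub>0 s))) has_integral (x T - x\<^sub>0 T)) {0..T}"
proof -
  have cx: "continuous_on {0..T} x" using x by (auto simp: is_traj_def)
  note px = F_pw_cont[OF u cx] and p0 = F_pw_cont[OF u0 x0_cont]
  have pS: "pw_cont T UNIV (\<lambda>s. - (S s o\<^sub>L A s))"
    by (rule pw_cont_minus[OF T pw_cont_compose_blinfun[OF T pw_cont_continuous[OF T S(1) subset_UNIV] A]])
  obtain E1 where E1: "finite E1" "\<And>t. t\<in>{0<..<T} - E1 \<Longrightarrow> isCont (\<lambda>s. F s (x s) (u s)) t"
    using pw_cont_exceptE[OF px] by blast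
  obtain E2 where E2: "finite E2" "\<And>t. t\<in>{0<..<T} - E2 \<Longrightarrow> isCont (\<lambda>s. F s (x\<^sub>0 s) (u\<^sub>0 s)) t"
    using pw_cont_exceptE[OF p0] by blast
  obtain E3 where E3: "finite E3" "\<And>t. t\<in>{0<..<T} - E3 \<Longrightarrow> isCont (\<lambda>s. - (S s o\<^sub>L A s)) t"
    using pw_cont_exceptE[OF pS] by blast
  note E = E1 E2 E3
  have "((\<lambda>s. S s (F s (x s) (u s) - F s (x\<^sub>0 s) (u\<^sub>0 s) - A s (x s - x\<^sub>0 s))) has_integral
        (S T (x T - x\<^sub>0 T) - S 0 (x 0 - x\<^sub>0 0))) {0..T}"
  proof (rule fundamental_theorem_of_calculus_interior_strong[where S = "E1 \<union> E2 \<union> E3" and f = "\<lambda>s. S s (x s - x\<^sub>0 s)"])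
    show "continuous_on {0..T} (\<lambda>s. S s (x s - x\<^sub>0 s))" by (intro continuous_intros S cx x0_cont)
    fix t assume t: "t \<in> {0<..<T} - (E1 \<union> E2 \<union> E3)"
    have d: "(x has_vector_derivative F t (x t) (u t)) (at t)"
    proof (rule integral_pw_cont(3)[OF T px])
      show "x r = x\<^sub>0 0 + integral {0..r} (\<lambda>s. F s (x s) (u s))" if "r \<in> {0..T}" for r
        using x that unfolding is_traj_def by blast
    qed (use t E in auto)
    have d0: "(x\<^sub>0 has_vector_derivative F t (x\<^sub>0 t) (u\<^sub>0 t)) (at t)"
      by (rule integral_pw_cont(3)[OF T p0 x0]) (use t E in auto)
    have dS: "(S has_vector_derivative - (S t o\<^sub>L A t)) (at t)"
      by (rule integral_pw_cont(3)[OF T pS S(3)]) (use t E in auto)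
    have "((\<lambda>s. S s (x s - x\<^sub>0 s)) has_vector_derivative
        (S t (F t (x t) (u t) - F t (x\<^sub>0 t) (u\<^sub>0 t)) + (- (S t o\<^sub>L A t)) (x t - x\<^sub>0 t))) (at t)"
      by (rule bounded_bilinear.has_vector_derivative[OF bounded_bilinear_blinfun_apply dS has_vector_derivative_diff[OF d d0]])
    then show "((\<lambda>s. S s (x s - x\<^sub>0 s)) has_vector_derivative
       S t (F t (x t) (u t) - F t (x\<^sub>0 t) (u\<^sub>0 t) - A t (x t - x\<^sub>0 t))) (at t)"
      by (simp add: blinfun.diff_right blinfun.minus_left blinfun.add_right algebra_simps)
  qed (use E T in auto)
  moreover have "x 0 = x\<^sub>0 0" using x T by (auto simp: is_traj_def)
  ultimately show ?thesis using S(2) by simp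
qed

end

text \<open>Needles \<open>(\<tau> i, z i)\<close> sorted by time, where several needles may sit at the same time.\<close>

locale needles = controlled_system +
  fixes N :: nat and \<tau> :: "nat \<Rightarrow> real" and z :: "nat \<Rightarrow> 'b"
  assumes \<tau>: "\<And>i. i < N \<Longrightarrow> 0 \<le> \<tau> i \<and> \<tau> i < T"
    and z: "\<And>i. i < N \<Longrightarrow> z i \<in> M"
    and \<tau>_mono: "\<And>i j. i \<le> j \<Longrightarrow> j < N \<Longrightarrow> \<tau> i \<le> \<tau> j"
begin

text \<open>The \<open>i\<close>-th needle is delayed by the total length of all earlier ones, whether or not they sit at the
  same time. Since the times are sorted, the intervals \<open>J a i\<close> are then disjoint without any case
  distinction, and the delay is of the order of \<open>a\<close>, so it does not affect first-order terms.\<close>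

definition off :: "(nat \<Rightarrow> real) \<Rightarrow> nat \<Rightarrow> real" where
  "off a i = \<tau> i + (\<Sum>j<i. a j)"

definition J :: "(nat \<Rightarrow> real) \<Rightarrow> nat \<Rightarrow> real set" where
  "J a i = {off a i..<off a i + a i}"

primrec ctrl :: "(nat \<Rightarrow> real) \<Rightarrow> nat \<Rightarrow> real \<Rightarrow> 'b" where
  "ctrl a 0 = u\<^sub>0"
| "ctrl a (Suc n) = (\<lambda>t. if t \<in> J a n then z n else ctrl a n t)"

text \<open>The lengths for which all needle intervals end before \<open>T\<close>.\<close>

definition dom :: "(nat \<Rightarrow> real) set" where
  "dom = {a. (\<forall>i<N. a i \<ge> 0) \<and> (\<forall>i<N. \<tau> i + (\<Sum>j<N. a j) < T)}"

lemma dom_J: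
  assumes a: "a \<in> dom" and i: "i < N"
  shows "0 \<le> a i" "\<tau> i \<le> off a i" "0 \<le> off a i" "off a i + a i < T"
proof -
  have nn: "\<And>j. j < N \<Longrightarrow> a j \<ge> 0" using a by (simp add: dom_def)
  show "0 \<le> a i" using nn i by simp
  show le: "\<tau> i \<le> off a i" unfolding off_def using nn i by (auto intro!: sum_nonneg)
  then show "0 \<le> off a i" using \<tau>[OF i] by simp
  have "off a i + a i = \<tau> i + (\<Sum>j<Suc i. a j)" by (simp add: off_def)
  also have "\<dots> \<le> \<tau> i + (\<Sum>j<N. a j)" using nn i by (intro add_left_mono sum_mono2) auto
  also have "\<dots> < T" using a i by (simp add: dom_def)
  finally show "off a i + a i < T" .
qed

lemma J_disjoint:
  assumes a: "a \<in> dom" and ij: "i < j" "j < N" and t: "t \<in> J a j"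
  shows "t \<notin> J a i"
proof -
  have nn: "\<And>j. j < N \<Longrightarrow> a j \<ge> 0" using a by (simp add: dom_def)
  have "off a i + a i = \<tau> i + (\<Sum>l<Suc i. a l)" by (simp add: off_def)
  also have "\<dots> \<le> \<tau> j + (\<Sum>l<j. a l)" using nn ij \<tau>_mono[of i j] by (intro add_mono sum_mono2) auto
  finally show ?thesis using t by (auto simp: J_def off_def)
qed

lemma ctrl_pw_cont:
  assumes a: "a \<in> dom" and n: "n \<le> N"
  shows "pw_cont T M (ctrl a n)"
  using n
proof (induction n)
  case 0 then show ?case by (simp add: u0)
next
  case (Suc n)
  then have "pw_cont T M (\<lambda>t. if t \<in> {off a n..<off a n + a n} then z n else ctrl a n t)"
    using dom_J[OF a, of n] by (intro pw_cont_override z) auto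
  then show ?case by (simp only: ctrl.simps J_def)
qed

lemma ctrl_difference:
  fixes G :: "'b \<Rightarrow> 'c::real_vector"
  assumes a: "a \<in> dom" and n: "n \<le> N"
  shows "G (ctrl a n s) - G (u\<^sub>0 s) = (\<Sum>i<n. indicat_real (J a i) s *\<^sub>R (G (z i) - G (u\<^sub>0 s)))"
  using n
proof (induction n)
  case (Suc n)
  show ?case
  proof (cases "s \<in> J a n")
    case True
    then have "s \<notin> J a i" if "i < n" for i using J_disjoint[OF a that, of s] Suc.prems by simp
    then have "(\<Sum>i<n. indicat_real (J a i) s *\<^sub>R (G (z i) - G (u\<^sub>0 s))) = 0"
      by (intro sum.neutral) auto
    then show ?thesis using True by simp
  qed (use Suc in simp)
qed simp

lemma integral_indicator_J:
  fixes v :: "real \<Rightarrow> 'c::banach"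
  assumes a: "a \<in> dom" and i: "i < N" and v: "pw_cont T UNIV v"
  shows "((\<lambda>s. indicat_real (J a i) s *\<^sub>R v s) has_integral integral {off a i..off a i + a i} v) {0..T}"
  unfolding J_def using dom_J[OF a i] by (intro has_integral_indicator_Ico pw_cont_integrable'[OF T v]) auto

text \<open>The integrand vanishes outside the needle intervals, whose total length is \<open>\<Sum>i<N. a i\<close>.\<close>

lemma integral_ctrl_difference_le:
  fixes v :: "real \<Rightarrow> 'b \<Rightarrow> 'c::banach"
  assumes a: "a \<in> dom" and B: "\<And>s \<zeta>. s \<in> {0..T} \<Longrightarrow> \<zeta> \<in> M \<Longrightarrow> norm (v s \<zeta>) \<le> B"
    and int: "(\<lambda>s. norm (v s (ctrl a N s) - v s (u\<^sub>0 s))) integrable_on {0..T}"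
  shows "integral {0..T} (\<lambda>s. norm (v s (ctrl a N s) - v s (u\<^sub>0 s))) \<le> 2 * B * (\<Sum>i<N. a i)"
proof -
  have "((\<lambda>s. \<Sum>i<N. indicat_real (J a i) s *\<^sub>R (2 * B)) has_integral (\<Sum>i<N. integral {off a i..off a i + a i} (\<lambda>s. 2 * B))) {0..T}"
    by (intro has_integral_sum integral_indicator_J a pw_cont_continuous[OF T] continuous_intros) auto
  moreover have "(\<Sum>i<N. integral {off a i..off a i + a i} (\<lambda>s. 2 * B)) = 2 * B * (\<Sum>i<N. a i)"
    unfolding sum_distrib_left using dom_J[OF a] by (intro sum.cong) auto
  ultimately have hi: "((\<lambda>s. \<Sum>i<N. indicat_real (J a i) s *\<^sub>R (2 * B)) has_integral 2 * B * (\<Sum>i<N. a i)) {0..T}" by simp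
  show ?thesis
  proof (rule has_integral_le[OF integrable_integral[OF int] hi])
    fix s assume s: "s \<in> {0..T}"
    have us: "u\<^sub>0 s \<in> M" using u0 s by (auto simp: pw_cont_def)
    have "norm (v s (ctrl a N s) - v s (u\<^sub>0 s)) = norm (\<Sum>i<N. indicat_real (J a i) s *\<^sub>R (v s (z i) - v s (u\<^sub>0 s)))"
      by (subst ctrl_difference[OF a order_refl, of "v s"]) simp
    also have "\<dots> \<le> (\<Sum>i<N. indicat_real (J a i) s *\<^sub>R (2 * B))"
    proof (rule sum_norm_le)
      fix i assume i: "i \<in> {..<N}"
      have "norm (v s (z i) - v s (u\<^sub>0 s)) \<le> 2 * B"
        using norm_triangle_ineq4[of "v s (z i)" "v s (u\<^sub>0 s)"] B[OF s us] B[OF s z[of i]] i by simp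
      then show "norm (indicat_real (J a i) s *\<^sub>R (v s (z i) - v s (u\<^sub>0 s))) \<le> indicat_real (J a i) s *\<^sub>R (2 * B)"
        by (simp add: mult_left_mono)
    qed
    finally show "norm (v s (ctrl a N s) - v s (u\<^sub>0 s)) \<le> (\<Sum>i<N. indicat_real (J a i) s *\<^sub>R (2 * B))" .
  qed
qed

abbreviation "X a \<equiv> traj (ctrl a N)"

lemma X_is_traj: "a \<in> dom \<Longrightarrow> is_traj (ctrl a N) (X a)"
  by (rule is_traj_traj[OF ctrl_pw_cont]) auto

lemma X_continuous: "a \<in> dom \<Longrightarrow> continuous_on {0..T} (X a)"
  using X_is_traj by (simp add: is_traj_def)

lemma X_near_x0:
  obtains C where "C > 0" "\<And>a t. a \<in> dom \<Longrightarrow> t \<in> {0..T} \<Longrightarrow> norm (X a t - x\<^sub>0 t) \<le> C * (\<Sum>i<N. a i)"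
proof -
  obtain B where B: "B > 0" "\<And>s \<zeta>. s \<in> {0..T} \<Longrightarrow> \<zeta> \<in> M \<Longrightarrow> norm (F s (x\<^sub>0 s) \<zeta>) \<le> B"
    using F_bounded[OF x0_cont] by metis
  show thesis
  proof (rule that[of "2 * exp (2 * \<Lambda> * T) * (2 * B)"])
    fix a t assume a: "a \<in> dom" and t: "t \<in> {0..T}"
    have pc: "pw_cont T M (ctrl a N)" by (rule ctrl_pw_cont[OF a order_refl])
    have "norm (X a t - x\<^sub>0 t) \<le> 2 * exp (2 * \<Lambda> * T) * integral {0..T} (\<lambda>s. norm (F s (x\<^sub>0 s) (ctrl a N s) - F s (x\<^sub>0 s) (u\<^sub>0 s)))"
      by (rule traj_stability[OF pc u0 X_is_traj[OF a] is_traj_x0 t])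
    also have "\<dots> \<le> 2 * exp (2 * \<Lambda> * T) * (2 * B * (\<Sum>i<N. a i))"
    proof (rule mult_left_mono)
      show "integral {0..T} (\<lambda>s. norm (F s (x\<^sub>0 s) (ctrl a N s) - F s (x\<^sub>0 s) (u\<^sub>0 s))) \<le> 2 * B * (\<Sum>i<N. a i)"
        by (rule integral_ctrl_difference_le[OF a, of "\<lambda>s. F s (x\<^sub>0 s)"])
          (use B in \<open>auto intro!: pw_cont_integrable[OF T pw_cont_norm[OF T pw_cont_diff[OF T F_pw_cont[OF pc x0_cont] F_pw_cont[OF u0 x0_cont]]]]\<close>)
    qed auto
    finally show "norm (X a t - x\<^sub>0 t) \<le> 2 * exp (2 * \<Lambda> * T) * (2 * B) * (\<Sum>i<N. a i)" by simp
  qed (use B in auto)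
qed

lemma ctrl_eventually_eq:
  assumes lim: "\<And>i. i < N \<Longrightarrow> (\<lambda>k. a k i) \<longlonglongrightarrow> b i" and n: "n \<le> N"
    and s: "\<And>i. i < N \<Longrightarrow> s \<noteq> off b i \<and> s \<noteq> off b i + b i"
  shows "eventually (\<lambda>k. ctrl (a k) n s = ctrl b n s) sequentially"
  using n
proof (induction n)
  case (Suc n)
  have n: "n < N" using Suc.prems by simp
  have o: "(\<lambda>k. off (a k) n) \<longlonglongrightarrow> off b n"
    unfolding off_def using n by (intro tendsto_intros lim) auto
  then have o': "(\<lambda>k. off (a k) n + a k n) \<longlonglongrightarrow> off b n + b n" by (intro tendsto_intros lim n)
  have e1: "eventually (\<lambda>k. off (a k) n \<le> s \<longleftrightarrow> off b n \<le> s) sequentially"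
  proof (cases "off b n < s")
    case True
    then show ?thesis using order_tendstoD(2)[OF o True] by (auto elim!: eventually_mono)
  next
    case False
    then have *: "s < off b n" using s[OF n] by simp
    then show ?thesis using order_tendstoD(1)[OF o *] by (auto elim!: eventually_mono)
  qed
  have e2: "eventually (\<lambda>k. s < off (a k) n + a k n \<longleftrightarrow> s < off b n + b n) sequentially"
  proof (cases "off b n + b n < s")
    case True
    then show ?thesis using order_tendstoD(2)[OF o' True] by (auto elim!: eventually_mono)
  next
    case False
    then have *: "s < off b n + b n" using s[OF n] by simp
    then show ?thesis using order_tendstoD(1)[OF o' *] by (auto elim!: eventually_mono)
  qed
  have "eventually (\<lambda>k. ctrl (a k) n s = ctrl b n s) sequentially" using Suc by simp
  with e1 e2 show ?case by eventually_elim (auto simp: J_def)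
qed simp

text \<open>If the lengths converge, the controls become equal to the limit control at every time that is not an
  end of a needle interval; dominated convergence and stability of trajectories give the claim.\<close>

lemma endpoint_continuous:
  assumes a: "\<And>k. a k \<in> dom" and b: "b \<in> dom" and lim: "\<And>i. i < N \<Longrightarrow> (\<lambda>k. a k i) \<longlonglongrightarrow> b i"
  shows "(\<lambda>k. X (a k) T) \<longlonglongrightarrow> X b T"
proof -
  define y where "y = X b"
  have cy: "continuous_on {0..T} y" unfolding y_def by (rule X_continuous[OF b])
  obtain B where B: "B > 0" "\<And>s \<zeta>. s \<in> {0..T} \<Longrightarrow> \<zeta> \<in> M \<Longrightarrow> norm (F s (y s) \<zeta>) \<le> B"
    using F_bounded[OF cy] by metis
  define E where "E = (\<Union>i<N. {off b i, off b i + b i})"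
  have E: "finite E" by (simp add: E_def)
  define d where "d k s = norm (F s (y s) (ctrl (a k) N s) - F s (y s) (ctrl b N s))" for k s
  \<comment> \<open>at the ends of the limit intervals the integrand need not converge; there it is set to \<open>0\<close>\<close>
  define d' where "d' k s = (if s \<in> E then 0 else d k s)" for k s
  have pa: "pw_cont T M (ctrl (a k) N)" for k by (rule ctrl_pw_cont[OF a order_refl])
  have pb: "pw_cont T M (ctrl b N)" by (rule ctrl_pw_cont[OF b order_refl])
  have int: "d k integrable_on {0..T}" for k unfolding d_def
    by (rule pw_cont_integrable[OF T pw_cont_norm[OF T pw_cont_diff[OF T F_pw_cont[OF pa cy] F_pw_cont[OF pb cy]]]])
  have int': "d' k integrable_on {0..T}" for k
    by (rule integrable_spike_finite[OF E _ int]) (auto simp: d'_def)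
  have eq: "integral {0..T} (d k) = integral {0..T} (d' k)" for k
    by (rule integral_spike[OF negligible_finite[OF E]]) (auto simp: d'_def)
  have "(\<lambda>k. integral {0..T} (d' k)) \<longlonglongrightarrow> integral {0..T} (\<lambda>_. 0 :: real)"
  proof (rule dominated_convergence(2)[where h = "\<lambda>_. 2 * B"])
    fix k s assume s: "s \<in> {0..T}"
    have "ctrl (a k) N s \<in> M" "ctrl b N s \<in> M" using pa[of k] pb s by (auto simp: pw_cont_def)
    then have "d k s \<le> 2 * B"
      unfolding d_def using norm_triangle_ineq4[of "F s (y s) (ctrl (a k) N s)" "F s (y s) (ctrl b N s)"]
        B(2)[OF s, of "ctrl (a k) N s"] B(2)[OF s, of "ctrl b N s"] by linarith
    then show "norm (d' k s) \<le> 2 * B" using B by (auto simp: d'_def d_def)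
  next
    fix s assume s: "s \<in> {0..T}"
    show "(\<lambda>k. d' k s) \<longlonglongrightarrow> 0"
    proof (cases "s \<in> E")
      case False
      have "eventually (\<lambda>k. ctrl (a k) N s = ctrl b N s) sequentially"
        by (rule ctrl_eventually_eq[OF lim]) (use False in \<open>auto simp: E_def\<close>)
      then have "eventually (\<lambda>k. d' k s = 0) sequentially"
        by (rule eventually_mono) (simp add: d'_def d_def)
      then show ?thesis by (rule tendsto_eventually)
    qed (simp add: d'_def)
  qed (use int' in auto)
  then have lim0: "(\<lambda>k. 2 * exp (2 * \<Lambda> * T) * integral {0..T} (d k)) \<longlonglongrightarrow> 0"
    unfolding eq by (auto intro: tendsto_mult_right_zero)
  have "norm (X (a k) T - X b T) \<le> 2 * exp (2 * \<Lambda> * T) * integral {0..T} (d k)" for k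
    using traj_stability[OF pa pb X_is_traj[OF a] X_is_traj[OF b], of T k] T by (simp add: d_def[abs_def] y_def)
  then have "(\<lambda>k. X (a k) T - X b T) \<longlonglongrightarrow> 0"
    by (intro Lim_null_comparison[OF _ lim0]) auto
  then show ?thesis by (simp add: LIM_zero_iff)
qed

text \<open>By Duhamel's formula the displacement of the endpoint is the integral of \<open>S\<close> applied to
  \<open>F(x, u) - F(x\<^sub>0, u\<^sub>0) - A (x - x\<^sub>0)\<close>. This splits into three parts. On the needle intervals,
  \<open>F(x\<^sub>0, u) - F(x\<^sub>0, u\<^sub>0)\<close> gives the stated limit. The remainder \<open>P\<close> of replacing \<open>x\<close> by \<open>x\<^sub>0\<close> there is
  of order \<open>e\<close> on a set of measure of order \<open>e\<close>. The linearisation error \<open>R\<close> is \<open>o(e)\<close> at each time,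
  with a common bound from the Lipschitz condition, so that dominated convergence applies although
  differentiability is not uniform in time.\<close>

lemma endpoint_differentiable:
  assumes S: "continuous_on {0..T} S" "S T = id_blinfun"
      "\<And>t. t \<in> {0..T} \<Longrightarrow> S t = S 0 + integral {0..t} (\<lambda>s. - (S s o\<^sub>L A s))"
    and e: "\<And>k. e k > 0" "e \<longlonglongrightarrow> 0"
    and lim: "\<And>i. i < N \<Longrightarrow> (\<lambda>k. a k i) \<longlonglongrightarrow> b i"
    and d: "\<And>k. (\<lambda>i. e k * a k i) \<in> dom"
  shows "(\<lambda>k. (1 / e k) *\<^sub>R (X (\<lambda>i. e k * a k i) T - x\<^sub>0 T)) \<longlonglongrightarrow>
    (\<Sum>i<N. b i *\<^sub>R S (\<tau> i) (F (\<tau> i) (x\<^sub>0 (\<tau> i)) (z i) - F (\<tau> i) (x\<^sub>0 (\<tau> i)) (u\<^sub>0 (\<tau> i))))"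
proof -
  define ea where "ea k = (\<lambda>i. e k * a k i)" for k
  define x where "x k = X (ea k)" for k
  define u where "u k = ctrl (ea k) N" for k
  have ead: "ea k \<in> dom" for k using d by (simp add: ea_def)
  have pu: "pw_cont T M (u k)" for k unfolding u_def by (rule ctrl_pw_cont[OF ead order_refl])
  have tx: "is_traj (u k) (x k)" for k unfolding u_def x_def by (rule X_is_traj[OF ead])
  have cx: "continuous_on {0..T} (x k)" for k using tx by (simp add: is_traj_def)
  have an: "a k i \<ge> 0" if "i < N" for k i
    using dom_J(1)[OF ead[of k] that] e(1)[of k] by (simp add: ea_def zero_le_mult_iff)
  have suma: "(\<lambda>k. \<Sum>i<N. a k i) \<longlonglongrightarrow> (\<Sum>i<N. b i)" by (intro tendsto_intros lim) auto
  obtain \<alpha> where \<alpha>: "\<alpha> > 0" "\<And>k. (\<Sum>i<N. a k i) \<le> \<alpha>"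
    using convergent_imp_Bseq[OF convergentI[OF suma]] unfolding Bseq_def by (metis abs_le_D1 real_norm_def)
  have sumea: "(\<Sum>i<N. ea k i) = e k * (\<Sum>i<N. a k i)" for k by (simp add: ea_def sum_distrib_left)
  obtain C where C: "C > 0" "\<And>a t. a \<in> dom \<Longrightarrow> t \<in> {0..T} \<Longrightarrow> norm (X a t - x\<^sub>0 t) \<le> C * (\<Sum>i<N. a i)"
    using X_near_x0 by metis
  define K where "K = C * \<alpha>"
  have K: "K > 0" using C \<alpha> by (simp add: K_def)
  have near: "norm (x k t - x\<^sub>0 t) \<le> K * e k" if "t \<in> {0..T}" for k t
  proof -
    have "norm (x k t - x\<^sub>0 t) \<le> C * (e k * (\<Sum>i<N. a k i))"
      using C(2)[OF ead[of k] that] by (simp add: x_def sumea)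
    also have "\<dots> \<le> C * (e k * \<alpha>)" using C e(1)[of k] \<alpha> by (intro mult_left_mono) auto
    finally show ?thesis by (simp add: K_def mult_ac)
  qed
  obtain BS where BS: "BS > 0" "\<And>t. t \<in> {0..T} \<Longrightarrow> norm (S t) \<le> BS"
    using pw_cont_bounded[OF T pw_cont_continuous[OF T S(1) subset_UNIV]] by metis
  obtain BA where BA: "BA > 0" "\<And>t. t \<in> {0..T} \<Longrightarrow> norm (A t) \<le> BA"
    using pw_cont_bounded[OF T A] by metis
  \<comment> \<open>the remainders described above, before division by \<open>e k\<close>; \<open>G i\<close> is the contribution of the \<open>i\<close>-th needle\<close>
  define P where "P k s = (F s (x k s) (u k s) - F s (x\<^sub>0 s) (u k s)) - (F s (x k s) (u\<^sub>0 s) - F s (x\<^sub>0 s) (u\<^sub>0 s))" for k s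
  define R where "R k s = F s (x k s) (u\<^sub>0 s) - F s (x\<^sub>0 s) (u\<^sub>0 s) - A s (x k s - x\<^sub>0 s)" for k s
  define G where "G i s = S s (F s (x\<^sub>0 s) (z i) - F s (x\<^sub>0 s) (u\<^sub>0 s))" for i s
  have pS: "pw_cont T UNIV S" by (rule pw_cont_continuous[OF T S(1) subset_UNIV])
  have pz: "pw_cont T M (\<lambda>_. z i)" if "i < N" for i
    by (rule pw_cont_continuous[OF T]) (use z that in auto)
  have pG: "pw_cont T UNIV (G i)" if "i < N" for i
    unfolding G_def by (rule pw_cont_blinfun_apply[OF T pS pw_cont_diff[OF T F_pw_cont[OF pz[OF that] x0_cont] F_pw_cont[OF u0 x0_cont]]])
  have pP: "pw_cont T UNIV (P k)" for k
    unfolding P_def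
    by (rule pw_cont_diff[OF T pw_cont_diff[OF T F_pw_cont[OF pu cx] F_pw_cont[OF pu x0_cont]]
          pw_cont_diff[OF T F_pw_cont[OF u0 cx] F_pw_cont[OF u0 x0_cont]]])
  have pR: "pw_cont T UNIV (R k)" for k
    unfolding R_def
    by (rule pw_cont_diff[OF T pw_cont_diff[OF T F_pw_cont[OF u0 cx] F_pw_cont[OF u0 x0_cont]]
         pw_cont_blinfun_apply[OF T A pw_cont_continuous[OF T continuous_on_diff[OF cx x0_cont] subset_UNIV]]])
  define main where "main k = (\<Sum>i<N. integral {off (ea k) i..off (ea k) i + ea k i} (G i))" for k
  have split: "S s (F s (x k s) (u k s) - F s (x\<^sub>0 s) (u\<^sub>0 s) - A s (x k s - x\<^sub>0 s))
      = S s (P k s + R k s) + (\<Sum>i<N. indicat_real (J (ea k) i) s *\<^sub>R G i s)" for k s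
  proof -
    have "(\<Sum>i<N. indicat_real (J (ea k) i) s *\<^sub>R G i s) = S s (F s (x\<^sub>0 s) (u k s) - F s (x\<^sub>0 s) (u\<^sub>0 s))"
      unfolding u_def ctrl_difference[OF ead order_refl, of "F s (x\<^sub>0 s)"]
      by (simp add: G_def blinfun.sum_right blinfun.scaleR_right)
    moreover have "F s (x k s) (u k s) - F s (x\<^sub>0 s) (u\<^sub>0 s) - A s (x k s - x\<^sub>0 s)
        = (P k s + R k s) + (F s (x\<^sub>0 s) (u k s) - F s (x\<^sub>0 s) (u\<^sub>0 s))"
      by (simp add: P_def R_def)
    ultimately show ?thesis by (simp only: blinfun.add_right[of "S s" "P k s + R k s"])
  qed
  have rem: "((\<lambda>s. S s (P k s + R k s)) has_integral (x k T - x\<^sub>0 T - main k)) {0..T}" for k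
  proof -
    have "((\<lambda>s. \<Sum>i<N. indicat_real (J (ea k) i) s *\<^sub>R G i s) has_integral main k) {0..T}"
      unfolding main_def by (intro has_integral_sum integral_indicator_J ead pG) auto
    from has_integral_diff[OF duhamel[OF S pu[of k] tx[of k]] this] show ?thesis unfolding split by simp
  qed
  have iP: "(\<lambda>s. norm (P k s)) integrable_on {0..T}" and iR: "(\<lambda>s. norm (R k s)) integrable_on {0..T}" for k
    by (rule pw_cont_integrable[OF T pw_cont_norm[OF T pP]], rule pw_cont_integrable[OF T pw_cont_norm[OF T pR]])
  have rem_le: "norm (x k T - x\<^sub>0 T - main k) \<le> BS * (integral {0..T} (\<lambda>s. norm (P k s)) + integral {0..T} (\<lambda>s. norm (R k s)))" for k
  proof -
    have "norm (x k T - x\<^sub>0 T - main k) = norm (integral {0..T} (\<lambda>s. S s (P k s + R k s)))"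
      by (simp only: integral_unique[OF rem])
    also have "\<dots> \<le> integral {0..T} (\<lambda>s. BS * (norm (P k s) + norm (R k s)))"
    proof (rule integral_norm_bound_integral)
      show "(\<lambda>s. S s (P k s + R k s)) integrable_on {0..T}" using rem by blast
      show "(\<lambda>s. BS * (norm (P k s) + norm (R k s))) integrable_on {0..T}"
        by (intro integrable_on_mult_right integrable_add iP iR)
      fix s assume s: "s \<in> {0..T}"
      have "norm (S s (P k s + R k s)) \<le> norm (S s) * norm (P k s + R k s)" by (rule norm_blinfun)
      also have "\<dots> \<le> BS * (norm (P k s) + norm (R k s))"
        using BS(1) by (intro mult_mono BS(2) s norm_triangle_ineq) auto
      finally show "norm (S s (P k s + R k s)) \<le> BS * (norm (P k s) + norm (R k s))" .
    qed
    also have "\<dots> = BS * (integral {0..T} (\<lambda>s. norm (P k s)) + integral {0..T} (\<lambda>s. norm (R k s)))"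
      by (simp add: integral_add[OF iP iR])
    finally show ?thesis .
  qed
  have Ple: "integral {0..T} (\<lambda>s. norm (P k s)) \<le> 2 * (\<Lambda> * K * e k) * (e k * \<alpha>)" for k
  proof -
    have Peq: "P k s = (F s (x k s) (u k s) - F s (x\<^sub>0 s) (u k s)) - (F s (x k s) (u\<^sub>0 s) - F s (x\<^sub>0 s) (u\<^sub>0 s))" for s
      by (simp add: P_def)
    have "integral {0..T} (\<lambda>s. norm (P k s)) \<le> 2 * (\<Lambda> * (K * e k)) * (\<Sum>i<N. ea k i)"
      unfolding Peq u_def
    proof (rule integral_ctrl_difference_le[OF ead, of "\<lambda>s \<zeta>. F s (x k s) \<zeta> - F s (x\<^sub>0 s) \<zeta>"])
      show "norm (F s (x k s) \<zeta> - F s (x\<^sub>0 s) \<zeta>) \<le> \<Lambda> * (K * e k)" if "s \<in> {0..T}" "\<zeta> \<in> M" for s \<zeta>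
        using lip[OF that, of "x k s" "x\<^sub>0 s"] near[OF that(1), of k] \<Lambda> by (meson mult_left_mono less_imp_le order_trans)
      show "(\<lambda>s. norm (F s (x k s) (ctrl (ea k) N s) - F s (x\<^sub>0 s) (ctrl (ea k) N s) - (F s (x k s) (u\<^sub>0 s) - F s (x\<^sub>0 s) (u\<^sub>0 s)))) integrable_on {0..T}"
        using iP[of k] by (simp add: P_def u_def)
    qed
    also have "\<dots> \<le> 2 * (\<Lambda> * (K * e k)) * (e k * \<alpha>)"
      unfolding sumea using \<Lambda> K e(1)[of k] \<alpha> by (intro mult_left_mono) auto
    finally show ?thesis by (simp add: mult_ac)
  qed
  have Rlim: "(\<lambda>k. integral {0..T} (\<lambda>s. norm (R k s) / e k)) \<longlonglongrightarrow> integral {0..T} (\<lambda>_. 0 :: real)"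
  proof (rule dominated_convergence(2)[where h = "\<lambda>_. (\<Lambda> + BA) * K"])
    fix k show "(\<lambda>s. norm (R k s) / e k) integrable_on {0..T}"
      using integrable_on_mult_right[OF iR[of k], of "1 / e k"] by simp
    fix s assume s: "s \<in> {0..T}"
    have us: "u\<^sub>0 s \<in> M" using u0 s by (auto simp: pw_cont_def)
    have "norm (R k s) \<le> norm (F s (x k s) (u\<^sub>0 s) - F s (x\<^sub>0 s) (u\<^sub>0 s)) + norm (A s (x k s - x\<^sub>0 s))"
      unfolding R_def by (rule norm_triangle_ineq4)
    also have "\<dots> \<le> \<Lambda> * norm (x k s - x\<^sub>0 s) + norm (A s) * norm (x k s - x\<^sub>0 s)"
      by (intro add_mono lip s us norm_blinfun)
    also have "\<dots> \<le> \<Lambda> * (K * e k) + BA * (K * e k)"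
      using \<Lambda> BA(1) by (intro add_mono mult_mono BA(2) s near) auto
    finally show "norm (norm (R k s) / e k) \<le> (\<Lambda> + BA) * K"
      using e(1)[of k] by (simp add: field_simps)
  next
    fix s assume s: "s \<in> {0..T}"
    show "(\<lambda>k. norm (R k s) / e k) \<longlonglongrightarrow> 0"
    proof (rule metric_LIMSEQ_I, goal_cases)
      case (1 \<epsilon>)
      define \<epsilon>' where "\<epsilon>' = \<epsilon> / (2 * K)"
      have "\<epsilon>' > 0" using 1 K by (simp add: \<epsilon>'_def)
      then obtain \<delta> where \<delta>: "\<delta> > 0" "\<And>\<xi>. norm (\<xi> - x\<^sub>0 s) < \<delta> \<Longrightarrow>
          norm (F s \<xi> (u\<^sub>0 s) - F s (x\<^sub>0 s) (u\<^sub>0 s) - A s (\<xi> - x\<^sub>0 s)) \<le> \<epsilon>' * norm (\<xi> - x\<^sub>0 s)"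
        using deriv[OF s] unfolding has_derivative_at_alt by metis
      have "(\<lambda>k. K * e k) \<longlonglongrightarrow> K * 0" by (intro tendsto_intros e)
      then have "eventually (\<lambda>k. K * e k < \<delta>) sequentially" using \<delta> by (intro order_tendstoD) auto
      then obtain n where n: "\<And>k. k \<ge> n \<Longrightarrow> K * e k < \<delta>" by (auto simp: eventually_sequentially)
      have "dist (norm (R k s) / e k) 0 < \<epsilon>" if k: "k \<ge> n" for k
      proof -
        have "norm (R k s) \<le> \<epsilon>' * norm (x k s - x\<^sub>0 s)"
          unfolding R_def using near[OF s, of k] n[OF k] by (intro \<delta>(2)) simp
        also have "\<dots> \<le> \<epsilon>' * (K * e k)" using near[OF s, of k] \<open>\<epsilon>' > 0\<close> by (intro mult_left_mono) auto
        also have "\<dots> = \<epsilon> / 2 * e k" using K by (simp add: \<epsilon>'_def)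
        finally have "norm (R k s) / e k \<le> \<epsilon> / 2" using e(1)[of k] by (simp add: field_simps)
        then have "norm (R k s) / e k < \<epsilon>" using 1 by linarith
        then show ?thesis using e(1)[of k] by simp
      qed
      then show ?case by blast
    qed
  qed auto
  have bound0: "(\<lambda>k. BS * (2 * (\<Lambda> * K * e k) * \<alpha> + integral {0..T} (\<lambda>s. norm (R k s) / e k))) \<longlonglongrightarrow> BS * (2 * (\<Lambda> * K * 0) * \<alpha> + 0)"
    using Rlim by (intro tendsto_intros e) simp
  have "norm ((1 / e k) *\<^sub>R (x k T - x\<^sub>0 T) - (1 / e k) *\<^sub>R main k)
      \<le> BS * (2 * (\<Lambda> * K * e k) * \<alpha> + integral {0..T} (\<lambda>s. norm (R k s) / e k))" for k
  proof -
    have ek: "e k > 0" by (rule e(1))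
    have "norm ((1 / e k) *\<^sub>R (x k T - x\<^sub>0 T) - (1 / e k) *\<^sub>R main k) = norm (x k T - x\<^sub>0 T - main k) / e k"
      using ek by (simp flip: scaleR_diff_right)
    also have "\<dots> \<le> BS * (2 * (\<Lambda> * K * e k) * (e k * \<alpha>) + integral {0..T} (\<lambda>s. norm (R k s))) / e k"
      using ek BS(1) by (intro divide_right_mono order_trans[OF rem_le] mult_left_mono add_right_mono Ple) auto
    also have "\<dots> = BS * (2 * (\<Lambda> * K * e k) * \<alpha> + integral {0..T} (\<lambda>s. norm (R k s)) / e k)"
      using ek by (simp add: field_simps)
    finally show ?thesis by simp
  qed
  note quot_le = this
  have diff0: "(\<lambda>k. (1 / e k) *\<^sub>R (x k T - x\<^sub>0 T) - (1 / e k) *\<^sub>R main k) \<longlonglongrightarrow> 0"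
  proof (rule Lim_null_comparison[OF always_eventually])
    show "(\<lambda>k. BS * (2 * (\<Lambda> * K * e k) * \<alpha> + integral {0..T} (\<lambda>s. norm (R k s) / e k))) \<longlonglongrightarrow> 0"
      using bound0 by simp
  qed (rule allI, rule quot_le)
  have "(\<lambda>k. (1 / e k) *\<^sub>R integral {off (ea k) i..off (ea k) i + e k * a k i} (G i)) \<longlonglongrightarrow> b i *\<^sub>R G i (\<tau> i)"
    if i: "i < N" for i
  proof (rule average_over_shrinking_interval[OF T pG[OF i]])
    have "(\<lambda>k. \<tau> i + e k * (\<Sum>j<i. a k j)) \<longlonglongrightarrow> \<tau> i + 0 * (\<Sum>j<i. b j)"
      using i by (intro tendsto_intros e lim) auto
    then show "(\<lambda>k. off (ea k) i) \<longlonglongrightarrow> \<tau> i" by (simp add: off_def ea_def sum_distrib_left)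
    show "off (ea k) i + e k * a k i \<le> T" for k using dom_J(4)[OF ead[of k] i] by (simp add: ea_def)
  qed (use i \<tau> e an lim dom_J(2)[OF ead i] in auto)
  then have "(\<lambda>k. \<Sum>i<N. (1 / e k) *\<^sub>R integral {off (ea k) i..off (ea k) i + e k * a k i} (G i)) \<longlonglongrightarrow> (\<Sum>i<N. b i *\<^sub>R G i (\<tau> i))"
    by (intro tendsto_sum) auto
  then have "(\<lambda>k. (1 / e k) *\<^sub>R main k) \<longlonglongrightarrow> (\<Sum>i<N. b i *\<^sub>R G i (\<tau> i))"
    by (simp add: main_def scaleR_sum_right ea_def)
  from tendsto_add[OF diff0 this] show ?thesis by (simp add: x_def ea_def G_def)
qed

end

section \<open>Convex cones and zeros on the cube\<close>

text \<open>A convex cone in a finite-dimensional space is the whole space if every nonzero functional is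
  positive somewhere on it. Induction on the set of coordinates: the functionals \<open>\<plusminus> e\<^sub>k\<close> give elements of
  the cone whose \<open>k\<close>-th coordinate is positive and negative, respectively, so it suffices that the slice
  \<open>c k = 0\<close> is full. If a functional were nonpositive on the slice, then the numbers \<open>lval c / c k\<close> for
  \<open>c k > 0\<close> would lie below those for \<open>c k < 0\<close>, and a number \<open>s\<close> between them would extend the
  functional by the coefficient \<open>- s\<close> to one that is nonpositive on the cone. Coordinates are indexed by
  a finite set and not by a type, because the number of constraints is a variable.\<close>

lemma cone_separation:
  fixes C :: "('i \<Rightarrow> real) set"
  assumes "finite I"
    and "(\<lambda>_. 0) \<in> C"
    and "\<And>c d. c \<in> C \<Longrightarrow> d \<in> C \<Longrightarrow> (\<lambda>i. c i + d i) \<in> C"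
    and "\<And>c r. c \<in> C \<Longrightarrow> r \<ge> 0 \<Longrightarrow> (\<lambda>i. r * c i) \<in> C"
    and "\<And>l. \<exists>i\<in>I. l i \<noteq> 0 \<Longrightarrow> \<exists>c\<in>C. (\<Sum>i\<in>I. l i * c i) > 0"
  shows "\<exists>c\<in>C. \<forall>i\<in>I. c i = y i"
  using assms
proof (induction I arbitrary: C y rule: finite_induct)
  case empty
  then show ?case by auto
next
  case (insert k I)
  note zero = insert.prems(1) and add = insert.prems(2) and scale = insert.prems(3) and sep = insert.prems(4)
  have sumk: "(\<Sum>i\<in>insert k I. l i * c i) = l k * c k + (\<Sum>i\<in>I. l i * c i)" for l c :: "'i \<Rightarrow> real"
    using insert.hyps by simp
  have "\<exists>c\<in>C. s * c k > 0" if "s \<noteq> 0" for s :: real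
  proof -
    have "(\<Sum>i\<in>I. (if i = k then s else 0) * c i) = 0" for c
      using insert.hyps by (intro sum.neutral) auto
    then show ?thesis using sep[of "\<lambda>i. if i = k then s else 0"] that by (auto simp: sumk)
  qed
  from this[of 1] this[of "-1"] obtain cp cm where cp: "cp \<in> C" "cp k > 0" and cm: "cm \<in> C" "cm k < 0"
    by auto
  define C0 where "C0 = {c \<in> C. c k = 0}"
  have IH: "\<exists>c\<in>C0. \<forall>i\<in>I. c i = z i" for z
  proof (rule insert.IH)
    fix l :: "'i \<Rightarrow> real" assume l: "\<exists>i\<in>I. l i \<noteq> 0"
    show "\<exists>c\<in>C0. (\<Sum>i\<in>I. l i * c i) > 0"
    proof (rule ccontr)
      assume "\<not> ?thesis"
      then have neg: "(\<Sum>i\<in>I. l i * c i) \<le> 0" if "c \<in> C" "c k = 0" for c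
        using that by (auto simp: C0_def not_less)
      define lval where "lval c = (\<Sum>i\<in>I. l i * c i)" for c
      define P where "P = {lval c / c k | c. c \<in> C \<and> c k > 0}"
      define N where "N = {lval c / c k | c. c \<in> C \<and> c k < 0}"
      have PN: "a \<le> b" if ab: "a \<in> P" "b \<in> N" for a b
      proof -
        obtain c d where c: "c \<in> C" "c k > 0" "a = lval c / c k" and d: "d \<in> C" "d k < 0" "b = lval d / d k"
          using ab unfolding P_def N_def by blast
        have "(\<lambda>i. (- d k) * c i + c k * d i) \<in> C" using c d by (intro add scale) auto
        then have "lval (\<lambda>i. (- d k) * c i + c k * d i) \<le> 0" unfolding lval_def by (rule neg) simp
        also have "lval (\<lambda>i. (- d k) * c i + c k * d i) = (- d k) * lval c + c k * lval d"
          by (simp add: lval_def sum_distrib_left distrib_left sum.distrib mult_ac sum_subtractf right_diff_distrib sum_negf)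
        finally have "c k * lval d \<le> d k * lval c" by simp
        then show ?thesis unfolding c(3) d(3) using c(2) d(2) by (simp add: field_simps)
      qed
      have ne: "P \<noteq> {}" "N \<noteq> {}" using cp cm by (auto simp: P_def N_def)
      define s where "s = Sup P"
      obtain b0 where "b0 \<in> N" using ne by blast
      then have "bdd_above P" using PN by (intro bdd_aboveI[of P b0]) blast
      then have sP: "a \<le> s" if "a \<in> P" for a unfolding s_def using that by (intro cSup_upper)
      have sN: "s \<le> b" if "b \<in> N" for b unfolding s_def using ne PN[OF _ that] by (intro cSup_least)
      have "lval c - s * c k \<le> 0" if c: "c \<in> C" for c
      proof -
        consider "c k = 0" | "c k > 0" | "c k < 0" by linarith
        then show ?thesis
        proof cases
          case 1 then show ?thesis using neg[of c] c by (simp add: lval_def)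
        next
          case 2
          then have "lval c / c k \<le> s" using c by (intro sP) (auto simp: P_def)
          then show ?thesis using 2 by (simp add: field_simps)
        next
          case 3
          then have "s \<le> lval c / c k" using c by (intro sN) (auto simp: N_def)
          then show ?thesis using 3 by (simp add: field_simps)
        qed
      qed
      moreover have "\<exists>c\<in>C. (\<Sum>i\<in>insert k I. (l(k := - s)) i * c i) > 0"
        using l insert.hyps by (intro sep) (auto intro!: bexI)
      moreover have "(\<Sum>i\<in>insert k I. (l(k := - s)) i * c i) = lval c - s * c k" for c
        unfolding sumk lval_def using insert.hyps by (auto intro!: sum.cong)
      ultimately show False by (metis not_less)
    qed
  qed (use zero add scale in \<open>auto simp: C0_def\<close>)
  \<comment> \<open>corrects the \<open>k\<close>-th coordinate; what remains lies in the slice\<close>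
  define b where "b = (if y k \<ge> 0 then (\<lambda>i. (y k / cp k) * cp i) else (\<lambda>i. (y k / cm k) * cm i))"
  have b: "b \<in> C" "b k = y k"
    unfolding b_def using cp cm scale[OF cp(1), of "y k / cp k"] scale[OF cm(1), of "y k / cm k"]
    by (auto simp: divide_nonpos_neg)
  obtain c where c: "c \<in> C" "c k = 0" "\<forall>i\<in>I. c i = y i - b i"
    using IH[of "\<lambda>i. y i - b i"] by (auto simp: C0_def)
  have "(\<lambda>i. c i + b i) \<in> C" using b c add by simp
  then show ?case using b c by (intro bexI[of _ "\<lambda>i. c i + b i"]) auto
qed

text \<open>The cube \<open>[-1, 1]\<^sup>n\<close>, with \<open>n\<close> a variable; the coordinates from \<open>n\<close> on are pinned to \<open>0\<close>, so that
  convergence means convergence of all coordinates.\<close>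

definition cube :: "nat \<Rightarrow> (nat \<Rightarrow> real) set" where
  "cube n = {\<eta>. (\<forall>i<n. \<bar>\<eta> i\<bar> \<le> 1) \<and> (\<forall>i\<ge>n. \<eta> i = 0)}"

lemma cube_convergent_subseq:
  fixes \<eta> :: "nat \<Rightarrow> nat \<Rightarrow> real"
  assumes \<eta>: "\<And>k. \<eta> k \<in> cube n"
  obtains e r where "e \<in> cube n" "strict_mono (r :: nat \<Rightarrow> nat)" "\<And>i. (\<lambda>k. \<eta> (r k) i) \<longlonglongrightarrow> e i"
proof -
  have "\<exists>r e. strict_mono (r :: nat \<Rightarrow> nat) \<and> (\<forall>i<m. (\<lambda>k. \<eta> (r k) i) \<longlonglongrightarrow> e i)" for m
  proof (induction m)
    case 0
    show ?case by (intro exI[of _ id]) (auto simp: strict_mono_def)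
  next
    case (Suc m)
    then obtain r e where r: "strict_mono (r :: nat \<Rightarrow> nat)" "\<And>i. i < m \<Longrightarrow> (\<lambda>k. \<eta> (r k) i) \<longlonglongrightarrow> e i" by blast
    have "\<forall>k. \<eta> (r k) m \<in> {-1..1}"
    proof
      fix k show "\<eta> (r k) m \<in> {-1..1}" using \<eta>[of "r k"] by (cases "m < n") (auto simp: cube_def abs_le_iff)
    qed
    then obtain l r' where r': "strict_mono r'" "((\<lambda>k. \<eta> (r k) m) \<circ> r') \<longlonglongrightarrow> l"
      using compact_imp_seq_compact[OF compact_Icc, of "-1::real" 1] unfolding seq_compact_def by metis
    show ?case
    proof (intro exI conjI allI impI)
      show "strict_mono (r \<circ> r')" using r r' by (intro strict_mono_o)
      fix i assume "i < Suc m"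
      then consider "i < m" | "i = m" by linarith
      then show "(\<lambda>k. \<eta> ((r \<circ> r') k) i) \<longlonglongrightarrow> (e(m := l)) i"
      proof cases
        case 1
        then show ?thesis using LIMSEQ_subseq_LIMSEQ[OF r(2)[OF 1] r'(1)] by (simp add: o_def)
      qed (use r' in \<open>simp add: o_def\<close>)
    qed
  qed
  then obtain r e where r: "strict_mono (r :: nat \<Rightarrow> nat)" "\<And>i. i < n \<Longrightarrow> (\<lambda>k. \<eta> (r k) i) \<longlonglongrightarrow> e i" by blast
  define e' where "e' i = (if i < n then e i else 0)" for i
  have lim: "(\<lambda>k. \<eta> (r k) i) \<longlonglongrightarrow> e' i" for i
    using r(2)[of i] \<eta> by (cases "i < n") (auto simp: e'_def cube_def)
  have "\<bar>e' i\<bar> \<le> 1" if "i < n" for i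
    by (rule LIMSEQ_le_const2[OF tendsto_rabs[OF lim]]) (use \<eta> that in \<open>auto simp: cube_def\<close>)
  then have "e' \<in> cube n" by (auto simp: cube_def e'_def)
  then show thesis using that r lim by blast
qed

text \<open>The theorem of Poincare and Miranda, in effect Brouwer's theorem for the map \<open>\<eta> - \<Phi> \<eta>\<close>: the
  hypothesis makes \<open>\<Phi> \<eta> i\<close> negative on the face \<open>\<eta> i = -1\<close> and positive on \<open>\<eta> i = 1\<close>. Labelling the grid
  of mesh \<open>2 / p\<close> by the signs of \<open>\<Phi>\<close>, Kuhn's lemma gives a small cell on which every component changes
  sign; a limit point of these cells is a zero.\<close>

lemma cube_zero:
  fixes \<Phi> :: "(nat \<Rightarrow> real) \<Rightarrow> nat \<Rightarrow> real"
  assumes cont: "\<And>\<eta> e i. (\<And>k. \<eta> k \<in> cube n) \<Longrightarrow> e \<in> cube n \<Longrightarrow> (\<And>j. (\<lambda>k. \<eta> k j) \<longlonglongrightarrow> e j) \<Longrightarrow> i < n \<Longrightarrow>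
      (\<lambda>k. \<Phi> (\<eta> k) i) \<longlonglongrightarrow> \<Phi> e i"
    and near: "\<And>\<eta> i. \<eta> \<in> cube n \<Longrightarrow> i < n \<Longrightarrow> \<bar>\<Phi> \<eta> i - \<eta> i\<bar> < 1"
  obtains e where "e \<in> cube n" "\<And>i. i < n \<Longrightarrow> \<Phi> e i = 0"
proof -
  define pt where "pt p x i = (if i < n then -1 + 2 * real (x i) / real p else 0)" for p :: nat and x :: "nat \<Rightarrow> nat" and i
  have pt: "pt p x \<in> cube n" if "p > 0" "\<forall>i<n. x i \<le> p" for p x
  proof -
    have "real (x i) \<le> real p" if "i < n" for i using that \<open>\<forall>i<n. x i \<le> p\<close> by simp
    then show ?thesis using that(1) by (auto simp: cube_def pt_def abs_le_iff field_simps)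
  qed
  define label where "label p x i = (if \<Phi> (pt p x) i < 0 then 0 else 1 :: nat)" for p x i
  have "\<exists>q r s. (\<forall>i<n. q i < p) \<and> (\<forall>i<n. (\<forall>j<n. q j \<le> r i j \<and> r i j \<le> q j + 1) \<and>
      (\<forall>j<n. q j \<le> s i j \<and> s i j \<le> q j + 1) \<and> \<Phi> (pt p (r i)) i < 0 \<and> \<Phi> (pt p (s i)) i \<ge> 0)"
    if p: "p > 0" for p :: nat
  proof -
    obtain q where q: "\<forall>i<n. q i < p"
      "\<forall>i<n. \<exists>r s. (\<forall>j<n. q j \<le> r j \<and> r j \<le> q j + 1) \<and> (\<forall>j<n. q j \<le> s j \<and> s j \<le> q j + 1) \<and> label p r i \<noteq> label p s i"
    proof (rule kuhn_lemma[OF p, of n "label p"])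
      show "\<forall>x. (\<forall>i<n. x i \<le> p) \<longrightarrow> (\<forall>i<n. x i = 0 \<longrightarrow> label p x i = 0)"
      proof (intro allI impI)
        fix x i assume x: "\<forall>i<n. x i \<le> p" "i < n" "x i = 0"
        then have "pt p x i = -1" by (simp add: pt_def)
        then show "label p x i = 0" using near[OF pt[OF p x(1)] x(2)] by (auto simp: label_def)
      qed
      show "\<forall>x. (\<forall>i<n. x i \<le> p) \<longrightarrow> (\<forall>i<n. x i = p \<longrightarrow> label p x i = 1)"
      proof (intro allI impI)
        fix x i assume x: "\<forall>i<n. x i \<le> p" "i < n" "x i = p"
        then have "pt p x i = 1" using p by (simp add: pt_def)
        then show "label p x i = 1" using near[OF pt[OF p x(1)] x(2)] by (auto simp: label_def)
      qed
    qed (auto simp: label_def)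
    have "\<forall>i. \<exists>r s. i < n \<longrightarrow> (\<forall>j<n. q j \<le> r j \<and> r j \<le> q j + 1) \<and>
      (\<forall>j<n. q j \<le> s j \<and> s j \<le> q j + 1) \<and> \<Phi> (pt p r) i < 0 \<and> \<Phi> (pt p s) i \<ge> 0"
    proof
      fix i
      show "\<exists>r s. i < n \<longrightarrow> (\<forall>j<n. q j \<le> r j \<and> r j \<le> q j + 1) \<and>
      (\<forall>j<n. q j \<le> s j \<and> s j \<le> q j + 1) \<and> \<Phi> (pt p r) i < 0 \<and> \<Phi> (pt p s) i \<ge> 0"
      proof (cases "i < n")
        case True
        then obtain r s where rs: "\<forall>j<n. q j \<le> r j \<and> r j \<le> q j + 1" "\<forall>j<n. q j \<le> s j \<and> s j \<le> q j + 1"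
          "label p r i \<noteq> label p s i" using q(2) by blast
        show ?thesis
        proof (cases "\<Phi> (pt p r) i < 0")
          case True
          then have "\<Phi> (pt p s) i \<ge> 0" using rs(3) by (auto simp: label_def split: if_splits)
          then show ?thesis using rs True by blast
        next
          case False
          then have "\<Phi> (pt p s) i < 0" using rs(3) by (auto simp: label_def split: if_splits)
          then show ?thesis using rs False by (metis not_less)
        qed
      qed blast
    qed
    then show ?thesis using q(1) by metis
  qed
  then have "\<forall>k. \<exists>q r s. (\<forall>i<n. q i < Suc k) \<and> (\<forall>i<n. (\<forall>j<n. q j \<le> r i j \<and> r i j \<le> q j + 1) \<and>
      (\<forall>j<n. q j \<le> s i j \<and> s i j \<le> q j + 1) \<and> \<Phi> (pt (Suc k) (r i)) i < 0 \<and> \<Phi> (pt (Suc k) (s i)) i \<ge> 0)"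
    by blast
  then obtain q r s where qrs: "\<And>k. (\<forall>i<n. q k i < Suc k) \<and> (\<forall>i<n. (\<forall>j<n. q k j \<le> r k i j \<and> r k i j \<le> q k j + 1) \<and>
      (\<forall>j<n. q k j \<le> s k i j \<and> s k i j \<le> q k j + 1) \<and> \<Phi> (pt (Suc k) (r k i)) i < 0 \<and> \<Phi> (pt (Suc k) (s k i)) i \<ge> 0)"
    by metis
  have q: "\<And>k i. i < n \<Longrightarrow> q k i < Suc k"
    and r: "\<And>k i j. i < n \<Longrightarrow> j < n \<Longrightarrow> q k j \<le> r k i j \<and> r k i j \<le> q k j + 1"
    and s: "\<And>k i j. i < n \<Longrightarrow> j < n \<Longrightarrow> q k j \<le> s k i j \<and> s k i j \<le> q k j + 1"
    and neg: "\<And>k i. i < n \<Longrightarrow> \<Phi> (pt (Suc k) (r k i)) i < 0"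
    and pos: "\<And>k i. i < n \<Longrightarrow> \<Phi> (pt (Suc k) (s k i)) i \<ge> 0"
    using qrs by blast+
  have qc: "pt (Suc k) (q k) \<in> cube n" for k using q by (intro pt) (auto intro: less_imp_le)
  obtain e \<rho> where e: "e \<in> cube n" "strict_mono (\<rho> :: nat \<Rightarrow> nat)" "\<And>i. (\<lambda>k. pt (Suc (\<rho> k)) (q (\<rho> k)) i) \<longlonglongrightarrow> e i"
    using cube_convergent_subseq[of "\<lambda>k. pt (Suc k) (q k)" n] qc by metis
  have mesh: "(\<lambda>k. 2 / real (Suc (\<rho> k))) \<longlonglongrightarrow> 0"
    using LIMSEQ_subseq_LIMSEQ[OF tendsto_mult_right_zero[OF LIMSEQ_inverse_real_of_nat, of 2] e(2)]
    by (simp add: o_def divide_inverse)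
  have near_lim: "(\<lambda>k. pt (Suc (\<rho> k)) (x k) j) \<longlonglongrightarrow> e j"
    if x: "\<And>k j. j < n \<Longrightarrow> q (\<rho> k) j \<le> x k j \<and> x k j \<le> q (\<rho> k) j + 1" for x j
  proof -
    have "\<bar>pt (Suc (\<rho> k)) (x k) j - pt (Suc (\<rho> k)) (q (\<rho> k)) j\<bar> \<le> 2 / real (Suc (\<rho> k))" for k
    proof (cases "j < n")
      case True
      then have "real (q (\<rho> k) j) \<le> real (x k j)" "real (x k j) \<le> real (q (\<rho> k) j) + 1"
        using x[of j k] by auto
      moreover have "pt (Suc (\<rho> k)) (x k) j - pt (Suc (\<rho> k)) (q (\<rho> k)) j
         = (2 / real (Suc (\<rho> k))) * (real (x k j) - real (q (\<rho> k) j))"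
        using True by (simp add: pt_def diff_divide_distrib[symmetric] right_diff_distrib)
      ultimately show ?thesis by (simp add: abs_mult divide_right_mono)
    qed (simp add: pt_def)
    then have "(\<lambda>k. pt (Suc (\<rho> k)) (x k) j - pt (Suc (\<rho> k)) (q (\<rho> k)) j) \<longlonglongrightarrow> 0"
      by (intro Lim_null_comparison[OF _ mesh]) (auto simp: eventually_sequentially)
    from tendsto_add[OF this e(3)[of j]] show ?thesis by simp
  qed
  have "\<Phi> e i = 0" if i: "i < n" for i
  proof -
    have rq: "r k i j \<le> Suc k" "s k i j \<le> Suc k" if "j < n" for k j
      using r[OF i that, of k] s[OF i that, of k] q[OF that, of k] by auto
    have "(\<lambda>k. \<Phi> (pt (Suc (\<rho> k)) (r (\<rho> k) i)) i) \<longlonglongrightarrow> \<Phi> e i"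
      using r rq i by (intro cont e near_lim pt) auto
    moreover have "(\<lambda>k. \<Phi> (pt (Suc (\<rho> k)) (s (\<rho> k) i)) i) \<longlonglongrightarrow> \<Phi> e i"
      using s rq i by (intro cont e near_lim pt) auto
    ultimately have "\<Phi> e i \<le> 0" "\<Phi> e i \<ge> 0"
      using LIMSEQ_le_const2[of _ "\<Phi> e i" 0] LIMSEQ_le_const[of _ "\<Phi> e i" 0] neg[OF i] pos[OF i]
      by (meson less_imp_le)+
    then show ?thesis by simp
  qed
  then show thesis using that e by blast
qed

section \<open>Attainability of a better endpoint\<close>

text \<open>The use of Hadamard differentials: directions may vary with the step, as long as they converge.\<close>

lemma has_hadamard_sequence:
  fixes g :: "'a::real_normed_vector \<Rightarrow> real"
  assumes g: "has_hadamard g l y" and e: "\<And>k. e k > 0" "e \<longlonglongrightarrow> 0" and v: "v \<longlonglongrightarrow> w"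
  shows "(\<lambda>k. (g (y + e k *\<^sub>R v k) - g y) / e k) \<longlonglongrightarrow> blinfun_apply l w"
proof -
  have "filterlim e (at_right 0) sequentially"
    by (simp add: filterlim_at e less_imp_neq[OF e(1), symmetric])
  then have lim: "filterlim (\<lambda>k. (e k, v k)) (at_right 0 \<times>\<^sub>F nhds w) sequentially"
    using v by (intro filterlim_Pair)
  have "((\<lambda>(\<theta>, w). (g (y + \<theta> *\<^sub>R w) - g y) /\<^sub>R \<theta>) \<longlongrightarrow> blinfun_apply l w) (at_right 0 \<times>\<^sub>F nhds w)"
    using g unfolding has_hadamard_def by blast
  from filterlim_compose[OF this lim]
  have "(\<lambda>k. (g (y + e k *\<^sub>R v k) - g y) /\<^sub>R e k) \<longlonglongrightarrow> blinfun_apply l w" by simp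
  then show ?thesis by (simp add: divide_inverse mult.commute)
qed

text \<open>Convergence along all sequences with convergent \<open>\<eta>\<close> is uniform on the cube, by compactness.\<close>

lemma uniform_on_cube:
  fixes \<psi> :: "real \<Rightarrow> (nat \<Rightarrow> real) \<Rightarrow> real"
  assumes r: "r > 0"
    and lim: "\<And>e \<eta> l. (\<And>k. 0 < e k \<and> e k < r) \<Longrightarrow> e \<longlonglongrightarrow> 0 \<Longrightarrow> (\<And>k. \<eta> k \<in> cube n) \<Longrightarrow> l \<in> cube n \<Longrightarrow>
        (\<And>j. (\<lambda>k. \<eta> k j) \<longlonglongrightarrow> l j) \<Longrightarrow> (\<lambda>k. \<psi> (e k) (\<eta> k) - \<omega> (\<eta> k)) \<longlonglongrightarrow> 0"
    and \<epsilon>: "\<epsilon> > 0"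
  shows "\<forall>\<^sub>F e in at_right 0. \<forall>\<eta>\<in>cube n. \<bar>\<psi> e \<eta> - \<omega> \<eta>\<bar> < \<epsilon>"
proof (rule ccontr)
  assume no: "\<not> ?thesis"
  have "\<exists>e \<eta>. 0 < e \<and> e < r / real (Suc k) \<and> \<eta> \<in> cube n \<and> \<epsilon> \<le> \<bar>\<psi> e \<eta> - \<omega> \<eta>\<bar>" for k
  proof (rule ccontr)
    assume "\<not> ?thesis"
    then have "\<forall>\<^sub>F e in at_right 0. \<forall>\<eta>\<in>cube n. \<bar>\<psi> e \<eta> - \<omega> \<eta>\<bar> < \<epsilon>"
      unfolding eventually_at_right[OF zero_less_one] using r
      by (intro exI[of _ "r / real (Suc k)"]) (auto simp: not_le)
    then show False using no by blast
  qed
  then obtain e \<eta> where e: "\<And>k. 0 < e k" "\<And>k. e k < r / real (Suc k)" and \<eta>: "\<And>k. \<eta> k \<in> cube n"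
    and far: "\<And>k. \<epsilon> \<le> \<bar>\<psi> (e k) (\<eta> k) - \<omega> (\<eta> k)\<bar>" by metis
  have er: "e k < r" for k
  proof -
    have "r / real (Suc k) \<le> r / 1" using r by (intro divide_left_mono) auto
    then show ?thesis using e(2)[of k] by simp
  qed
  have "(\<lambda>k. r * inverse (real (Suc k))) \<longlonglongrightarrow> r * 0" by (intro tendsto_intros LIMSEQ_inverse_real_of_nat)
  then have r0: "(\<lambda>k. r * inverse (real (Suc k))) \<longlonglongrightarrow> 0" by simp
  have e0: "e \<longlonglongrightarrow> 0"
  proof (rule Lim_null_comparison[OF always_eventually r0], rule allI)
    show "norm (e k) \<le> r * inverse (real (Suc k))" for k
      using e(1)[of k] e(2)[of k] by (simp add: divide_inverse)
  qed
  obtain l \<rho> where l: "l \<in> cube n" "strict_mono (\<rho> :: nat \<Rightarrow> nat)" "\<And>i. (\<lambda>k. \<eta> (\<rho> k) i) \<longlonglongrightarrow> l i"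
    using cube_convergent_subseq[of \<eta> n] \<eta> by metis
  have "(\<lambda>k. e (\<rho> k)) \<longlonglongrightarrow> 0" using LIMSEQ_subseq_LIMSEQ[OF e0 l(2)] by (simp add: o_def)
  then have "(\<lambda>k. \<psi> (e (\<rho> k)) (\<eta> (\<rho> k)) - \<omega> (\<eta> (\<rho> k))) \<longlonglongrightarrow> 0"
    by (rule lim[rotated 1, OF _ _ l(1) l(3)]) (use e er \<eta> in auto)
  then have "eventually (\<lambda>k. dist (\<psi> (e (\<rho> k)) (\<eta> (\<rho> k)) - \<omega> (\<eta> (\<rho> k))) 0 < \<epsilon>) sequentially"
    using \<epsilon> by (rule tendstoD)
  then obtain k where "\<bar>\<psi> (e (\<rho> k)) (\<eta> (\<rho> k)) - \<omega> (\<eta> (\<rho> k))\<bar> < \<epsilon>"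
    by (auto simp: eventually_sequentially)
  then show False using far[of "\<rho> k"] by simp
qed

text \<open>A continuous choice of nonnegative weights \<open>a \<eta>\<close> on the directions \<open>w\<close>, for each prescribed
  first-order change \<open>\<eta>\<close> of the equality constraints, that increases all functions \<open>lg \<alpha>\<close>, \<open>\<alpha> \<in> I\<close>, at
  rate at least \<open>1\<close>.\<close>

definition selection ::
  "nat set \<Rightarrow> (nat \<Rightarrow> 'e \<Rightarrow>\<^sub>L real) \<Rightarrow> nat \<Rightarrow> (nat \<Rightarrow> 'e \<Rightarrow>\<^sub>L real) \<Rightarrow> 'n set \<Rightarrow>
   ('n \<Rightarrow> 'e::real_normed_vector) \<Rightarrow> ((nat \<Rightarrow> real) \<Rightarrow> 'n \<Rightarrow> real) \<Rightarrow> bool" where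
  "selection I lg q lh P w a \<longleftrightarrow>
     (\<forall>\<eta>\<in>cube q. (\<forall>p\<in>P. 0 \<le> a \<eta> p) \<and> (\<forall>\<alpha>\<in>I. 1 \<le> lg \<alpha> (\<Sum>p\<in>P. a \<eta> p *\<^sub>R w p)) \<and>
        (\<forall>j<q. lh j (\<Sum>p\<in>P. a \<eta> p *\<^sub>R w p) = \<eta> j)) \<and>
     (\<exists>B. \<forall>\<eta>\<in>cube q. (\<Sum>p\<in>P. a \<eta> p) \<le> B) \<and>
     (\<forall>\<eta> l. (\<forall>j. (\<lambda>k. \<eta> k j) \<longlonglongrightarrow> l j) \<longrightarrow> (\<forall>p\<in>P. (\<lambda>k. a (\<eta> k) p) \<longlonglongrightarrow> a l p))"

lemma selection_reindex:
  assumes \<pi>: "bij_betw \<pi> Q P" and a: "selection I lg q lh P w a"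
  shows "selection I lg q lh Q (\<lambda>i. w (\<pi> i)) (\<lambda>\<eta> i. a \<eta> (\<pi> i))"
proof -
  have "(\<Sum>i\<in>Q. a \<eta> (\<pi> i) *\<^sub>R w (\<pi> i)) = (\<Sum>p\<in>P. a \<eta> p *\<^sub>R w p)" "(\<Sum>i\<in>Q. a \<eta> (\<pi> i)) = (\<Sum>p\<in>P. a \<eta> p)" for \<eta>
    by (rule sum.reindex_bij_betw[OF \<pi>])+
  moreover have "\<pi> i \<in> P" if "i \<in> Q" for i using \<pi> that by (auto simp: bij_betw_def)
  ultimately show ?thesis using a by (simp add: selection_def)
qed

text \<open>At the endpoint \<open>Y (e a(\<eta>))\<close> the equality constraints divided by \<open>e\<close> differ from \<open>\<eta>\<close> by less than \<open>1\<close>,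
  uniformly on the cube, once \<open>e\<close> is small. So they have a common zero \<open>\<eta>\<close> in the cube, and there the
  active inequalities have increased, at a positive rate, while the inactive ones are still positive.
  Differentiability of \<open>Y\<close> at \<open>0\<close> alone does not allow for the inverse function theorem; continuity of
  \<open>Y\<close> and of \<open>h\<close> is what \<open>cube_zero\<close> needs instead.\<close>

lemma better_endpoint:
  fixes Y :: "(nat \<Rightarrow> real) \<Rightarrow> 'e::real_normed_vector" and w :: "nat \<Rightarrow> 'e" and g h :: "nat \<Rightarrow> 'e \<Rightarrow> real"
    and lg lh :: "nat \<Rightarrow> 'e \<Rightarrow>\<^sub>L real"
  assumes \<rho>: "\<rho> > 0" "\<And>a. (\<And>i. i < N \<Longrightarrow> a i \<ge> 0) \<Longrightarrow> (\<Sum>i<N. a i) < \<rho> \<Longrightarrow> a \<in> D"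
    and cont: "\<And>a b. (\<And>k. a k \<in> D) \<Longrightarrow> b \<in> D \<Longrightarrow> (\<And>i. i < N \<Longrightarrow> (\<lambda>k. a k i) \<longlonglongrightarrow> b i) \<Longrightarrow> (\<lambda>k. Y (a k)) \<longlonglongrightarrow> Y b"
    and diff: "\<And>e a b. (\<And>k. e k > 0) \<Longrightarrow> e \<longlonglongrightarrow> 0 \<Longrightarrow> (\<And>i. i < N \<Longrightarrow> (\<lambda>k. a k i) \<longlonglongrightarrow> b i) \<Longrightarrow>
        (\<And>k. (\<lambda>i. e k * a k i) \<in> D) \<Longrightarrow> (\<lambda>k. (1 / e k) *\<^sub>R (Y (\<lambda>i. e k * a k i) - y)) \<longlonglongrightarrow> (\<Sum>i<N. b i *\<^sub>R w i)"
    and I: "finite I" "I' \<subseteq> I" and g: "\<And>\<alpha>. \<alpha> \<in> I \<Longrightarrow> has_hadamard (g \<alpha>) (lg \<alpha>) y"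
    and inact: "\<And>\<alpha>. \<alpha> \<in> I - I' \<Longrightarrow> g \<alpha> y > 0"
    and h: "\<And>j. j < q \<Longrightarrow> has_hadamard (h j) (lh j) y" "\<And>j. j < q \<Longrightarrow> h j y = 0"
    and hc: "\<And>j. j < q \<Longrightarrow> \<exists>B. open B \<and> y \<in> B \<and> continuous_on B (h j)"
    and a: "selection I' lg q lh {..<N} w a"
  obtains b where "b \<in> D" "\<And>\<alpha>. \<alpha> \<in> I' \<Longrightarrow> g \<alpha> (Y b) > g \<alpha> y" "\<And>\<alpha>. \<alpha> \<in> I - I' \<Longrightarrow> g \<alpha> (Y b) > 0"
    "\<And>j. j < q \<Longrightarrow> h j (Y b) = 0"
proof -
  define v where "v \<eta> = (\<Sum>i<N. a \<eta> i *\<^sub>R w i)" for \<eta>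
  have a0: "a \<eta> i \<ge> 0" if "\<eta> \<in> cube q" "i < N" for \<eta> i using a that by (simp add: selection_def)
  have lgv: "lg \<alpha> (v \<eta>) \<ge> 1" if "\<eta> \<in> cube q" "\<alpha> \<in> I'" for \<alpha> \<eta> using a that by (simp add: selection_def v_def)
  have lhv: "lh j (v \<eta>) = \<eta> j" if "\<eta> \<in> cube q" "j < q" for j \<eta> using a that by (simp add: selection_def v_def)
  have alim: "(\<lambda>k. a (\<eta> k) i) \<longlonglongrightarrow> a l i" if "\<And>j. (\<lambda>k. \<eta> k j) \<longlonglongrightarrow> l j" "i < N" for \<eta> l i
    using a that by (simp add: selection_def)
  obtain A where A: "\<And>\<eta>. \<eta> \<in> cube q \<Longrightarrow> (\<Sum>i<N. a \<eta> i) \<le> A" using a unfolding selection_def by blast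
  define r where "r = \<rho> / (\<bar>A\<bar> + 1)"
  have r: "r > 0" using \<rho> by (simp add: r_def add_nonneg_pos)
  define ea where "ea e \<eta> = (\<lambda>i. e * a \<eta> i)" for e \<eta>
  have D: "ea e \<eta> \<in> D" if "0 < e" "e < r" "\<eta> \<in> cube q" for e \<eta>
  proof (rule \<rho>(2))
    have "(\<Sum>i<N. ea e \<eta> i) = e * (\<Sum>i<N. a \<eta> i)" by (simp add: ea_def sum_distrib_left)
    also have "\<dots> \<le> e * (\<bar>A\<bar> + 1)" using A[OF that(3)] that by (intro mult_left_mono) auto
    also have "\<dots> < r * (\<bar>A\<bar> + 1)" using that by (intro mult_strict_right_mono) auto
    finally show "(\<Sum>i<N. ea e \<eta> i) < \<rho>" by (simp add: r_def add_nonneg_pos)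
  qed (use that a0 in \<open>auto simp: ea_def\<close>)
  define Z where "Z e \<eta> = Y (ea e \<eta>)" for e \<eta>
  have quot: "(\<lambda>k. (1 / e k) *\<^sub>R (Z (e k) (\<eta> k) - y)) \<longlonglongrightarrow> v l"
    if "\<And>k. 0 < e k \<and> e k < r" "e \<longlonglongrightarrow> 0" "\<And>k. \<eta> k \<in> cube q" "\<And>j. (\<lambda>k. \<eta> k j) \<longlonglongrightarrow> l j" for e \<eta> l
    unfolding Z_def ea_def v_def using that D by (intro diff alim) (auto simp: ea_def)
  have hada: "(\<lambda>k. (G (Z (e k) (\<eta> k)) - G y) / e k) \<longlonglongrightarrow> L (v l)"
    if G: "has_hadamard G L y" and e: "\<And>k. 0 < e k \<and> e k < r" "e \<longlonglongrightarrow> 0" "\<And>k. \<eta> k \<in> cube q" "\<And>j. (\<lambda>k. \<eta> k j) \<longlonglongrightarrow> l j" for G L e \<eta> l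
  proof -
    have ek: "\<And>k. e k > 0" "\<And>k. e k \<noteq> 0" using e(1) by (auto simp: less_imp_neq[symmetric])
    show ?thesis using has_hadamard_sequence[OF G ek(1) e(2) quot[OF e]] ek by simp
  qed
  have vlim: "(\<lambda>k. v (\<eta> k)) \<longlonglongrightarrow> v l" if "\<And>j. (\<lambda>k. \<eta> k j) \<longlonglongrightarrow> l j" for \<eta> l
    unfolding v_def by (intro tendsto_intros alim that) auto
  have unif: "\<forall>\<^sub>F e in at_right 0. \<forall>\<eta>\<in>cube q. \<bar>(G (Z e \<eta>) - G y) / e - L (v \<eta>)\<bar> < 1"
    if G: "has_hadamard G L y" for G L
  proof (rule uniform_on_cube[OF r])
    fix e :: "nat \<Rightarrow> real" and \<eta> l
    assume e: "\<And>k. 0 < e k \<and> e k < r" "e \<longlonglongrightarrow> 0" "\<And>k. \<eta> k \<in> cube q" "\<And>j. (\<lambda>k. \<eta> k j) \<longlonglongrightarrow> l j"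
    have "(\<lambda>k. (G (Z (e k) (\<eta> k)) - G y) / e k - L (v (\<eta> k))) \<longlonglongrightarrow> L (v l) - L (v l)"
      by (intro tendsto_intros hada[OF G e] vlim e(4))
    then show "(\<lambda>k. (G (Z (e k) (\<eta> k)) - G y) / e k - L (v (\<eta> k))) \<longlonglongrightarrow> 0" by simp
  qed auto
  have pos: "\<forall>\<^sub>F e in at_right 0. \<forall>\<eta>\<in>cube q. G (Z e \<eta>) > 0"
    if G: "has_hadamard G L y" and Gy: "G y > 0" for G :: "'e \<Rightarrow> real" and L
  proof -
    have "\<forall>\<^sub>F e in at_right 0. \<forall>\<eta>\<in>cube q. \<bar>G (Z e \<eta>) - G y\<bar> < G y"
    proof (rule uniform_on_cube[OF r, where \<omega> = "\<lambda>_. G y"])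
      fix e :: "nat \<Rightarrow> real" and \<eta> l
      assume e: "\<And>k. 0 < e k \<and> e k < r" "e \<longlonglongrightarrow> 0" "\<And>k. \<eta> k \<in> cube q" "\<And>j. (\<lambda>k. \<eta> k j) \<longlonglongrightarrow> l j"
      have ek: "\<And>k. e k \<noteq> 0" using e(1) by (auto simp: less_imp_neq[symmetric])
      have "(\<lambda>k. e k * ((G (Z (e k) (\<eta> k)) - G y) / e k)) \<longlonglongrightarrow> 0 * L (v l)"
        by (intro tendsto_mult e(2) hada[OF G e])
      then show "(\<lambda>k. G (Z (e k) (\<eta> k)) - G y) \<longlonglongrightarrow> 0" using ek by simp
    qed (use Gy in auto)
    then show ?thesis by (rule eventually_mono) (force simp: abs_less_iff)
  qed
  have inB: "\<forall>\<^sub>F e in at_right 0. \<forall>\<eta>\<in>cube q. Z e \<eta> \<in> B" if B: "open B" "y \<in> B" for B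
  proof -
    obtain d where d: "d > 0" "ball y d \<subseteq> B" using B open_contains_ball by blast
    have "\<forall>\<^sub>F e in at_right 0. \<forall>\<eta>\<in>cube q. \<bar>norm (Z e \<eta> - y) - 0\<bar> < d"
    proof (rule uniform_on_cube[OF r, where \<omega> = "\<lambda>_. 0"])
      fix e :: "nat \<Rightarrow> real" and \<eta> l
      assume e: "\<And>k. 0 < e k \<and> e k < r" "e \<longlonglongrightarrow> 0" "\<And>k. \<eta> k \<in> cube q" "\<And>j. (\<lambda>k. \<eta> k j) \<longlonglongrightarrow> l j"
      have ek: "\<And>k. e k \<noteq> 0" using e(1) by (auto simp: less_imp_neq[symmetric])
      have "(\<lambda>k. e k *\<^sub>R ((1 / e k) *\<^sub>R (Z (e k) (\<eta> k) - y))) \<longlonglongrightarrow> 0 *\<^sub>R v l"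
        by (intro tendsto_scaleR e(2) quot[OF e])
      then have "(\<lambda>k. Z (e k) (\<eta> k) - y) \<longlonglongrightarrow> 0" using ek by simp
      then show "(\<lambda>k. norm (Z (e k) (\<eta> k) - y) - 0) \<longlonglongrightarrow> 0" by (simp add: tendsto_norm_zero)
    qed (use d in auto)
    then show ?thesis by (rule eventually_mono) (use d in \<open>auto simp: dist_norm norm_minus_commute subset_iff\<close>)
  qed
  obtain B where B: "\<And>j. j < q \<Longrightarrow> open (B j) \<and> y \<in> B j \<and> continuous_on (B j) (h j)" using hc by metis
  have "finite I'" "finite (I - I')" using I by (auto intro: finite_subset)
  have "\<forall>\<^sub>F e in at_right 0. (0 < e \<and> e < r) \<and>
      (\<forall>\<alpha>\<in>I'. \<forall>\<eta>\<in>cube q. \<bar>(g \<alpha> (Z e \<eta>) - g \<alpha> y) / e - lg \<alpha> (v \<eta>)\<bar> < 1) \<and>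
      (\<forall>\<alpha>\<in>I - I'. \<forall>\<eta>\<in>cube q. g \<alpha> (Z e \<eta>) > 0) \<and>
      (\<forall>j\<in>{..<q}. \<forall>\<eta>\<in>cube q. \<bar>(h j (Z e \<eta>) - h j y) / e - lh j (v \<eta>)\<bar> < 1) \<and>
      (\<forall>j\<in>{..<q}. \<forall>\<eta>\<in>cube q. Z e \<eta> \<in> B j)"
    using I g inact h B r \<open>finite I'\<close> \<open>finite (I - I')\<close>
    by (intro eventually_conj eventually_ball_finite ballI unif pos inB)
       (auto simp: eventually_at_right[OF zero_less_one])
  then obtain e where e: "0 < e" "e < r"
    and R1: "\<And>\<alpha> \<eta>. \<alpha> \<in> I' \<Longrightarrow> \<eta>\<in>cube q \<Longrightarrow> \<bar>(g \<alpha> (Z e \<eta>) - g \<alpha> y) / e - lg \<alpha> (v \<eta>)\<bar> < 1"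
    and R2: "\<And>\<alpha> \<eta>. \<alpha> \<in> I - I' \<Longrightarrow> \<eta>\<in>cube q \<Longrightarrow> g \<alpha> (Z e \<eta>) > 0"
    and R3: "\<And>j \<eta>. j < q \<Longrightarrow> \<eta>\<in>cube q \<Longrightarrow> \<bar>(h j (Z e \<eta>) - h j y) / e - lh j (v \<eta>)\<bar> < 1"
    and R4: "\<And>j \<eta>. j < q \<Longrightarrow> \<eta>\<in>cube q \<Longrightarrow> Z e \<eta> \<in> B j"
    by (drule_tac eventually_happens) (auto simp: Ball_def)
  obtain \<eta> where \<eta>: "\<eta> \<in> cube q" "\<And>j. j < q \<Longrightarrow> h j (Z e \<eta>) / e = 0"
  proof (rule cube_zero[of q "\<lambda>\<eta> j. h j (Z e \<eta>) / e"])
    fix \<eta>s \<eta> j assume s: "\<And>k. \<eta>s k \<in> cube q" "\<eta> \<in> cube q" "\<And>j. (\<lambda>k. \<eta>s k j) \<longlonglongrightarrow> \<eta> j" and j: "j < q"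
    have Zl: "(\<lambda>k. Z e (\<eta>s k)) \<longlonglongrightarrow> Z e \<eta>"
      unfolding Z_def using s e by (intro cont D) (auto simp: ea_def intro!: tendsto_intros alim)
    have "isCont (h j) (Z e \<eta>)"
      using B[OF j] R4[OF j s(2)] continuous_on_eq_continuous_at by blast
    then have "(\<lambda>k. h j (Z e (\<eta>s k))) \<longlonglongrightarrow> h j (Z e \<eta>)" using Zl by (rule isCont_tendsto_compose)
    then show "(\<lambda>k. h j (Z e (\<eta>s k)) / e) \<longlonglongrightarrow> h j (Z e \<eta>) / e" using e by (intro tendsto_intros) auto
  next
    fix \<eta> j assume "\<eta> \<in> cube q" "j < q"
    then show "\<bar>h j (Z e \<eta>) / e - \<eta> j\<bar> < 1" using R3[of j \<eta>] by (simp add: lhv h)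
  qed auto
  show thesis
  proof (rule that)
    show "ea e \<eta> \<in> D" using D e \<eta> by simp
    show "h j (Y (ea e \<eta>)) = 0" if "j < q" for j using \<eta>(2)[OF that] e by (simp add: Z_def)
    show "g \<alpha> (Y (ea e \<eta>)) > 0" if "\<alpha> \<in> I - I'" for \<alpha> using R2[OF that \<eta>(1)] by (simp add: Z_def)
    show "g \<alpha> (Y (ea e \<eta>)) > g \<alpha> y" if "\<alpha> \<in> I'" for \<alpha>
    proof -
      have "(g \<alpha> (Z e \<eta>) - g \<alpha> y) / e > 0" using R1[OF that \<eta>(1)] lgv[OF \<eta>(1) that] by linarith
      then show ?thesis using e by (simp add: Z_def zero_less_divide_iff)
    qed
  qed
qed

text \<open>Consider the first-order changes of the constraints that needles from \<open>Nd\<close> can produce, lowered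
  arbitrarily in the inequality coordinates. If every nonzero multiplier with nonnegative coefficients
  for the inequalities is positive on some needle, then by \<open>cone_separation\<close> this cone is everything; lowering is what forces the multipliers of the
  inequalities to be nonnegative. In particular it contains the change \<open>1\<close> of all inequalities together
  with \<open>0\<close>, and \<open>0\<close> together with each \<open>\<plusminus> e\<^sub>l\<close>; these finitely many elements use finitely many needles,
  and interpolating between them gives the selection. Since all needles
  enter at once, this takes the place of a compactness argument over finite families of needles.\<close>

lemma cone_alternative:
  fixes W :: "'n \<Rightarrow> 'e::real_normed_vector" and lg lh :: "nat \<Rightarrow> 'e \<Rightarrow>\<^sub>L real"
  assumes I: "finite I"
    and no: "\<And>lam \<mu>. (\<exists>\<alpha>\<in>I. lam \<alpha> \<noteq> 0) \<or> (\<exists>j<q. \<mu> j \<noteq> 0) \<Longrightarrow> \<forall>\<alpha>\<in>I. lam \<alpha> \<ge> 0 \<Longrightarrow>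
       \<exists>p\<in>Nd. (\<Sum>\<alpha>\<in>I. lam \<alpha> * lg \<alpha> (W p)) + (\<Sum>j<q. \<mu> j * lh j (W p)) > 0"
  obtains P a where "finite P" "P \<subseteq> Nd" "selection I lg q lh P W a"
proof -
  define V where "V = {v. \<exists>P a. finite P \<and> P \<subseteq> Nd \<and> (\<forall>p\<in>P. 0 \<le> a p) \<and> v = (\<Sum>p\<in>P. a p *\<^sub>R W p)}"
  have VI: "v \<in> V" if "finite P" "P \<subseteq> Nd" "\<forall>p\<in>P. 0 \<le> a p" "v = (\<Sum>p\<in>P. a p *\<^sub>R W p)" for v P a
    unfolding V_def using that by (intro CollectI exI[of _ P] exI[of _ a]) simp
  have extend: "(\<Sum>p\<in>P. a p *\<^sub>R W p) = (\<Sum>p\<in>Q. (if p \<in> P then a p else 0) *\<^sub>R W p)"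
    if "finite Q" "P \<subseteq> Q" for P Q :: "'n set" and a :: "'n \<Rightarrow> real"
    using that by (intro sum.mono_neutral_cong_left) auto
  have Vadd: "v + w \<in> V" if v: "v \<in> V" and w: "w \<in> V" for v w
  proof -
    obtain P a where P: "finite P" "P \<subseteq> Nd" "\<forall>p\<in>P. 0 \<le> a p" "v = (\<Sum>p\<in>P. a p *\<^sub>R W p)"
      using v unfolding V_def by blast
    obtain Q b where Q: "finite Q" "Q \<subseteq> Nd" "\<forall>p\<in>Q. 0 \<le> b p" "w = (\<Sum>p\<in>Q. b p *\<^sub>R W p)"
      using w unfolding V_def by blast
    have "v + w = (\<Sum>p\<in>P \<union> Q. ((if p \<in> P then a p else 0) + (if p \<in> Q then b p else 0)) *\<^sub>R W p)"
      using P Q extend[of "P \<union> Q" P a] extend[of "P \<union> Q" Q b]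
      by (simp add: sum.distrib scaleR_add_left)
    moreover have "\<forall>p\<in>P \<union> Q. 0 \<le> (if p \<in> P then a p else 0) + (if p \<in> Q then b p else 0)" using P Q by auto
    moreover have "finite (P \<union> Q)" "P \<union> Q \<subseteq> Nd" using P Q by auto
    ultimately show ?thesis by (intro VI[where P = "P \<union> Q"])
  qed
  have Vscale: "r *\<^sub>R v \<in> V" if v: "v \<in> V" and r: "r \<ge> 0" for v r
  proof -
    obtain P a where P: "finite P" "P \<subseteq> Nd" "\<forall>p\<in>P. 0 \<le> a p" "v = (\<Sum>p\<in>P. a p *\<^sub>R W p)"
      using v unfolding V_def by blast
    then have "r *\<^sub>R v = (\<Sum>p\<in>P. (r * a p) *\<^sub>R W p)" "\<forall>p\<in>P. 0 \<le> r * a p"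
      using r by (auto simp: scaleR_sum_right)
    then show ?thesis by (intro VI[OF P(1,2)])
  qed
  have V0: "0 \<in> V" by (rule VI[where P = "{}"]) auto
  have VW: "W p \<in> V" if "p \<in> Nd" for p
    by (rule VI[where P = "{p}" and a = "\<lambda>_. 1"]) (use that in auto)
  define C where "C = {c :: nat + nat \<Rightarrow> real. \<exists>v\<in>V. (\<forall>\<alpha>\<in>I. c (Inl \<alpha>) \<le> lg \<alpha> v) \<and> (\<forall>j<q. c (Inr j) = lh j v)}"
  have full: "\<exists>c\<in>C. \<forall>i\<in>I <+> {..<q}. c i = y i" for y
  proof (rule cone_separation)
    show "finite (I <+> {..<q})" using I by simp
    show "(\<lambda>_. 0) \<in> C" unfolding C_def using V0 by (auto intro!: bexI[of _ 0])
    show "(\<lambda>i. c i + d i) \<in> C" if cd: "c \<in> C" "d \<in> C" for c d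
    proof -
      obtain v w where "v \<in> V" "\<forall>\<alpha>\<in>I. c (Inl \<alpha>) \<le> lg \<alpha> v" "\<forall>j<q. c (Inr j) = lh j v"
        "w \<in> V" "\<forall>\<alpha>\<in>I. d (Inl \<alpha>) \<le> lg \<alpha> w" "\<forall>j<q. d (Inr j) = lh j w" using cd unfolding C_def by blast
      then show ?thesis unfolding C_def
        by (intro CollectI bexI[of _ "v + w"] Vadd) (auto simp: blinfun.add_right intro!: add_mono)
    qed
    show "(\<lambda>i. r * c i) \<in> C" if c: "c \<in> C" and r: "r \<ge> 0" for c r
    proof -
      obtain v where "v \<in> V" "\<forall>\<alpha>\<in>I. c (Inl \<alpha>) \<le> lg \<alpha> v" "\<forall>j<q. c (Inr j) = lh j v"
        using c unfolding C_def by blast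
      then show ?thesis unfolding C_def using r
        by (intro CollectI bexI[of _ "r *\<^sub>R v"] Vscale) (auto simp: blinfun.scaleR_right intro!: mult_left_mono)
    qed
    fix l :: "nat + nat \<Rightarrow> real" assume l: "\<exists>i\<in>I <+> {..<q}. l i \<noteq> 0"
    have sumC: "(\<Sum>i\<in>I <+> {..<q}. l i * c i) = (\<Sum>\<alpha>\<in>I. l (Inl \<alpha>) * c (Inl \<alpha>)) + (\<Sum>j<q. l (Inr j) * c (Inr j))" for c
      using I by (simp add: sum.Plus)
    show "\<exists>c\<in>C. (\<Sum>i\<in>I <+> {..<q}. l i * c i) > 0"
    proof (cases "\<forall>\<alpha>\<in>I. l (Inl \<alpha>) \<ge> 0")
      case True
      have "(\<exists>\<alpha>\<in>I. l (Inl \<alpha>) \<noteq> 0) \<or> (\<exists>j<q. l (Inr j) \<noteq> 0)" using l by auto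
      from no[OF this True] obtain p where p: "p \<in> Nd"
        "(\<Sum>\<alpha>\<in>I. l (Inl \<alpha>) * lg \<alpha> (W p)) + (\<Sum>j<q. l (Inr j) * lh j (W p)) > 0" by blast
      show ?thesis
      proof (rule bexI)
        show "(\<Sum>i\<in>I <+> {..<q}. l i * (case_sum (\<lambda>\<alpha>. lg \<alpha> (W p)) (\<lambda>j. lh j (W p))) i) > 0"
          using p(2) by (simp add: sumC)
        show "case_sum (\<lambda>\<alpha>. lg \<alpha> (W p)) (\<lambda>j. lh j (W p)) \<in> C"
          unfolding C_def using VW[OF p(1)] by (auto intro!: bexI[of _ "W p"])
      qed
    next
      case False
      then obtain \<alpha> where \<alpha>: "\<alpha> \<in> I" "l (Inl \<alpha>) < 0" by auto
      show ?thesis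
      proof (rule bexI)
        let ?c = "\<lambda>i. if i = Inl \<alpha> then - 1 else 0 :: real"
        show "?c \<in> C" unfolding C_def using V0 by (auto intro!: bexI[of _ 0])
        have "(\<Sum>i\<in>I <+> {..<q}. l i * ?c i) = (\<Sum>i\<in>I <+> {..<q}. if i = Inl \<alpha> then - l i else 0)"
          by (intro sum.cong) auto
        also have "\<dots> = - l (Inl \<alpha>)" using \<alpha>(1) I by (subst sum.delta) auto
        finally show "(\<Sum>i\<in>I <+> {..<q}. l i * ?c i) > 0" using \<alpha>(2) by simp
      qed
    qed
  qed
  have V_ex: "\<exists>v\<in>V. (\<forall>\<alpha>\<in>I. lg \<alpha> v \<ge> s) \<and> (\<forall>j<q. lh j v = \<eta> j)" for s :: real and \<eta> :: "nat \<Rightarrow> real"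
  proof -
    obtain c where c: "c \<in> C" "\<forall>i\<in>I <+> {..<q}. c i = case_sum (\<lambda>_. s) \<eta> i" using full by blast
    then obtain v where "v \<in> V" "\<forall>\<alpha>\<in>I. c (Inl \<alpha>) \<le> lg \<alpha> v" "\<forall>j<q. c (Inr j) = lh j v"
      unfolding C_def by blast
    moreover have "c (Inl \<alpha>) = s" if "\<alpha> \<in> I" for \<alpha> using c(2) that by force
    moreover have "c (Inr j) = \<eta> j" if "j < q" for j using c(2) that by force
    ultimately show ?thesis by (intro bexI[of _ v]) auto
  qed
  obtain v0 where v0: "v0 \<in> V" "\<And>\<alpha>. \<alpha>\<in>I \<Longrightarrow> lg \<alpha> v0 \<ge> 1" "\<And>j. j<q \<Longrightarrow> lh j v0 = 0"
    using bexE[OF V_ex[of 1 "\<lambda>_. 0"]] by metis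
  have "\<forall>l. \<exists>v\<in>V. (\<forall>\<alpha>\<in>I. lg \<alpha> v \<ge> 0) \<and> (\<forall>j<q. lh j v = (if j = l then 1 else 0))" by (rule allI, rule V_ex)
  then obtain vp where vp: "\<And>l. vp l \<in> V" "\<And>\<alpha> l. \<alpha>\<in>I \<Longrightarrow> lg \<alpha> (vp l) \<ge> 0" "\<And>j l. j<q \<Longrightarrow> lh j (vp l) = (if j = l then 1 else 0)"
    by metis
  have "\<forall>l. \<exists>v\<in>V. (\<forall>\<alpha>\<in>I. lg \<alpha> v \<ge> 0) \<and> (\<forall>j<q. lh j v = (if j = l then -1 else 0))" by (rule allI, rule V_ex)
  then obtain vm where vm: "\<And>l. vm l \<in> V" "\<And>\<alpha> l. \<alpha>\<in>I \<Longrightarrow> lg \<alpha> (vm l) \<ge> 0" "\<And>j l. j<q \<Longrightarrow> lh j (vm l) = (if j = l then -1 else 0)"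
    by metis
  have "\<forall>v. \<exists>P a. v \<in> V \<longrightarrow> finite P \<and> P \<subseteq> Nd \<and> (\<forall>p\<in>P. 0 \<le> a p) \<and> v = (\<Sum>p\<in>P. a p *\<^sub>R W p)"
    unfolding V_def by blast
  then obtain Pf af where "\<forall>v. v \<in> V \<longrightarrow> finite (Pf v) \<and> Pf v \<subseteq> Nd \<and> (\<forall>p\<in>Pf v. (0::real) \<le> af v p) \<and> v = (\<Sum>p\<in>Pf v. af v p *\<^sub>R W p)"
    by metis
  then have PA: "finite (Pf v)" "Pf v \<subseteq> Nd" "\<And>p. p\<in>Pf v \<Longrightarrow> 0 \<le> af v p" "(\<Sum>p\<in>Pf v. af v p *\<^sub>R W p) = v" if "v \<in> V" for v
    using that by auto
  define P where "P = Pf v0 \<union> (\<Union>l<q. Pf (vp l) \<union> Pf (vm l))"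
  define b where "b v p = (if p \<in> Pf v then af v p else 0)" for v p
  have finP: "finite P" unfolding P_def using PA(1) v0 vp vm by auto
  have PNd: "P \<subseteq> Nd" unfolding P_def using PA(2)[OF v0(1)] PA(2)[OF vp(1)] PA(2)[OF vm(1)] by blast
  have b: "(\<Sum>p\<in>P. b v p *\<^sub>R W p) = v" if "v \<in> V" "Pf v \<subseteq> P" for v
    unfolding b_def extend[OF finP that(2), symmetric] by (rule PA(4)[OF that(1)])
  have b0: "b v p \<ge> 0" if "v \<in> V" for v p using PA(3)[OF that] by (simp add: b_def)
  have bp: "(\<Sum>p\<in>P. b v0 p *\<^sub>R W p) = v0" "\<And>l. l < q \<Longrightarrow> (\<Sum>p\<in>P. b (vp l) p *\<^sub>R W p) = vp l"
      "\<And>l. l < q \<Longrightarrow> (\<Sum>p\<in>P. b (vm l) p *\<^sub>R W p) = vm l"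
    by (intro b v0 vp vm; auto simp: P_def)+
  define a where "a \<eta> p = b v0 p + (\<Sum>l<q. max 0 (\<eta> l) * b (vp l) p + max 0 (- \<eta> l) * b (vm l) p)"
    for \<eta> :: "nat \<Rightarrow> real" and p
  have a0: "a \<eta> p \<ge> 0" for \<eta> p
    unfolding a_def using b0 v0 vp vm by (intro add_nonneg_nonneg sum_nonneg mult_nonneg_nonneg) auto
  have v: "(\<Sum>p\<in>P. a \<eta> p *\<^sub>R W p) = v0 + (\<Sum>l<q. max 0 (\<eta> l) *\<^sub>R vp l + max 0 (- \<eta> l) *\<^sub>R vm l)" for \<eta>
  proof -
    have "(\<Sum>p\<in>P. a \<eta> p *\<^sub>R W p) = v0 + (\<Sum>p\<in>P. \<Sum>l<q. max 0 (\<eta> l) *\<^sub>R b (vp l) p *\<^sub>R W p + max 0 (- \<eta> l) *\<^sub>R b (vm l) p *\<^sub>R W p)"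
      by (simp add: a_def bp scaleR_add_left scaleR_sum_left sum.distrib)
    also have "(\<Sum>p\<in>P. \<Sum>l<q. max 0 (\<eta> l) *\<^sub>R b (vp l) p *\<^sub>R W p + max 0 (- \<eta> l) *\<^sub>R b (vm l) p *\<^sub>R W p)
       = (\<Sum>l<q. max 0 (\<eta> l) *\<^sub>R (\<Sum>p\<in>P. b (vp l) p *\<^sub>R W p) + max 0 (- \<eta> l) *\<^sub>R (\<Sum>p\<in>P. b (vm l) p *\<^sub>R W p))"
      by (subst sum.swap) (simp add: scaleR_sum_right sum.distrib)
    finally show ?thesis using bp by simp
  qed
  have lgv: "lg \<alpha> (\<Sum>p\<in>P. a \<eta> p *\<^sub>R W p) \<ge> 1" if "\<alpha> \<in> I" for \<alpha> \<eta>
  proof -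
    have "(\<Sum>l<q. max 0 (\<eta> l) * lg \<alpha> (vp l) + max 0 (- \<eta> l) * lg \<alpha> (vm l)) \<ge> 0"
      using that vp(2) vm(2) by (intro sum_nonneg add_nonneg_nonneg mult_nonneg_nonneg) auto
    then show ?thesis using v0(2)[OF that] unfolding v
      by (simp add: blinfun.add_right blinfun.sum_right blinfun.scaleR_right)
  qed
  have lhv: "lh j (\<Sum>p\<in>P. a \<eta> p *\<^sub>R W p) = \<eta> j" if "j < q" for j \<eta>
  proof -
    have "lh j (\<Sum>p\<in>P. a \<eta> p *\<^sub>R W p) = (\<Sum>l<q. max 0 (\<eta> l) * lh j (vp l) + max 0 (- \<eta> l) * lh j (vm l))"
      unfolding v using v0(3)[OF that] by (simp add: blinfun.add_right blinfun.sum_right blinfun.scaleR_right)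
    also have "\<dots> = (\<Sum>l<q. (if j = l then max 0 (\<eta> l) - max 0 (- \<eta> l) else 0))"
      using that vp(3) vm(3) by (intro sum.cong) auto
    also have "\<dots> = \<eta> j" using that by (simp add: max_def)
    finally show ?thesis .
  qed
  have bound: "(\<Sum>p\<in>P. a \<eta> p) \<le> (\<Sum>p\<in>P. b v0 p + (\<Sum>l<q. b (vp l) p + b (vm l) p))" if "\<eta> \<in> cube q" for \<eta>
  proof -
    have "max 0 (\<eta> l) * b (vp l) p + max 0 (- \<eta> l) * b (vm l) p \<le> 1 * b (vp l) p + 1 * b (vm l) p" if "l < q" for l p
      using that \<open>\<eta> \<in> cube q\<close> b0 vp vm by (intro add_mono mult_right_mono) (auto simp: cube_def abs_le_iff)
    then show ?thesis unfolding a_def by (intro sum_mono add_left_mono) auto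
  qed
  have lim: "(\<lambda>k. a (\<eta> k) p) \<longlonglongrightarrow> a l p" if "\<forall>j. (\<lambda>k. \<eta> k j) \<longlonglongrightarrow> l j" for \<eta> l p
    unfolding a_def using that by (intro tendsto_intros) auto
  have "selection I lg q lh P W a"
    unfolding selection_def using a0 lgv lhv bound lim by blast
  then show thesis using that finP PNd by blast
qed

lemma sorted_enumeration:
  fixes P :: "(real \<times> 'u) set"
  assumes "finite P"
  obtains N \<pi> where "bij_betw \<pi> {..<N::nat} P" "\<And>i j. i \<le> j \<Longrightarrow> j < N \<Longrightarrow> fst (\<pi> i) \<le> fst (\<pi> j)"
proof -
  obtain ys where ys: "set ys = P" "distinct ys" using finite_distinct_list[OF assms] by blast
  define xs where "xs = sort_key fst ys"
  have "bij_betw (\<lambda>i. xs ! i) {..<length xs} P"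
    using ys by (intro bij_betw_nth) (auto simp: xs_def)
  moreover have "fst (xs ! i) \<le> fst (xs ! j)" if "i \<le> j" "j < length xs" for i j
    using sorted_nth_mono[of "map fst xs" i j] that by (simp add: xs_def)
  ultimately show thesis using that by blast
qed

text \<open>The hypothesis \<open>opt\<close> says that no control whose trajectory stays \<open>\<delta>\<close>-close to \<open>x\<^sub>0\<close> does better; the
  set \<open>D\<close> below consists of the lengths for which needle variations stay that close.\<close>

lemma (in needles) not_attainable:
  fixes g h :: "nat \<Rightarrow> 'a \<Rightarrow> real" and lg lh :: "nat \<Rightarrow> 'a \<Rightarrow>\<^sub>L real"
  assumes S: "continuous_on {0..T} S" "S T = id_blinfun"
      "\<And>t. t \<in> {0..T} \<Longrightarrow> S t = S 0 + integral {0..t} (\<lambda>s. - (S s o\<^sub>L A s))"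
    and w: "\<And>i. i < N \<Longrightarrow> w i = S (\<tau> i) (F (\<tau> i) (x\<^sub>0 (\<tau> i)) (z i) - F (\<tau> i) (x\<^sub>0 (\<tau> i)) (u\<^sub>0 (\<tau> i)))"
    and I: "finite I" "I' \<subseteq> I" and g: "\<And>\<alpha>. \<alpha> \<in> I \<Longrightarrow> has_hadamard (g \<alpha>) (lg \<alpha>) (x\<^sub>0 T)"
    and inact: "\<And>\<alpha>. \<alpha> \<in> I - I' \<Longrightarrow> g \<alpha> (x\<^sub>0 T) > 0"
    and h: "\<And>j. j < q \<Longrightarrow> has_hadamard (h j) (lh j) (x\<^sub>0 T)" "\<And>j. j < q \<Longrightarrow> h j (x\<^sub>0 T) = 0"
    and hc: "\<And>j. j < q \<Longrightarrow> \<exists>B. open B \<and> x\<^sub>0 T \<in> B \<and> continuous_on B (h j)"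
    and \<delta>: "\<delta> > 0"
    and opt: "\<And>u. pw_cont T M u \<Longrightarrow> (\<And>t. t \<in> {0..T} \<Longrightarrow> norm (traj u t - x\<^sub>0 t) < \<delta>) \<Longrightarrow>
       (\<And>\<alpha>. \<alpha> \<in> I' \<Longrightarrow> g \<alpha> (traj u T) > g \<alpha> (x\<^sub>0 T)) \<Longrightarrow> (\<And>\<alpha>. \<alpha> \<in> I - I' \<Longrightarrow> g \<alpha> (traj u T) > 0) \<Longrightarrow>
       (\<And>j. j < q \<Longrightarrow> h j (traj u T) = 0) \<Longrightarrow> False"
    and a: "selection I' lg q lh {..<N} w a"
  shows False
proof -
  obtain C where C: "C > 0" "\<And>a t. a \<in> dom \<Longrightarrow> t \<in> {0..T} \<Longrightarrow> norm (X a t - x\<^sub>0 t) \<le> C * (\<Sum>i<N. a i)"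
    using X_near_x0 by metis
  \<comment> \<open>by monotonicity \<open>\<tau> (N - 1)\<close> is the last needle time, so \<open>\<sigma>\<close> is the room left before \<open>T\<close>\<close>
  define \<sigma> where "\<sigma> = (if N = 0 then 1 else T - \<tau> (N - 1))"
  have \<sigma>: "\<sigma> > 0" using \<tau>[of "N - 1"] by (auto simp: \<sigma>_def)
  have \<sigma>\<tau>: "\<tau> i + \<sigma> \<le> T" if "i < N" for i using \<tau>_mono[of i "N - 1"] that by (auto simp: \<sigma>_def)
  define \<rho> where "\<rho> = min \<sigma> (\<delta> / C)"
  have \<rho>: "\<rho> > 0" using \<sigma> \<delta> C by (simp add: \<rho>_def)
  define D where "D = {a \<in> dom. C * (\<Sum>i<N. a i) < \<delta>}"
  obtain b where b: "b \<in> D" "\<And>\<alpha>. \<alpha> \<in> I' \<Longrightarrow> g \<alpha> (X b T) > g \<alpha> (x\<^sub>0 T)" "\<And>\<alpha>. \<alpha> \<in> I - I' \<Longrightarrow> g \<alpha> (X b T) > 0"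
    "\<And>j. j < q \<Longrightarrow> h j (X b T) = 0"
  proof (rule better_endpoint[where D = D and Y = "\<lambda>a. X a T" and y = "x\<^sub>0 T" and N = N and w = w
        and I = I and I' = I' and g = g and lg = lg and h = h and lh = lh and q = q and a = a])
    show "a \<in> D" if a: "\<And>i. i < N \<Longrightarrow> a i \<ge> 0" "(\<Sum>i<N. a i) < \<rho>" for a
    proof -
      have "(\<Sum>i<N. a i) < \<delta> / C" using a(2) by (simp add: \<rho>_def)
      then have "C * (\<Sum>i<N. a i) < \<delta>" using C(1) by (simp add: field_simps)
      moreover have "\<tau> i + (\<Sum>j<N. a j) < T" if "i < N" for i
        using a(2) \<sigma>\<tau>[OF that] by (simp add: \<rho>_def)
      ultimately show ?thesis using a(1) by (simp add: D_def dom_def)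
    qed
    show "(\<lambda>k. X (a k) T) \<longlonglongrightarrow> X b T" if "\<And>k. a k \<in> D" "b \<in> D" "\<And>i. i < N \<Longrightarrow> (\<lambda>k. a k i) \<longlonglongrightarrow> b i" for a b
      using that by (intro endpoint_continuous) (auto simp: D_def)
    show "(\<lambda>k. (1 / e k) *\<^sub>R (X (\<lambda>i. e k * a k i) T - x\<^sub>0 T)) \<longlonglongrightarrow> (\<Sum>i<N. b i *\<^sub>R w i)"
      if "\<And>k. e k > 0" "e \<longlonglongrightarrow> 0" "\<And>i. i < N \<Longrightarrow> (\<lambda>k. a k i) \<longlonglongrightarrow> b i" "\<And>k. (\<lambda>i. e k * a k i) \<in> D" for e a b
    proof -
      have "(\<Sum>i<N. b i *\<^sub>R w i) = (\<Sum>i<N. b i *\<^sub>R S (\<tau> i) (F (\<tau> i) (x\<^sub>0 (\<tau> i)) (z i) - F (\<tau> i) (x\<^sub>0 (\<tau> i)) (u\<^sub>0 (\<tau> i))))"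
        by (intro sum.cong) (auto simp: w)
      then show ?thesis using endpoint_differentiable[OF S that(1,2,3)] that(4) by (simp add: D_def)
    qed
  qed (assumption | rule \<rho> I g inact h hc a | blast)+
  have ad: "b \<in> dom" and small: "C * (\<Sum>i<N. b i) < \<delta>" using b(1) by (auto simp: D_def)
  have "norm (X b t - x\<^sub>0 t) < \<delta>" if "t \<in> {0..T}" for t
    using C(2)[OF ad that] small by simp
  then show False by (rule opt[OF ctrl_pw_cont[OF ad order_refl]]) (use b in auto)
qed

section \<open>Lipschitz estimates along the optimal trajectory\<close>

text \<open>Gateaux differentials are defined by limits from the right only; linearity in \<open>v\<close> supplies the
  limit from the left.\<close>

lemma has_gateaux_line:
  assumes "has_gateaux F L (x + s *\<^sub>R v)"
  shows "((\<lambda>r. F (x + r *\<^sub>R v)) has_vector_derivative L v) (at s)"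
proof -
  let ?p = "x + s *\<^sub>R v"
  have R: "((\<lambda>h. (F (?p + h *\<^sub>R v) - F ?p) /\<^sub>R h) \<longlongrightarrow> L v) (at_right 0)"
    using assms by (simp add: has_gateaux_def)
  have "((\<lambda>h. (F (?p + h *\<^sub>R (- v)) - F ?p) /\<^sub>R h) \<longlongrightarrow> L (- v)) (at_right 0)"
    using assms unfolding has_gateaux_def by blast
  from tendsto_minus[OF this]
  have "((\<lambda>h. (F (?p + (- h) *\<^sub>R v) - F ?p) /\<^sub>R (- h)) \<longlongrightarrow> L v) (at_right (- 0))"
    by (simp add: blinfun.minus_right)
  then have "((\<lambda>h. (F (?p + h *\<^sub>R v) - F ?p) /\<^sub>R h) \<longlongrightarrow> L v) (at_left 0)"
    by (subst filterlim_at_left_to_right)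
  with R have "((\<lambda>h. (F (?p + h *\<^sub>R v) - F ?p) /\<^sub>R h) \<longlongrightarrow> L v) (at 0)"
    by (simp add: filterlim_at_split)
  then have lim: "((\<lambda>h. norm ((F (?p + h *\<^sub>R v) - F ?p) /\<^sub>R h - L v)) \<longlongrightarrow> 0) (at 0)"
    by (intro tendsto_norm_zero) (simp add: LIM_zero_iff)
  have "norm ((F (?p + h *\<^sub>R v) - F ?p) /\<^sub>R h - L v) = norm (F (x + (s + h) *\<^sub>R v) - F (x + s *\<^sub>R v) - h *\<^sub>R L v) / norm h"
    if "h \<noteq> 0" for h
  proof -
    have "(F (?p + h *\<^sub>R v) - F ?p) /\<^sub>R h - L v = (F (?p + h *\<^sub>R v) - F ?p - h *\<^sub>R L v) /\<^sub>R h"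
      using that by (simp add: scaleR_diff_right)
    then show ?thesis by (simp add: scaleR_add_left add.assoc divide_inverse mult.commute)
  qed
  note quotient = this
  from lim have "((\<lambda>h. norm (F (x + (s + h) *\<^sub>R v) - F (x + s *\<^sub>R v) - h *\<^sub>R L v) / norm h) \<longlongrightarrow> 0) (at 0)"
    by (rule Lim_transform_eventually) (auto simp: eventually_at_filter quotient)
  then show ?thesis
    unfolding has_vector_derivative_def has_derivative_at by (auto intro: bounded_linear_scaleR_left)
qed

lemma gateaux_lipschitz:
  fixes F :: "'a::real_normed_vector \<Rightarrow> 'b::real_normed_vector"
  assumes C: "convex C" and cont: "continuous_on C F"
    and ga: "\<And>p. p \<in> C \<Longrightarrow> \<exists>L. has_gateaux F L p \<and> norm L \<le> K"
    and xy: "x \<in> C" "y \<in> C"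
  shows "norm (F y - F x) \<le> K * norm (y - x)"
proof -
  define v where "v = y - x"
  have seg: "x + s *\<^sub>R v \<in> C" if "s \<in> {0..1}" for s
    using convexD_alt[OF C xy, of s] that by (simp add: v_def algebra_simps)
  define L where "L s = (SOME L. has_gateaux F L (x + s *\<^sub>R v) \<and> norm L \<le> K)" for s
  have L: "has_gateaux F (L s) (x + s *\<^sub>R v)" "norm (L s) \<le> K" if "s \<in> {0..1}" for s
    using someI_ex[OF ga[OF seg[OF that]]] by (auto simp: L_def)
  have "norm (F (x + 1 *\<^sub>R v) - F (x + 0 *\<^sub>R v)) \<le> K * norm v * 1 - K * norm v * 0"
  proof (rule differentiable_bound_general[of 0 1 "\<lambda>s. F (x + s *\<^sub>R v)" "\<lambda>s. K * norm v * s" "\<lambda>s. L s v" "\<lambda>_. K * norm v"])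
    show "continuous_on {0..1} (\<lambda>s. F (x + s *\<^sub>R v))"
      by (rule continuous_on_compose2[OF cont]) (auto intro!: continuous_intros seg)
    show "((\<lambda>s. F (x + s *\<^sub>R v)) has_vector_derivative L s v) (at s)" if "0 < s" "s < 1" for s
      by (rule has_gateaux_line[OF L(1)]) (use that in auto)
    show "norm (L s v) \<le> K * norm v" if "0 < s" "s < 1" for s
      using norm_blinfun[of "L s" v] mult_right_mono[OF L(2)[of s], of "norm v"] that by simp
    show "((\<lambda>s. K * norm v * s) has_vector_derivative K * norm v) (at s)" for s
      by (auto intro!: derivative_eq_intros simp: has_real_derivative_iff_has_vector_derivative[symmetric])
  qed (auto intro!: continuous_intros)
  then show ?thesis by (simp add: v_def)
qed

lemma compact_insert_limit:
  fixes f :: "nat \<Rightarrow> 'a::topological_space"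
  assumes "f \<longlonglongrightarrow> l"
  shows "compact (insert l (range f))"
proof (rule compactI)
  fix C assume C: "\<forall>t\<in>C. open t" "insert l (range f) \<subseteq> \<Union>C"
  then obtain U where U: "U \<in> C" "l \<in> U" by auto
  then have "eventually (\<lambda>n. f n \<in> U) sequentially" using assms C(1) by (auto simp: tendsto_def)
  then obtain n where n: "\<And>k. k \<ge> n \<Longrightarrow> f k \<in> U" by (auto simp: eventually_sequentially)
  have "\<forall>k. \<exists>V\<in>C. f k \<in> V" using C(2) by auto
  then obtain V where V: "\<And>k. V k \<in> C" "\<And>k. f k \<in> V k" by metis
  show "\<exists>C'\<subseteq>C. finite C' \<and> insert l (range f) \<subseteq> \<Union>C'"
  proof (intro exI conjI)
    show "insert U (V ` {..<n}) \<subseteq> C" using U V by auto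
    show "finite (insert U (V ` {..<n}))" by simp
    show "insert l (range f) \<subseteq> \<Union>(insert U (V ` {..<n}))"
    proof
      fix p assume "p \<in> insert l (range f)"
      then consider "p = l" | k where "p = f k" "k < n" | k where "p = f k" "k \<ge> n" by force
      then show "p \<in> \<Union>(insert U (V ` {..<n}))" using U V n by cases auto
    qed
  qed
qed

text \<open>The radial retraction onto the ball of radius \<open>\<delta>\<close>, written without case distinction. In a general
  normed space it is Lipschitz with constant \<open>2\<close>, but in general not with \<open>1\<close>.\<close>

definition truncate :: "real \<Rightarrow> 'a::real_normed_vector \<Rightarrow> 'a" where
  "truncate \<delta> v = (\<delta> / max \<delta> (norm v)) *\<^sub>R v"

lemma truncate_eq: "\<delta> > 0 \<Longrightarrow> norm v \<le> \<delta> \<Longrightarrow> truncate \<delta> v = v"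
  by (simp add: truncate_def max_def)

lemma norm_truncate_le: "\<delta> > 0 \<Longrightarrow> norm (truncate \<delta> v) \<le> \<delta>"
  by (auto simp: truncate_def max_def field_simps)

lemma truncate_lipschitz:
  assumes d: "\<delta> > 0"
  shows "norm (truncate \<delta> v - truncate \<delta> w) \<le> 2 * norm (v - w)"
proof -
  define a b where "a = max \<delta> (norm v)" and "b = max \<delta> (norm w)"
  have ab: "a > 0" "b > 0" "\<delta> \<le> a" "norm w \<le> b" using d by (auto simp: a_def b_def)
  have "truncate \<delta> v - truncate \<delta> w = (\<delta> / a) *\<^sub>R (v - w) + (\<delta> / a - \<delta> / b) *\<^sub>R w"
    by (simp add: truncate_def a_def b_def scaleR_diff_right scaleR_diff_left)
  then have "norm (truncate \<delta> v - truncate \<delta> w) \<le> norm ((\<delta> / a) *\<^sub>R (v - w)) + norm ((\<delta> / a - \<delta> / b) *\<^sub>R w)"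
    by (simp only: norm_triangle_ineq)
  also have "norm ((\<delta> / a) *\<^sub>R (v - w)) \<le> 1 * norm (v - w)"
    using ab d mult_right_mono[of "\<delta> / a" 1 "norm (v - w)"] by simp
  also have "norm ((\<delta> / a - \<delta> / b) *\<^sub>R w) = (\<delta> / a) * (\<bar>b - a\<bar> * (norm w / b))"
  proof -
    have "\<delta> / a - \<delta> / b = (\<delta> / a) * ((b - a) / b)" using ab by (simp add: field_simps)
    then show ?thesis using ab d by (simp add: abs_mult)
  qed
  also have "\<dots> \<le> 1 * (\<bar>b - a\<bar> * 1)"
    using ab d by (intro mult_mono mult_left_mono) auto
  also have "\<bar>b - a\<bar> \<le> norm (v - w)"
    using norm_triangle_ineq3[of v w] by (auto simp: a_def b_def max_def)
  finally show ?thesis by simp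
qed

lemma continuous_on_truncate: "\<delta> > 0 \<Longrightarrow> continuous_on X f \<Longrightarrow> continuous_on X (\<lambda>x. truncate \<delta> (f x))"
  unfolding truncate_def by (intro continuous_intros) auto

section \<open>The maximum principle\<close>

locale mayer_problem =
  fixes T :: real and \<Omega> :: "'e::banach set" and \<xi>\<^sub>0 :: 'e and U :: "'u::t2_space set" and m q :: nat
    and f :: "real \<Rightarrow> 'e \<Rightarrow> 'u \<Rightarrow> 'e" and g h :: "nat \<Rightarrow> 'e \<Rightarrow> real"
    and x\<^sub>0 :: "real \<Rightarrow> 'e" and u\<^sub>0 :: "real \<Rightarrow> 'u"
  assumes T: "T > 0" and \<Omega>: "open \<Omega>"
    and sol: "mayer_solution T \<Omega> U \<xi>\<^sub>0 f m q g h x\<^sub>0 u\<^sub>0"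
    and f_cont: "continuous_on ({0..T} \<times> \<Omega> \<times> U) (\<lambda>(t, \<xi>, \<zeta>). f t \<xi> \<zeta>)"
    and f_gateaux: "\<forall>t\<in>{0..T}. \<forall>\<xi>\<in>\<Omega>. \<forall>\<zeta>\<in>U. gateaux_differentiable (\<lambda>\<xi>. f t \<xi> \<zeta>) \<xi>"
    and f_frechet: "\<forall>t\<in>{0..T}. \<forall>\<zeta>\<in>U. (\<lambda>\<xi>. f t \<xi> \<zeta>) differentiable (at (x\<^sub>0 t))"
    and f_frechet_cont: "continuous_on ({0..T} \<times> U) (\<lambda>(t, \<zeta>). DF (\<lambda>\<xi>. f t \<xi> \<zeta>) (x\<^sub>0 t))"
    and f_bounded: "\<forall>K M. compact K \<and> K \<noteq> {} \<and> K \<subseteq> \<Omega> \<and> compact M \<and> M \<noteq> {} \<and> M \<subseteq> U \<longrightarrow>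
      bdd_above ((\<lambda>(t, \<xi>, \<zeta>). norm (DG (\<lambda>\<xi>. f t \<xi> \<zeta>) \<xi>)) ` ({0..T} \<times> K \<times> M))"
    and g_hadamard: "\<forall>\<alpha>\<in>{0..m}. hadamard_differentiable (g \<alpha>) (x\<^sub>0 T)"
    and h_cont: "\<forall>\<beta>\<in>{1..q}. \<exists>N. open N \<and> x\<^sub>0 T \<in> N \<and> N \<subseteq> \<Omega> \<and> continuous_on N (h \<beta>)"
    and h_hadamard: "\<forall>\<beta>\<in>{1..q}. hadamard_differentiable (h \<beta>) (x\<^sub>0 T)"
begin

lemma adm: "admissible T \<Omega> U \<xi>\<^sub>0 f m q g h x\<^sub>0 u\<^sub>0"
  using sol by (simp add: mayer_solution_def)

lemma u0: "pw_cont T U u\<^sub>0"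
  using adm NPC0R_iff[OF T] by (auto simp: admissible_def)

lemma u0_in: "t \<in> {0..T} \<Longrightarrow> u\<^sub>0 t \<in> U"
  using u0 by (auto simp: pw_cont_def)

lemma x0_cont: "continuous_on {0..T} x\<^sub>0" and x0_in: "t \<in> {0..T} \<Longrightarrow> x\<^sub>0 t \<in> \<Omega>"
  using adm by (auto simp: admissible_def PC1_def)

lemma x0_T_hadamard:
  shows "\<alpha> \<le> m \<Longrightarrow> has_hadamard (g \<alpha>) (DH (g \<alpha>) (x\<^sub>0 T)) (x\<^sub>0 T)"
    and "\<beta> \<in> {1..q} \<Longrightarrow> has_hadamard (h \<beta>) (DH (h \<beta>) (x\<^sub>0 T)) (x\<^sub>0 T)"
  using g_hadamard h_hadamard DH_eq unfolding hadamard_differentiable_def by (metis atLeastAtMost_iff le0)+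

definition A :: "real \<Rightarrow> 'e \<Rightarrow>\<^sub>L 'e" where
  "A t = DF (\<lambda>\<xi>. f t \<xi> (u\<^sub>0 t)) (x\<^sub>0 t)"

lemma f_has_derivative:
  assumes "t \<in> {0..T}"
  shows "((\<lambda>\<xi>. f t \<xi> (u\<^sub>0 t)) has_derivative blinfun_apply (A t)) (at (x\<^sub>0 t))"
proof -
  have d: "((\<lambda>\<xi>. f t \<xi> (u\<^sub>0 t)) has_derivative frechet_derivative (\<lambda>\<xi>. f t \<xi> (u\<^sub>0 t)) (at (x\<^sub>0 t))) (at (x\<^sub>0 t))"
    using f_frechet u0_in assms frechet_derivative_works by blast
  then have "bounded_linear (frechet_derivative (\<lambda>\<xi>. f t \<xi> (u\<^sub>0 t)) (at (x\<^sub>0 t)))"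
    by (rule has_derivative_bounded_linear)
  then show ?thesis using d unfolding A_def DF_def by (simp add: bounded_linear_Blinfun_apply)
qed

lemma A_pw_cont: "pw_cont T UNIV A"
  unfolding A_def[abs_def] by (rule pw_cont_compose[OF T u0 f_frechet_cont])

lemma f_continuous_on:
  assumes "continuous_on X a" "continuous_on X y" "continuous_on X w" "a ` X \<subseteq> {0..T}" "y ` X \<subseteq> \<Omega>" "w ` X \<subseteq> U"
  shows "continuous_on X (\<lambda>p. f (a p) (y p) (w p))"
proof -
  have "continuous_on X (\<lambda>p. (a p, y p, w p))" by (intro continuous_intros assms)
  from continuous_on_compose2[OF f_cont this] assms(4-6) show ?thesis by (auto simp: image_subset_iff)
qed

lemma f_x0_cont: "continuous_on ({0..T} \<times> U) (\<lambda>(t, \<zeta>). f t (x\<^sub>0 t) \<zeta>)"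
proof -
  have "continuous_on ({0..T} \<times> U) (\<lambda>p. f (fst p) (x\<^sub>0 (fst p)) (snd p))"
    by (intro f_continuous_on continuous_intros continuous_on_compose2[OF x0_cont]) (auto simp: x0_in)
  then show ?thesis by (simp add: case_prod_unfold)
qed

lemma x0_has_integral:
  assumes "0 \<le> t" "t \<le> T"
  shows "((\<lambda>s. f s (x\<^sub>0 s) (u\<^sub>0 s)) has_integral (x\<^sub>0 t - x\<^sub>0 0)) {0..t}"
proof -
  have x: "x\<^sub>0 \<in> PC1 T \<Omega>" and e: "\<And>s. s \<in> {0..T} \<Longrightarrow> ext_deriv T x\<^sub>0 s = f s (x\<^sub>0 s) (u\<^sub>0 s)"
    using adm by (auto simp: admissible_def)
  show ?thesis
    by (rule has_integral_eq[OF _ PC1_integral(1)[OF T x order_refl assms]]) (use e assms in auto)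
qed

text \<open>A bound on every compact set of states implies a bound on a tube around \<open>x\<^sub>0\<close>: otherwise there are
  points \<open>\<xi> k\<close> approaching the trajectory where the differential exceeds \<open>k\<close>; a subsequence converges to
  a point of the trajectory, and together with its limit it is a compact set.\<close>

lemma tube_bound:
  assumes M: "compact M" "M \<subseteq> U" "M \<noteq> {}"
  obtains \<delta> K where "\<delta> > 0" "K > 0" "\<And>t. t \<in> {0..T} \<Longrightarrow> cball (x\<^sub>0 t) \<delta> \<subseteq> \<Omega>"
    "\<And>t \<zeta> \<xi>. t \<in> {0..T} \<Longrightarrow> \<zeta> \<in> M \<Longrightarrow> \<xi> \<in> cball (x\<^sub>0 t) \<delta> \<Longrightarrow> norm (DG (\<lambda>\<xi>. f t \<xi> \<zeta>) \<xi>) \<le> K"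
proof -
  have cK: "compact (x\<^sub>0 ` {0..T})" by (intro compact_continuous_image x0_cont compact_Icc)
  obtain d0 where d0: "d0 > 0" "(\<Union>x\<in>x\<^sub>0 ` {0..T}. cball x d0) \<subseteq> \<Omega>"
    using compact_subset_open_imp_cball_epsilon_subset[OF cK \<Omega>] x0_in by blast
  have sub: "cball (x\<^sub>0 t) d \<subseteq> \<Omega>" if "t \<in> {0..T}" "d \<le> d0" for t d
  proof -
    have "cball (x\<^sub>0 t) d \<subseteq> cball (x\<^sub>0 t) d0" using that by auto
    also have "\<dots> \<subseteq> (\<Union>x\<in>x\<^sub>0 ` {0..T}. cball x d0)" using that by blast
    finally show ?thesis using d0(2) by blast
  qed
  have "\<exists>k. \<forall>t\<in>{0..T}. \<forall>\<zeta>\<in>M. \<forall>\<xi>\<in>cball (x\<^sub>0 t) (d0 / real (Suc k)). norm (DG (\<lambda>\<xi>. f t \<xi> \<zeta>) \<xi>) \<le> real (Suc k)"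
  proof (rule ccontr)
    assume "\<not> ?thesis"
    then have "\<forall>k. \<exists>t \<zeta> \<xi>. t \<in> {0..T} \<and> \<zeta> \<in> M \<and> \<xi> \<in> cball (x\<^sub>0 t) (d0 / real (Suc k)) \<and> norm (DG (\<lambda>\<xi>. f t \<xi> \<zeta>) \<xi>) > real (Suc k)"
      by (meson not_le)
    then obtain t \<zeta> \<xi> where *: "\<And>k. t k \<in> {0..T} \<and> \<zeta> k \<in> M \<and> \<xi> k \<in> cball (x\<^sub>0 (t k)) (d0 / real (Suc k)) \<and> norm (DG (\<lambda>\<xi>. f (t k) \<xi> (\<zeta> k)) (\<xi> k)) > real (Suc k)"
      by metis
    obtain s r where s: "s \<in> {0..T}" and r: "strict_mono (r :: nat \<Rightarrow> nat)" "(t \<circ> r) \<longlonglongrightarrow> s"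
      using compact_imp_seq_compact[OF compact_Icc, of 0 T] * unfolding seq_compact_def by metis
    have x0r: "(\<lambda>k. x\<^sub>0 (t (r k))) \<longlonglongrightarrow> x\<^sub>0 s"
      using continuous_on_tendsto_compose[OF x0_cont r(2) s] * by (simp add: o_def)
    have "(\<lambda>k. d0 * inverse (real (Suc k))) \<longlonglongrightarrow> d0 * 0" by (intro tendsto_intros LIMSEQ_inverse_real_of_nat)
    from LIMSEQ_subseq_LIMSEQ[OF this r(1)] have dr: "(\<lambda>k. d0 / real (Suc (r k))) \<longlonglongrightarrow> 0"
      by (simp add: o_def divide_inverse)
    have "(\<lambda>k. \<xi> (r k) - x\<^sub>0 (t (r k))) \<longlonglongrightarrow> 0"
    proof (rule Lim_null_comparison[OF always_eventually dr], rule allI)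
      show "norm (\<xi> (r k) - x\<^sub>0 (t (r k))) \<le> d0 / real (Suc (r k))" for k
        using *[of "r k"] by (simp add: dist_norm norm_minus_commute)
    qed
    from tendsto_add[OF this x0r] have \<xi>r: "(\<lambda>k. \<xi> (r k)) \<longlonglongrightarrow> x\<^sub>0 s" by simp
    define Kc where "Kc = insert (x\<^sub>0 s) (range (\<lambda>k. \<xi> (r k)))"
    have "compact Kc" unfolding Kc_def by (rule compact_insert_limit[OF \<xi>r])
    moreover have "\<xi> k \<in> \<Omega>" for k
      using *[of k] sub[of "t k" "d0 / real (Suc k)"] d0(1) by (auto simp: field_simps)
    then have "Kc \<subseteq> \<Omega>" using x0_in[OF s] by (auto simp: Kc_def)
    moreover have "Kc \<noteq> {}" by (simp add: Kc_def)
    ultimately have "bdd_above ((\<lambda>(t, \<xi>, \<zeta>). norm (DG (\<lambda>\<xi>. f t \<xi> \<zeta>) \<xi>)) ` ({0..T} \<times> Kc \<times> M))"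
      using f_bounded[rule_format, of Kc M] M by simp
    then obtain b where b: "\<And>p. p \<in> {0..T} \<times> Kc \<times> M \<Longrightarrow> (\<lambda>(t, \<xi>, \<zeta>). norm (DG (\<lambda>\<xi>. f t \<xi> \<zeta>) \<xi>)) p \<le> b"
      by (auto simp: bdd_above_def)
    have "norm (DG (\<lambda>\<xi>. f (t (r k)) \<xi> (\<zeta> (r k))) (\<xi> (r k))) \<le> b" for k
      using b[of "(t (r k), \<xi> (r k), \<zeta> (r k))"] *[of "r k"] by (auto simp: Kc_def)
    then have "real (Suc (r k)) \<le> b" for k using *[of "r k"] by (meson less_imp_le order_trans)
    moreover obtain k where "real k > b" using reals_Archimedean2 by blast
    moreover have "real k \<le> real (Suc (r k))" using seq_suble[OF r(1), of k] by simp
    ultimately show False by (meson less_le_trans not_le)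
  qed
  then obtain k where k: "\<forall>t\<in>{0..T}. \<forall>\<zeta>\<in>M. \<forall>\<xi>\<in>cball (x\<^sub>0 t) (d0 / real (Suc k)). norm (DG (\<lambda>\<xi>. f t \<xi> \<zeta>) \<xi>) \<le> real (Suc k)" ..
  show thesis
    by (rule that[of "d0 / real (Suc k)" "real (Suc k)"]) (use k d0(1) sub in \<open>auto simp: field_simps\<close>)
qed

lemma tube_lipschitz:
  assumes M: "compact M" "M \<subseteq> U" "M \<noteq> {}"
  obtains \<delta> K where "\<delta> > 0" "K > 0" "\<And>t. t \<in> {0..T} \<Longrightarrow> cball (x\<^sub>0 t) \<delta> \<subseteq> \<Omega>"
    "\<And>t \<zeta> \<xi> \<xi>'. t \<in> {0..T} \<Longrightarrow> \<zeta> \<in> M \<Longrightarrow> \<xi> \<in> cball (x\<^sub>0 t) \<delta> \<Longrightarrow> \<xi>' \<in> cball (x\<^sub>0 t) \<delta> \<Longrightarrow>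
       norm (f t \<xi> \<zeta> - f t \<xi>' \<zeta>) \<le> K * norm (\<xi> - \<xi>')"
proof -
  obtain \<delta> K where d: "\<delta> > 0" "K > 0" "\<And>t. t \<in> {0..T} \<Longrightarrow> cball (x\<^sub>0 t) \<delta> \<subseteq> \<Omega>"
    "\<And>t \<zeta> \<xi>. t \<in> {0..T} \<Longrightarrow> \<zeta> \<in> M \<Longrightarrow> \<xi> \<in> cball (x\<^sub>0 t) \<delta> \<Longrightarrow> norm (DG (\<lambda>\<xi>. f t \<xi> \<zeta>) \<xi>) \<le> K"
    using tube_bound[OF M] by metis
  show thesis
  proof (rule that[OF d(1-3)])
    fix t \<zeta> \<xi> \<xi>' assume t: "t \<in> {0..T}" and \<zeta>: "\<zeta> \<in> M" and \<xi>: "\<xi> \<in> cball (x\<^sub>0 t) \<delta>" "\<xi>' \<in> cball (x\<^sub>0 t) \<delta>"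
    show "norm (f t \<xi> \<zeta> - f t \<xi>' \<zeta>) \<le> K * norm (\<xi> - \<xi>')"
    proof (rule gateaux_lipschitz[OF convex_cball _ _ \<xi>(2,1)])
      show "continuous_on (cball (x\<^sub>0 t) \<delta>) (\<lambda>\<xi>. f t \<xi> \<zeta>)"
        using t \<zeta> M(2) d(3)[OF t] by (intro f_continuous_on continuous_intros) auto
      fix p assume p: "p \<in> cball (x\<^sub>0 t) \<delta>"
      then obtain L where "has_gateaux (\<lambda>\<xi>. f t \<xi> \<zeta>) L p"
        using f_gateaux t \<zeta> M(2) d(3)[OF t] unfolding gateaux_differentiable_def by blast
      then show "\<exists>L. has_gateaux (\<lambda>\<xi>. f t \<xi> \<zeta>) L p \<and> norm L \<le> K"
        using d(4)[OF t \<zeta> p] DG_eq by metis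
    qed
  qed
qed

text \<open>Let \<open>M\<close> contain the range of \<open>u\<^sub>0\<close> and the values of the finitely many needles. Truncating the state in
  a tube on which \<open>f\<close> is Lipschitz for controls in \<open>M\<close> gives a \<open>controlled_system\<close>. Its trajectories that
  stay in the interior of the tube are trajectories of \<open>f\<close>, so optimality of \<open>(x\<^sub>0, u\<^sub>0)\<close> applies to them.
  The tube depends on \<open>M\<close>, hence on the needles, which is why these are fixed before the system.\<close>

lemma unattainable:
  assumes S: "continuous_on {0..T} S" "S T = id_blinfun"
      "\<And>t. t \<in> {0..T} \<Longrightarrow> S t = S 0 + integral {0..t} (\<lambda>s. - (S s o\<^sub>L A s))"
    and W: "\<And>p. W p = S (fst p) (f (fst p) (x\<^sub>0 (fst p)) (snd p) - f (fst p) (x\<^sub>0 (fst p)) (u\<^sub>0 (fst p)))"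
    and I': "I' = {\<alpha>\<in>{0..m}. \<alpha> = 0 \<or> g \<alpha> (x\<^sub>0 T) = 0}"
    and lg: "\<And>\<alpha>. lg \<alpha> = DH (g \<alpha>) (x\<^sub>0 T)" and lh: "\<And>j. lh j = DH (h (Suc j)) (x\<^sub>0 T)"
    and P: "finite P" "P \<subseteq> {0..<T} \<times> U"
    and a: "selection I' lg q lh P W a"
  shows False
proof -
  obtain M0 where M0: "compact M0" "M0 \<subseteq> U" "pw_cont T M0 u\<^sub>0"
    using pw_cont_compact_range[OF T u0] by metis
  define M where "M = M0 \<union> snd ` P"
  have M: "compact M" "M \<subseteq> U"
    unfolding M_def by (rule compact_Un[OF M0(1) finite_imp_compact[OF finite_imageI[OF P(1)]]], use M0(2) P(2) in auto)
  have u0M: "pw_cont T M u\<^sub>0" using pw_cont_mono[OF M0(3)] by (simp add: M_def)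
  then have "M \<noteq> {}" using T by (auto simp: pw_cont_def)
  obtain \<delta> K where d: "\<delta> > 0" "K > 0" "\<And>t. t \<in> {0..T} \<Longrightarrow> cball (x\<^sub>0 t) \<delta> \<subseteq> \<Omega>"
    and lip: "\<And>t \<zeta> \<xi> \<xi>'. t \<in> {0..T} \<Longrightarrow> \<zeta> \<in> M \<Longrightarrow> \<xi> \<in> cball (x\<^sub>0 t) \<delta> \<Longrightarrow> \<xi>' \<in> cball (x\<^sub>0 t) \<delta> \<Longrightarrow>
       norm (f t \<xi> \<zeta> - f t \<xi>' \<zeta>) \<le> K * norm (\<xi> - \<xi>')"
    using tube_lipschitz[OF M \<open>M \<noteq> {}\<close>] by metis
  \<comment> \<open>on the tube \<open>F\<close> agrees with \<open>f\<close>; outside, the state is first moved back to the tube\<close>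
  define F where "F t \<xi> \<zeta> = f t (x\<^sub>0 t + truncate \<delta> (\<xi> - x\<^sub>0 t)) \<zeta>" for t \<xi> \<zeta>
  have tr: "x\<^sub>0 t + truncate \<delta> v \<in> cball (x\<^sub>0 t) \<delta>" for t and v :: 'e
    using norm_truncate_le[OF d(1), of v] by (simp add: dist_norm)
  have Feq: "F t \<xi> \<zeta> = f t \<xi> \<zeta>" if "norm (\<xi> - x\<^sub>0 t) < \<delta>" for t \<xi> \<zeta>
    using truncate_eq[OF d(1), of "\<xi> - x\<^sub>0 t"] that by (simp add: F_def)
  have F0: "F t (x\<^sub>0 t) \<zeta> = f t (x\<^sub>0 t) \<zeta>" for t \<zeta> using Feq d(1) by simp
  obtain N \<pi> where \<pi>: "bij_betw \<pi> {..<N::nat} P" "\<And>i j. i \<le> j \<Longrightarrow> j < N \<Longrightarrow> fst (\<pi> i) \<le> fst (\<pi> j)"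
    using sorted_enumeration[OF P(1)] by metis
  have \<pi>P: "\<pi> i \<in> P" if "i < N" for i using \<pi>(1) that by (auto simp: bij_betw_def)
  interpret V: needles T F M "2 * K" x\<^sub>0 u\<^sub>0 A N "\<lambda>i. fst (\<pi> i)" "\<lambda>i. snd (\<pi> i)"
  proof
    have "continuous_on ({0..T} \<times> UNIV \<times> M) (\<lambda>p. f (fst p) (x\<^sub>0 (fst p) + truncate \<delta> (fst (snd p) - x\<^sub>0 (fst p))) (snd (snd p)))"
    proof (intro f_continuous_on continuous_intros continuous_on_truncate d(1))
      show "continuous_on ({0..T} \<times> UNIV \<times> M) (\<lambda>p. x\<^sub>0 (fst p))"
        by (rule continuous_on_compose2[OF x0_cont]) (auto intro!: continuous_intros)
      then show "continuous_on ({0..T} \<times> UNIV \<times> M) (\<lambda>p. x\<^sub>0 (fst p))" .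
      show "(\<lambda>p. x\<^sub>0 (fst p) + truncate \<delta> (fst (snd p) - x\<^sub>0 (fst p))) ` ({0..T} \<times> UNIV \<times> M) \<subseteq> \<Omega>"
        using d(3) tr by fastforce
    qed (use M in auto)
    then show "continuous_on ({0..T} \<times> UNIV \<times> M) (\<lambda>(t, \<xi>, \<zeta>). F t \<xi> \<zeta>)"
      by (simp add: F_def case_prod_unfold)
    show "norm (F t \<xi> \<zeta> - F t \<xi>' \<zeta>) \<le> 2 * K * norm (\<xi> - \<xi>')" if t: "t \<in> {0..T}" "\<zeta> \<in> M" for t \<xi> \<xi>' \<zeta>
    proof -
      have "norm (F t \<xi> \<zeta> - F t \<xi>' \<zeta>) \<le> K * norm (truncate \<delta> (\<xi> - x\<^sub>0 t) - truncate \<delta> (\<xi>' - x\<^sub>0 t))"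
        unfolding F_def using lip[OF t tr tr, of "\<xi> - x\<^sub>0 t" "\<xi>' - x\<^sub>0 t"] by simp
      also have "\<dots> \<le> K * (2 * norm (\<xi> - \<xi>'))"
        using d(2) truncate_lipschitz[OF d(1), of "\<xi> - x\<^sub>0 t" "\<xi>' - x\<^sub>0 t"] by (intro mult_left_mono) auto
      finally show ?thesis by simp
    qed
    show "x\<^sub>0 t = x\<^sub>0 0 + integral {0..t} (\<lambda>s. F s (x\<^sub>0 s) (u\<^sub>0 s))" if "t \<in> {0..T}" for t
      using integral_unique[OF x0_has_integral, of t] that by (simp add: F0)
    show "((\<lambda>\<xi>. F t \<xi> (u\<^sub>0 t)) has_derivative blinfun_apply (A t)) (at (x\<^sub>0 t))" if "t \<in> {0..T}" for t
      by (rule has_derivative_transform_within_open[OF f_has_derivative[OF that], of "ball (x\<^sub>0 t) \<delta>"])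
         (use d(1) in \<open>auto simp: Feq dist_norm norm_minus_commute\<close>)
    show "0 \<le> fst (\<pi> i) \<and> fst (\<pi> i) < T" "snd (\<pi> i) \<in> M" if "i < N" for i
      using \<pi>P[OF that] P(2) by (auto simp: M_def)
  qed (use T d(2) M u0M x0_cont A_pw_cont \<pi>(2) in auto)
  have better: False
    if u: "pw_cont T M u" and near: "\<And>t. t \<in> {0..T} \<Longrightarrow> norm (V.traj u t - x\<^sub>0 t) < \<delta>"
      and act: "\<And>\<alpha>. \<alpha> \<in> I' \<Longrightarrow> g \<alpha> (V.traj u T) > g \<alpha> (x\<^sub>0 T)"
      and ina: "\<And>\<alpha>. \<alpha> \<in> {0..m} - I' \<Longrightarrow> g \<alpha> (V.traj u T) > 0"
      and hz: "\<And>j. j < q \<Longrightarrow> h (Suc j) (V.traj u T) = 0" for u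
  proof -
    define x where "x = V.traj u"
    have x: "V.is_traj u x" unfolding x_def by (rule V.is_traj_traj[OF u])
    have xi: "x t = x\<^sub>0 0 + integral {0..t} (\<lambda>s. F s (x s) (u s))" if "t \<in> {0..T}" for t
      using x that unfolding V.is_traj_def by blast
    have cx: "continuous_on {0..T} x" using x by (simp add: V.is_traj_def)
    have img: "x ` {0..T} \<subseteq> \<Omega>"
    proof
      fix y assume "y \<in> x ` {0..T}"
      then obtain t where t: "t \<in> {0..T}" "y = x t" by auto
      then have "y \<in> cball (x\<^sub>0 t) \<delta>" using near[OF t(1)] by (simp add: x_def dist_norm norm_minus_commute)
      then show "y \<in> \<Omega>" using d(3)[OF t(1)] by blast
    qed
    have PC1: "x \<in> PC1 T \<Omega>" by (rule integral_pw_cont(1)[OF T V.F_pw_cont[OF u cx] xi]) (use img in auto)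
    have ed: "ext_deriv T x t = f t (x t) (u t)" if "t \<in> {0..T}" for t
    proof -
      have "ext_deriv T x t = F t (x t) (u t)"
        by (rule integral_pw_cont(2)[OF T V.F_pw_cont[OF u cx] xi]) (use that in auto)
      then show ?thesis using Feq[OF near[OF that], of "u t"] by (simp add: x_def)
    qed
    have x00: "x 0 = \<xi>\<^sub>0" using xi[of 0] T adm by (simp add: admissible_def)
    have ge: "g \<alpha> (x T) \<ge> 0" if a: "\<alpha> \<in> {1..m}" for \<alpha>
    proof (cases "\<alpha> \<in> I'")
      case True
      then have "g \<alpha> (x\<^sub>0 T) = 0" using a by (auto simp: I')
      then show ?thesis using act[OF True] by (simp add: x_def)
    next
      case False
      then have "0 < g \<alpha> (x T)" unfolding x_def using a by (intro ina) auto
      then show ?thesis by simp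
    qed
    have hh: "h \<beta> (x T) = 0" if b: "\<beta> \<in> {1..q}" for \<beta>
      using hz b by (cases \<beta>) (auto simp: x_def)
    have "admissible T \<Omega> U \<xi>\<^sub>0 f m q g h x u"
      unfolding admissible_def using PC1 ed x00 ge hh pw_cont_mono[OF u M(2)] NPC0R_iff[OF T, of u U] by auto
    then have "g 0 (x T) \<le> g 0 (x\<^sub>0 T)" using sol unfolding mayer_solution_def by blast
    moreover have "0 \<in> I'" by (simp add: I')
    ultimately show False using act[of 0] by (simp add: x_def)
  qed
  show False
  proof (rule V.not_attainable[OF S, where w = "\<lambda>i. W (\<pi> i)" and I = "{0..m}" and I' = I' and g = g and lg = lg
        and h = "\<lambda>j. h (Suc j)" and lh = lh and q = q and \<delta> = \<delta>
        and a = "\<lambda>\<eta> i. a \<eta> (\<pi> i)"])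
    show "has_hadamard (g \<alpha>) (lg \<alpha>) (x\<^sub>0 T)" if "\<alpha> \<in> {0..m}" for \<alpha>
      unfolding lg using that by (intro x0_T_hadamard) auto
    show "has_hadamard (h (Suc j)) (lh j) (x\<^sub>0 T)" if "j < q" for j
      unfolding lh using that by (intro x0_T_hadamard) auto
    show "h (Suc j) (x\<^sub>0 T) = 0" if "j < q" for j using adm that by (simp add: admissible_def)
    show "\<exists>B. open B \<and> x\<^sub>0 T \<in> B \<and> continuous_on B (h (Suc j))" if "j < q" for j
      using h_cont[rule_format, of "Suc j"] that by auto
    show "g \<alpha> (x\<^sub>0 T) > 0" if "\<alpha> \<in> {0..m} - I'" for \<alpha>
    proof -
      have "\<alpha> \<in> {1..m}" "g \<alpha> (x\<^sub>0 T) \<noteq> 0" using that by (auto simp: I')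
      then show ?thesis using adm by (force simp: admissible_def)
    qed
    show "I' \<subseteq> {0..m}" by (auto simp: I')
    show False if "pw_cont T M u" "\<And>t. t \<in> {0..T} \<Longrightarrow> norm (V.traj u t - x\<^sub>0 t) < \<delta>"
      "\<And>\<alpha>. \<alpha> \<in> I' \<Longrightarrow> g \<alpha> (V.traj u T) > g \<alpha> (x\<^sub>0 T)" "\<And>\<alpha>. \<alpha> \<in> {0..m} - I' \<Longrightarrow> g \<alpha> (V.traj u T) > 0"
      "\<And>j. j < q \<Longrightarrow> h (Suc j) (V.traj u T) = 0" for u
      by (rule better[OF that])
    show "W (\<pi> i) = S (fst (\<pi> i)) (F (fst (\<pi> i)) (x\<^sub>0 (fst (\<pi> i))) (snd (\<pi> i)) -
        F (fst (\<pi> i)) (x\<^sub>0 (fst (\<pi> i))) (u\<^sub>0 (fst (\<pi> i))))" for i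
      by (simp add: W F0)
  qed (use d(1) selection_reindex[OF \<pi>(1) a] in auto)
qed


abbreviation "triple \<equiv> pontryagin_triple T U f m q g h x\<^sub>0 u\<^sub>0"

definition is_resolvent :: "(real \<Rightarrow> 'e \<Rightarrow>\<^sub>L 'e) \<Rightarrow> bool" where
  "is_resolvent S \<longleftrightarrow> continuous_on {0..T} S \<and> S T = id_blinfun \<and>
     (\<forall>t\<in>{0..T}. S t = S 0 + integral {0..t} (\<lambda>s. - (S s o\<^sub>L A s)))"

definition S :: "real \<Rightarrow> 'e \<Rightarrow>\<^sub>L 'e" where
  "S = (SOME S. is_resolvent S)"

lemma S: "continuous_on {0..T} S" "S T = id_blinfun"
  "t \<in> {0..T} \<Longrightarrow> S t = S 0 + integral {0..t} (\<lambda>s. - (S s o\<^sub>L A s))"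
proof -
  have "\<exists>S. is_resolvent S"
    using backward_solution[OF T A_pw_cont] unfolding is_resolvent_def by metis
  then have r: "is_resolvent S" unfolding S_def by (rule someI_ex)
  show "continuous_on {0..T} S" "S T = id_blinfun" using r by (auto simp: is_resolvent_def)
  show "t \<in> {0..T} \<Longrightarrow> S t = S 0 + integral {0..t} (\<lambda>s. - (S s o\<^sub>L A s))"
    using r unfolding is_resolvent_def by blast
qed

definition end_costate :: "(nat \<Rightarrow> real) \<Rightarrow> (nat \<Rightarrow> real) \<Rightarrow> 'e \<Rightarrow>\<^sub>L real" where
  "end_costate lam \<mu> = (\<Sum>\<alpha>=0..m. lam \<alpha> *\<^sub>R DH (g \<alpha>) (x\<^sub>0 T)) + (\<Sum>\<beta>=1..q. \<mu> \<beta> *\<^sub>R DH (h \<beta>) (x\<^sub>0 T))"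

text \<open>The conditions on the multipliers alone, with the maximum condition for all needles expressed through
  the resolvent. Scaling them amounts to scaling finitely many numbers, whereas a triple also contains a
  costate.\<close>

definition multipliers :: "(nat \<Rightarrow> real) \<Rightarrow> (nat \<Rightarrow> real) \<Rightarrow> bool" where
  "multipliers lam \<mu> \<longleftrightarrow> ((\<exists>\<alpha>\<in>{0..m}. lam \<alpha> \<noteq> 0) \<or> (\<exists>\<beta>\<in>{1..q}. \<mu> \<beta> \<noteq> 0)) \<and>
     (\<forall>\<alpha>\<in>{0..m}. lam \<alpha> \<ge> 0) \<and> (\<forall>\<alpha>\<in>{1..m}. lam \<alpha> * g \<alpha> (x\<^sub>0 T) = 0) \<and>
     (\<forall>t\<in>{0..<T}. \<forall>\<zeta>\<in>U. end_costate lam \<mu> (S t (f t (x\<^sub>0 t) \<zeta> - f t (x\<^sub>0 t) (u\<^sub>0 t))) \<le> 0)"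

lemma multipliers_scale:
  assumes "multipliers lam \<mu>" "c > 0"
  shows "multipliers (\<lambda>\<alpha>. c * lam \<alpha>) (\<lambda>\<beta>. c * \<mu> \<beta>)"
proof -
  have "end_costate (\<lambda>\<alpha>. c * lam \<alpha>) (\<lambda>\<beta>. c * \<mu> \<beta>) = c *\<^sub>R end_costate lam \<mu>"
    by (simp add: end_costate_def scaleR_add_right scaleR_sum_right)
  then show ?thesis using assms
    by (auto simp: multipliers_def blinfun.scaleR_left mult_nonneg_nonpos)
qed

lemma multipliers_exist: "\<exists>lam \<mu>. multipliers lam \<mu>"
proof (rule ccontr)
  assume no: "\<not> ?thesis"
  define I' where "I' = {\<alpha>\<in>{0..m}. \<alpha> = 0 \<or> g \<alpha> (x\<^sub>0 T) = 0}"
  define lg where "lg \<alpha> = DH (g \<alpha>) (x\<^sub>0 T)" for \<alpha>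
  define lh where "lh j = DH (h (Suc j)) (x\<^sub>0 T)" for j
  define W where "W p = S (fst p) (f (fst p) (x\<^sub>0 (fst p)) (snd p) - f (fst p) (x\<^sub>0 (fst p)) (u\<^sub>0 (fst p)))" for p
  have I': "I' \<subseteq> {0..m}" "finite I'" by (auto simp: I'_def)
  have ex: "\<exists>p\<in>{0..<T} \<times> U. (\<Sum>\<alpha>\<in>I'. lam \<alpha> * lg \<alpha> (W p)) + (\<Sum>j<q. \<mu> j * lh j (W p)) > 0"
    if nz: "(\<exists>\<alpha>\<in>I'. lam \<alpha> \<noteq> 0) \<or> (\<exists>j<q. \<mu> j \<noteq> 0)" and nn: "\<forall>\<alpha>\<in>I'. lam \<alpha> \<ge> 0" for lam \<mu> :: "nat \<Rightarrow> real"
  proof (rule ccontr)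
    assume neg: "\<not> ?thesis"
    define lam' where "lam' \<alpha> = (if \<alpha> \<in> I' then lam \<alpha> else 0)" for \<alpha>
    \<comment> \<open>equality constraints are numbered from \<open>1\<close> in the problem and from \<open>0\<close> on the cube\<close>
    define \<mu>' where "\<mu>' \<beta> = \<mu> (\<beta> - 1)" for \<beta>
    have ec: "end_costate lam' \<mu>' v = (\<Sum>\<alpha>\<in>I'. lam \<alpha> * lg \<alpha> v) + (\<Sum>j<q. \<mu> j * lh j v)" for v
    proof -
      have "(\<Sum>\<alpha>=0..m. lam' \<alpha> * lg \<alpha> v) = (\<Sum>\<alpha>\<in>I'. lam \<alpha> * lg \<alpha> v)"
        using I' by (intro sum.mono_neutral_cong_right) (auto simp: lam'_def)
      moreover have "(\<Sum>\<beta>=1..q. \<mu>' \<beta> * DH (h \<beta>) (x\<^sub>0 T) v) = (\<Sum>j<q. \<mu> j * lh j v)"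
        by (simp add: sum.atLeast1_atMost_eq \<mu>'_def lh_def)
      ultimately show ?thesis
        by (simp add: end_costate_def blinfun.add_left blinfun.sum_left blinfun.scaleR_left lg_def)
    qed
    have "multipliers lam' \<mu>'"
      unfolding multipliers_def
    proof (intro conjI ballI)
      show "(\<exists>\<alpha>\<in>{0..m}. lam' \<alpha> \<noteq> 0) \<or> (\<exists>\<beta>\<in>{1..q}. \<mu>' \<beta> \<noteq> 0)"
        using nz
      proof
        assume "\<exists>\<alpha>\<in>I'. lam \<alpha> \<noteq> 0"
        then obtain \<alpha> where "\<alpha> \<in> I'" "lam \<alpha> \<noteq> 0" by blast
        then have "\<alpha> \<in> {0..m}" "lam' \<alpha> \<noteq> 0" using I' by (auto simp: lam'_def)
        then show ?thesis by blast
      next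
        assume "\<exists>j<q. \<mu> j \<noteq> 0"
        then obtain j where "j < q" "\<mu> j \<noteq> 0" by blast
        then have "Suc j \<in> {1..q}" "\<mu>' (Suc j) \<noteq> 0" by (auto simp: \<mu>'_def)
        then show ?thesis by blast
      qed
      show "end_costate lam' \<mu>' (S t (f t (x\<^sub>0 t) \<zeta> - f t (x\<^sub>0 t) (u\<^sub>0 t))) \<le> 0" if "t \<in> {0..<T}" "\<zeta> \<in> U" for t \<zeta>
      proof -
        have "\<not> (\<Sum>\<alpha>\<in>I'. lam \<alpha> * lg \<alpha> (W (t, \<zeta>))) + (\<Sum>j<q. \<mu> j * lh j (W (t, \<zeta>))) > 0"
          using neg that by blast
        then show ?thesis unfolding ec by (simp add: W_def)
      qed
    qed (use nn in \<open>auto simp: lam'_def I'_def\<close>)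
    then show False using no by blast
  qed
  obtain P a where sel: "finite P" "P \<subseteq> {0..<T} \<times> U" "selection I' lg q lh P W a"
    by (rule cone_alternative[of I' q "{0..<T} \<times> U" lg W lh, OF I'(2) ex])
  show False
    by (rule unattainable[where P = P and a = a, OF S W_def I'_def lg_def lh_def]) (assumption | rule sel)+
qed

lemma DF_hamiltonian:
  assumes "t \<in> {0..T}"
  shows "DF (\<lambda>\<xi>. H\<^sub>M f t \<xi> (u\<^sub>0 t) p) (x\<^sub>0 t) = p o\<^sub>L A t"
proof (rule DF_eq)
  have "((\<lambda>\<xi>. p (f t \<xi> (u\<^sub>0 t))) has_derivative (\<lambda>v. p (A t v))) (at (x\<^sub>0 t))"
    by (rule bounded_linear.has_derivative[OF blinfun.bounded_linear_right f_has_derivative[OF assms]])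
  moreover have "blinfun_apply (p o\<^sub>L A t) = (\<lambda>v. p (A t v))" by auto
  ultimately show "((\<lambda>\<xi>. H\<^sub>M f t \<xi> (u\<^sub>0 t) p) has_derivative blinfun_apply (p o\<^sub>L A t)) (at (x\<^sub>0 t))"
    by (simp add: H\<^sub>M_def[abs_def])
qed

lemma hamiltonian_cont:
  fixes p :: "real \<Rightarrow> 'e \<Rightarrow>\<^sub>L real"
  assumes p: "continuous_on {0..T} p"
  shows "continuous_on ({0..T} \<times> U) (\<lambda>(t, \<zeta>). p t (f t (x\<^sub>0 t) \<zeta>))"
proof -
  have "continuous_on ({0..T} \<times> U) (\<lambda>x. p (fst x) (f (fst x) (x\<^sub>0 (fst x)) (snd x)))"
    using f_x0_cont by (intro continuous_intros continuous_on_compose2[OF p]) (auto simp: case_prod_unfold)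
  then show ?thesis by (simp add: case_prod_unfold)
qed

text \<open>At a jump \<open>t\<close> of \<open>u\<^sub>0\<close> the left limit \<open>l\<close> of the control is an admissible value, so \<open>H(t, l)\<close> is at most
  \<open>H(t, u\<^sub>0 t)\<close>; passing to the limit in \<open>H(s, u\<^sub>0 s) \<ge> H(s, u\<^sub>0 t)\<close> from the left gives the converse.\<close>

lemma maximised_hamiltonian_continuous:
  fixes p :: "real \<Rightarrow> 'e \<Rightarrow>\<^sub>L real"
  assumes p: "continuous_on {0..T} p"
    and max: "\<And>t \<zeta>. t \<in> {0..T} \<Longrightarrow> \<zeta> \<in> U \<Longrightarrow> p t (f t (x\<^sub>0 t) \<zeta>) \<le> p t (f t (x\<^sub>0 t) (u\<^sub>0 t))"
  shows "continuous_on {0..T} (\<lambda>t. p t (f t (x\<^sub>0 t) (u\<^sub>0 t)))"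
proof -
  define H where "H t = p t (f t (x\<^sub>0 t) (u\<^sub>0 t))" for t
  have pH: "pw_cont T UNIV H"
    unfolding H_def[abs_def] by (rule pw_cont_compose[OF T u0 hamiltonian_cont[OF p]])
  have R: "(H \<longlongrightarrow> H t) (at_right t)" if "t \<in> {0..<T}" for t
    using pH that by (auto simp: pw_cont_def continuous_within)
  have L: "(H \<longlongrightarrow> H t) (at_left t)" if t: "t \<in> {0<..T}" for t
  proof -
    have ev: "eventually (\<lambda>s. s \<in> {0..T}) (at_left t)"
      using t by (subst eventually_at_left[of 0 t]) (auto intro!: exI[of _ 0])
    have t': "t \<in> {0..T}" using t by auto
    have lim: "((\<lambda>s. p s (f s (x\<^sub>0 s) (w s))) \<longlongrightarrow> p t (f t (x\<^sub>0 t) l)) (at_left t)"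
      if w: "(w \<longlongrightarrow> l) (at_left t)" "l \<in> U" "eventually (\<lambda>s. w s \<in> U) (at_left t)" for w l
    proof -
      have "((\<lambda>s. (\<lambda>(t, \<zeta>). p t (f t (x\<^sub>0 t) \<zeta>)) (s, w s)) \<longlongrightarrow> (\<lambda>(t, \<zeta>). p t (f t (x\<^sub>0 t) \<zeta>)) (t, l)) (at_left t)"
        by (rule continuous_on_tendsto_compose[OF hamiltonian_cont[OF p]])
           (use w t' ev in \<open>auto intro!: tendsto_Pair tendsto_ident_at elim: eventually_elim2\<close>)
      then show ?thesis by simp
    qed
    have evU: "eventually (\<lambda>s. u\<^sub>0 s \<in> U) (at_left t)" using ev by (rule eventually_mono) (rule u0_in)
    obtain l where l: "l \<in> U" "(u\<^sub>0 \<longlongrightarrow> l) (at_left t)" using u0 t unfolding pw_cont_def by blast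
    have Hl: "(H \<longlongrightarrow> p t (f t (x\<^sub>0 t) l)) (at_left t)"
      unfolding H_def[abs_def] by (rule lim[OF l(2,1) evU])
    have Hu: "((\<lambda>s. p s (f s (x\<^sub>0 s) (u\<^sub>0 t))) \<longlongrightarrow> H t) (at_left t)"
      unfolding H_def by (rule lim) (use u0_in[OF t'] in auto)
    have "H t \<le> p t (f t (x\<^sub>0 t) l)"
    proof (rule tendsto_le[OF _ Hl Hu])
      show "eventually (\<lambda>s. p s (f s (x\<^sub>0 s) (u\<^sub>0 t)) \<le> H s) (at_left t)"
        unfolding H_def using ev by (rule eventually_mono) (rule max, use u0_in[OF t'] in auto)
    qed simp
    moreover have "p t (f t (x\<^sub>0 t) l) \<le> H t" unfolding H_def by (rule max[OF t' l(1)])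
    ultimately have "p t (f t (x\<^sub>0 t) l) = H t" by simp
    then show ?thesis using Hl by simp
  qed
  have "continuous_on {0..T} H"
    by (rule continuous_on_IccI) (use R L T in \<open>auto simp: filterlim_at_split\<close>)
  then show ?thesis by (simp add: H_def[abs_def])
qed

text \<open>The costate is \<open>p t = p\<^sub>T \<circ> S t\<close>. The maximum condition at \<open>T\<close>, where no needle fits, follows by
  left continuity from earlier times.\<close>

lemma pontryagin_triple_of_multipliers:
  assumes mult: "multipliers lam \<mu>"
  shows "triple lam \<mu> (\<lambda>t. end_costate lam \<mu> o\<^sub>L S t)"
proof -
  define pT where "pT = end_costate lam \<mu>"
  define p where "p t = pT o\<^sub>L S t" for t
  have pS: "pw_cont T UNIV S" by (rule pw_cont_continuous[OF T S(1) subset_UNIV])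
  have pSA: "pw_cont T UNIV (\<lambda>s. - (S s o\<^sub>L A s))"
    by (rule pw_cont_minus[OF T pw_cont_compose_blinfun[OF T pS A_pw_cont]])
  have bl: "bounded_linear (\<lambda>Y :: 'e \<Rightarrow>\<^sub>L 'e. pT o\<^sub>L Y)"
    by (rule bounded_bilinear.bounded_linear_right[OF bounded_bilinear_blinfun_compose])
  have cp: "continuous_on {0..T} p" unfolding p_def by (intro continuous_intros S)
  have pA: "pw_cont T UNIV (\<lambda>s. - (p s o\<^sub>L A s))"
    by (rule pw_cont_minus[OF T pw_cont_compose_blinfun[OF T pw_cont_continuous[OF T cp subset_UNIV] A_pw_cont]])
  have pi: "p t = p 0 + integral {0..t} (\<lambda>s. - (p s o\<^sub>L A s))" if t: "t \<in> {0..T}" for t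
  proof -
    have "(\<lambda>s. - (S s o\<^sub>L A s)) integrable_on {0..t}" using t by (intro pw_cont_integrable'[OF T pSA]) auto
    from integral_linear[OF this bl]
    have "pT o\<^sub>L integral {0..t} (\<lambda>s. - (S s o\<^sub>L A s)) = integral {0..t} (\<lambda>s. pT o\<^sub>L (- (S s o\<^sub>L A s)))"
      by (simp add: o_def)
    also have "(\<lambda>s. pT o\<^sub>L (- (S s o\<^sub>L A s))) = (\<lambda>s. - (p s o\<^sub>L A s))"
      by (intro ext blinfun_eqI) (simp add: p_def blinfun.minus_left blinfun.minus_right)
    finally have I: "pT o\<^sub>L integral {0..t} (\<lambda>s. - (S s o\<^sub>L A s)) = integral {0..t} (\<lambda>s. - (p s o\<^sub>L A s))" .
    have "p t = pT o\<^sub>L (S 0 + integral {0..t} (\<lambda>s. - (S s o\<^sub>L A s)))"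
      unfolding p_def by (rule arg_cong[OF S(3)[OF t]])
    also have "\<dots> = (pT o\<^sub>L S 0) + (pT o\<^sub>L integral {0..t} (\<lambda>s. - (S s o\<^sub>L A s)))"
      by (rule linear_add[OF bounded_linear.linear[OF bl]])
    finally show ?thesis unfolding I by (simp only: p_def)
  qed
  have PC1: "p \<in> PC1 T UNIV"
    by (rule integral_pw_cont(1)[OF T pA pi]) auto
  have ed: "ext_deriv T p t = - (p t o\<^sub>L A t)" if "t \<in> {0..T}" for t
    by (rule integral_pw_cont(2)[OF T pA pi]) (use that in auto)
  have max1: "p t (f t (x\<^sub>0 t) \<zeta>) \<le> p t (f t (x\<^sub>0 t) (u\<^sub>0 t))" if "t \<in> {0..<T}" "\<zeta> \<in> U" for t \<zeta>
    using mult that by (auto simp: multipliers_def p_def pT_def blinfun.diff_right)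
  have maxT: "p T (f T (x\<^sub>0 T) \<zeta>) \<le> p T (f T (x\<^sub>0 T) (u\<^sub>0 T))" if \<zeta>: "\<zeta> \<in> U" for \<zeta>
  proof -
    have "pw_cont T UNIV (\<lambda>t. p t (f t (x\<^sub>0 t) (u\<^sub>0 t)))"
      by (rule pw_cont_compose[OF T u0 hamiltonian_cont[OF cp]])
    moreover have "pw_cont T UNIV (\<lambda>t. p t (f t (x\<^sub>0 t) \<zeta>))"
      by (rule pw_cont_compose[OF T pw_cont_continuous[OF T, of "\<lambda>_. \<zeta>" U] hamiltonian_cont[OF cp]])
         (use \<zeta> in auto)
    ultimately have l: "((\<lambda>t. p t (f t (x\<^sub>0 t) (u\<^sub>0 t))) \<longlongrightarrow> p T (f T (x\<^sub>0 T) (u\<^sub>0 T))) (at_left T)"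
        "((\<lambda>t. p t (f t (x\<^sub>0 t) \<zeta>)) \<longlongrightarrow> p T (f T (x\<^sub>0 T) \<zeta>)) (at_left T)"
      by (auto simp: pw_cont_def continuous_within)
    have ev: "eventually (\<lambda>t. t \<in> {0..<T}) (at_left T)"
      using T by (subst eventually_at_left[of 0 T]) (auto intro!: exI[of _ 0])
    show ?thesis
      by (rule tendsto_le[OF _ l]) (use ev max1 \<zeta> in \<open>auto elim: eventually_mono\<close>)
  qed
  have max: "p t (f t (x\<^sub>0 t) \<zeta>) \<le> p t (f t (x\<^sub>0 t) (u\<^sub>0 t))" if "t \<in> {0..T}" "\<zeta> \<in> U" for t \<zeta>
    using max1[of t \<zeta>] maxT[of \<zeta>] that by (cases "t = T") auto
  have "triple lam \<mu> p"
    unfolding pontryagin_triple_def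
  proof (intro conjI)
    show "\<forall>t\<in>{0..T}. ext_deriv T p t = - DF (\<lambda>\<xi>. H\<^sub>M f t \<xi> (u\<^sub>0 t) (p t)) (x\<^sub>0 t)"
      using ed DF_hamiltonian by simp
    show "(\<Sum>\<alpha>=0..m. lam \<alpha> *\<^sub>R DH (g \<alpha>) (x\<^sub>0 T)) + (\<Sum>\<beta>=1..q. \<mu> \<beta> *\<^sub>R DH (h \<beta>) (x\<^sub>0 T)) = p T"
      unfolding p_def S(2) pT_def end_costate_def[symmetric] by (rule blinfun_eqI) simp
    show "\<forall>t\<in>{0..T}. \<forall>\<zeta>\<in>U. H\<^sub>M f t (x\<^sub>0 t) (u\<^sub>0 t) (p t) \<ge> H\<^sub>M f t (x\<^sub>0 t) \<zeta> (p t)"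
      using max by (simp add: H\<^sub>M_def)
    show "continuous_on {0..T} (\<lambda>t. H\<^sub>M f t (x\<^sub>0 t) (u\<^sub>0 t) (p t))"
      unfolding H\<^sub>M_def by (rule maximised_hamiltonian_continuous[OF cp max])
  qed (use PC1 mult in \<open>auto simp: multipliers_def\<close>)
  then show ?thesis by (simp add: p_def[abs_def] pT_def)
qed

lemma normal_triple_exists:
  assumes "\<And>lam \<mu> p. triple lam \<mu> p \<Longrightarrow> lam 0 \<noteq> 0"
  shows "\<exists>lam \<mu> p. triple lam \<mu> p \<and> lam 0 = 1"
proof -
  obtain lam \<mu> where m: "multipliers lam \<mu>" using multipliers_exist by blast
  have "lam 0 \<noteq> 0" using assms[OF pontryagin_triple_of_multipliers[OF m]] .
  moreover have "lam 0 \<ge> 0" using m by (auto simp: multipliers_def)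
  ultimately have "lam 0 > 0" by simp
  then have "multipliers (\<lambda>\<alpha>. 1 / lam 0 * lam \<alpha>) (\<lambda>\<beta>. 1 / lam 0 * \<mu> \<beta>)" by (intro multipliers_scale m) simp
  from pontryagin_triple_of_multipliers[OF this] \<open>lam 0 > 0\<close> show ?thesis by fastforce
qed

lemma triple_adjoint:
  assumes "triple lam \<mu> p"
  shows "continuous_on {0..T} p"
    and "0 \<le> s \<Longrightarrow> s \<le> t \<Longrightarrow> t \<le> T \<Longrightarrow> ((\<lambda>r. - (p r o\<^sub>L A r)) has_integral (p t - p s)) {s..t}"
proof -
  have p: "p \<in> PC1 T UNIV" and e: "\<And>t. t \<in> {0..T} \<Longrightarrow> ext_deriv T p t = - (p t o\<^sub>L A t)"
    using assms DF_hamiltonian by (auto simp: pontryagin_triple_def)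
  show "continuous_on {0..T} p" using p by (simp add: PC1_def)
  show "((\<lambda>r. - (p r o\<^sub>L A r)) has_integral (p t - p s)) {s..t}" if "0 \<le> s" "s \<le> t" "t \<le> T"
    by (rule has_integral_eq[OF _ PC1_integral(1)[OF T p that]]) (use e that in auto)
qed

lemma triple_end:
  assumes "triple lam \<mu> p"
  shows "p T = (\<Sum>\<alpha>=0..m. lam \<alpha> *\<^sub>R DG (g \<alpha>) (x\<^sub>0 T)) + (\<Sum>\<beta>=1..q. \<mu> \<beta> *\<^sub>R DG (h \<beta>) (x\<^sub>0 T))"
proof -
  have g: "DG (g \<alpha>) (x\<^sub>0 T) = DH (g \<alpha>) (x\<^sub>0 T)" if "\<alpha> \<in> {0..m}" for \<alpha>
    using x0_T_hadamard(1)[of \<alpha>] that unfolding has_hadamard_def by (intro DG_eq) auto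
  have h: "DG (h \<beta>) (x\<^sub>0 T) = DH (h \<beta>) (x\<^sub>0 T)" if "\<beta> \<in> {1..q}" for \<beta>
    using x0_T_hadamard(2)[of \<beta>] that unfolding has_hadamard_def by (intro DG_eq) auto
  show ?thesis using assms by (simp add: pontryagin_triple_def g h)
qed

section \<open>Qualification conditions\<close>

lemma costate_vanishes:
  assumes p: "triple lam \<mu> p" and "c \<in> {0..T}" "p c = 0" "t \<in> {0..T}"
  shows "p t = 0"
  by (rule adjoint_zero[OF T A_pw_cont triple_adjoint[OF p] assms(3,2,4)])

lemma QC1_nondegenerate:
  assumes QC: "QC 1 m q g h (x\<^sub>0 T)" and p: "triple lam \<mu> p" and t: "t \<in> {0..T}"
  shows "(lam 0, p t) \<noteq> (0, 0)"
proof
  assume "(lam 0, p t) = (0, 0)"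
  then have l0: "lam 0 = 0" and "p T = 0" using costate_vanishes[OF p t, of T] T by auto
  then have "(\<Sum>\<alpha>=1..m. lam \<alpha> *\<^sub>R DG (g \<alpha>) (x\<^sub>0 T)) + (\<Sum>\<beta>=1..q. \<mu> \<beta> *\<^sub>R DG (h \<beta>) (x\<^sub>0 T)) = 0"
    using triple_end[OF p] by (simp add: sum.atLeast_Suc_atMost[of 0 m])
  moreover have "\<forall>\<alpha>\<in>{1..m}. lam \<alpha> \<ge> 0" "\<forall>\<alpha>\<in>{1..m}. lam \<alpha> * g \<alpha> (x\<^sub>0 T) = 0"
    using p by (auto simp: pontryagin_triple_def)
  ultimately have "(\<forall>\<alpha>\<in>{1..m}. lam \<alpha> = 0) \<and> (\<forall>\<beta>\<in>{1..q}. \<mu> \<beta> = 0)"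
    using QC unfolding QC_def by blast
  moreover have "(\<exists>\<alpha>\<in>{0..m}. lam \<alpha> \<noteq> 0) \<or> (\<exists>\<beta>\<in>{1..q}. \<mu> \<beta> \<noteq> 0)"
    using p by (simp add: pontryagin_triple_def)
  ultimately obtain \<alpha> where "\<alpha> \<le> m" "lam \<alpha> \<noteq> 0" "\<forall>\<alpha>\<in>{1..m}. lam \<alpha> = 0" by auto
  then show False using l0 by (cases \<alpha>) auto
qed

lemma QC0_nondegenerate:
  assumes QC: "QC 0 m q g h (x\<^sub>0 T)" and p: "triple lam \<mu> p" and t: "t \<in> {0..T}"
  shows "p t \<noteq> 0"
proof
  assume "p t = 0"
  then have "p T = 0" using costate_vanishes[OF p t, of T] T by auto
  then have "(\<Sum>\<alpha>=0..m. lam \<alpha> *\<^sub>R DG (g \<alpha>) (x\<^sub>0 T)) + (\<Sum>\<beta>=1..q. \<mu> \<beta> *\<^sub>R DG (h \<beta>) (x\<^sub>0 T)) = 0"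
    using triple_end[OF p] by simp
  moreover have "\<forall>\<alpha>\<in>{0..m}. lam \<alpha> \<ge> 0" "\<forall>\<alpha>\<in>{1..m}. lam \<alpha> * g \<alpha> (x\<^sub>0 T) = 0"
    using p by (auto simp: pontryagin_triple_def)
  ultimately have "(\<forall>\<alpha>\<in>{0..m}. lam \<alpha> = 0) \<and> (\<forall>\<beta>\<in>{1..q}. \<mu> \<beta> = 0)"
    using QC unfolding QC_def by blast
  then show False using p by (auto simp: pontryagin_triple_def)
qed

text \<open>The directional derivatives of the Hamiltonian at an interior maximum are nonpositive, and they are
  linear in the direction.\<close>

lemma interior_maximum:
  fixes V :: "'y::real_normed_vector set"
  assumes p: "triple lam \<mu> p" and t: "t \<in> {0..T}"
    and hom: "homeomorphism U V \<phi> \<psi>" and int: "\<phi> (u\<^sub>0 t) \<in> interior V"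
    and gd: "gateaux_differentiable (\<lambda>y. f t (x\<^sub>0 t) (\<psi> y)) (\<phi> (u\<^sub>0 t))"
  shows "p t o\<^sub>L DG (\<lambda>y. f t (x\<^sub>0 t) (\<psi> y)) (\<phi> (u\<^sub>0 t)) = 0"
proof -
  define G where "G y = f t (x\<^sub>0 t) (\<psi> y)" for y
  define y where "y = \<phi> (u\<^sub>0 t)"
  obtain D where D: "has_gateaux G D y" using gd by (auto simp: gateaux_differentiable_def G_def[abs_def] y_def)
  have Gy: "G y = f t (x\<^sub>0 t) (u\<^sub>0 t)"
    using hom u0_in[OF t] by (simp add: G_def y_def homeomorphism_def)
  have max: "p t (G y') \<le> p t (G y)" if "y' \<in> V" for y'
  proof -
    have "\<psi> y' \<in> U" using hom that by (auto simp: homeomorphism_def)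
    then show ?thesis using p t unfolding Gy by (auto simp: G_def pontryagin_triple_def H\<^sub>M_def)
  qed
  have le: "p t (D v) \<le> 0" for v
  proof -
    have "((\<lambda>\<theta>. y + \<theta> *\<^sub>R v) \<longlongrightarrow> y + 0 *\<^sub>R v) (at_right 0)" by (intro tendsto_intros)
    then have "eventually (\<lambda>\<theta>. y + \<theta> *\<^sub>R v \<in> interior V) (at_right 0)"
      using int by (intro topological_tendstoD) (auto simp: y_def)
    moreover have "eventually (\<lambda>\<theta>::real. \<theta> > 0) (at_right 0)" by (auto simp: eventually_at_right_less)
    ultimately have ev: "eventually (\<lambda>\<theta>. p t ((G (y + \<theta> *\<^sub>R v) - G y) /\<^sub>R \<theta>) \<le> 0) (at_right 0)"
    proof eventually_elim
      case (elim \<theta>)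
      then have "p t (G (y + \<theta> *\<^sub>R v)) - p t (G y) \<le> 0" using max interior_subset by fastforce
      then show ?case using elim(2) by (simp add: blinfun.scaleR_right blinfun.diff_right mult_nonneg_nonpos)
    qed
    have "((\<lambda>\<theta>. p t ((G (y + \<theta> *\<^sub>R v) - G y) /\<^sub>R \<theta>)) \<longlongrightarrow> p t (D v)) (at_right 0)"
      using D by (intro tendsto_intros) (simp add: has_gateaux_def)
    then show ?thesis by (rule tendsto_upperbound[OF _ ev]) simp
  qed
  have "p t (D v) = 0" for v using le[of v] le[of "- v"] by (simp add: blinfun.minus_right)
  then have "p t o\<^sub>L D = 0" by (intro blinfun_eqI) simp
  then show ?thesis using DG_eq[OF D] by (simp add: G_def[abs_def] y_def)
qed

lemma Surj_normal:
  fixes V :: "'y::real_normed_vector set"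
  assumes QC: "QC 1 m q g h (x\<^sub>0 T)" and surj: "Surj T U f x\<^sub>0 u\<^sub>0 V \<phi> \<psi>"
    and p: "triple lam \<mu> p"
  shows "lam 0 \<noteq> 0"
proof
  assume "lam 0 = 0"
  obtain t where t: "t \<in> {0..T}" "\<phi> (u\<^sub>0 t) \<in> interior V" "gateaux_differentiable (\<lambda>y. f t (x\<^sub>0 t) (\<psi> y)) (\<phi> (u\<^sub>0 t))"
     and sj: "surj (blinfun_apply (DG (\<lambda>y. f t (x\<^sub>0 t) (\<psi> y)) (\<phi> (u\<^sub>0 t))))" and hom: "homeomorphism U V \<phi> \<psi>"
    using surj by (auto simp: Surj_def)
  have z: "p t o\<^sub>L DG (\<lambda>y. f t (x\<^sub>0 t) (\<psi> y)) (\<phi> (u\<^sub>0 t)) = 0"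
    by (rule interior_maximum[OF p t(1) hom t(2,3)])
  have "p t = 0"
  proof (rule blinfun_eqI)
    fix v
    obtain w where "v = DG (\<lambda>y. f t (x\<^sub>0 t) (\<psi> y)) (\<phi> (u\<^sub>0 t)) w" using sj by (metis surjD)
    then show "p t v = blinfun_apply 0 v" using arg_cong[OF z, of "\<lambda>b. blinfun_apply b w"] by simp
  qed
  then show False using QC1_nondegenerate[OF QC p t(1)] \<open>lam 0 = 0\<close> by simp
qed

lemma LI_zero:
  fixes V :: "'y::real_normed_vector set"
  assumes LI: "LI T U f m q g h x\<^sub>0 u\<^sub>0 V \<phi> \<psi>"
    and z: "((\<Sum>\<alpha>=1..m. c \<alpha> *\<^sub>R DH (g \<alpha>) (x\<^sub>0 T)) + (\<Sum>\<beta>=1..q. d \<beta> *\<^sub>R DH (h \<beta>) (x\<^sub>0 T))) o\<^sub>L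
        DG (\<lambda>y. f T (x\<^sub>0 T) (\<psi> y)) (\<phi> (u\<^sub>0 T)) = 0"
  shows "(\<forall>\<alpha>\<in>{1..m}. c \<alpha> = 0) \<and> (\<forall>\<beta>\<in>{1..q}. d \<beta> = 0)"
proof -
  define D where "D = DG (\<lambda>y. f T (x\<^sub>0 T) (\<psi> y)) (\<phi> (u\<^sub>0 T))"
  define v where "v = case_sum (\<lambda>\<alpha>. DH (g \<alpha>) (x\<^sub>0 T) o\<^sub>L D) (\<lambda>\<beta>. DH (h \<beta>) (x\<^sub>0 T) o\<^sub>L D)"
  have li: "lin_indep_family ({1..m} <+> {1..q}) v"
    using LI by (simp add: LI_def Let_def v_def D_def)
  have "(\<Sum>i\<in>{1..m} <+> {1..q}. case_sum c d i *\<^sub>R v i)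
      = (\<Sum>\<alpha>=1..m. c \<alpha> *\<^sub>R (DH (g \<alpha>) (x\<^sub>0 T) o\<^sub>L D)) + (\<Sum>\<beta>=1..q. d \<beta> *\<^sub>R (DH (h \<beta>) (x\<^sub>0 T) o\<^sub>L D))"
    by (simp add: sum.Plus v_def)
  also have "\<dots> = 0"
    unfolding z[symmetric] D_def[symmetric]
    by (rule blinfun_eqI) (simp add: blinfun.add_left blinfun.sum_left blinfun.scaleR_left)
  finally have zero: "(\<Sum>i\<in>{1..m} <+> {1..q}. case_sum c d i *\<^sub>R v i) = 0" .
  have all: "\<forall>i\<in>{1..m} <+> {1..q}. case_sum c d i = 0"
    by (rule li[unfolded lin_indep_family_def, THEN spec, THEN spec, THEN mp])
       (intro conjI zero order_refl finite_Plus finite_atLeastAtMost)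
  have "c \<alpha> = 0" if "\<alpha> \<in> {1..m}" for \<alpha> using bspec[OF all InlI[OF that]] by simp
  moreover have "d \<beta> = 0" if "\<beta> \<in> {1..q}" for \<beta> using bspec[OF all InrI[OF that]] by simp
  ultimately show ?thesis by blast
qed

lemma LI_stationary:
  fixes V :: "'y::real_normed_vector set"
  assumes LI: "LI T U f m q g h x\<^sub>0 u\<^sub>0 V \<phi> \<psi>" and p: "triple lam \<mu> p"
  shows "p T o\<^sub>L DG (\<lambda>y. f T (x\<^sub>0 T) (\<psi> y)) (\<phi> (u\<^sub>0 T)) = 0"
    and "p T = lam 0 *\<^sub>R DH (g 0) (x\<^sub>0 T) + ((\<Sum>\<alpha>=1..m. lam \<alpha> *\<^sub>R DH (g \<alpha>) (x\<^sub>0 T)) + (\<Sum>\<beta>=1..q. \<mu> \<beta> *\<^sub>R DH (h \<beta>) (x\<^sub>0 T)))"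
proof -
  show "p T o\<^sub>L DG (\<lambda>y. f T (x\<^sub>0 T) (\<psi> y)) (\<phi> (u\<^sub>0 T)) = 0"
    using LI T by (intro interior_maximum[OF p]) (auto simp: LI_def)
  show "p T = lam 0 *\<^sub>R DH (g 0) (x\<^sub>0 T) + ((\<Sum>\<alpha>=1..m. lam \<alpha> *\<^sub>R DH (g \<alpha>) (x\<^sub>0 T)) + (\<Sum>\<beta>=1..q. \<mu> \<beta> *\<^sub>R DH (h \<beta>) (x\<^sub>0 T)))"
    using p by (simp add: pontryagin_triple_def sum.atLeast_Suc_atMost[of 0 m] add.assoc)
qed

lemma LI_normal:
  fixes V :: "'y::real_normed_vector set"
  assumes LI: "LI T U f m q g h x\<^sub>0 u\<^sub>0 V \<phi> \<psi>" and p: "triple lam \<mu> p"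
  shows "lam 0 \<noteq> 0"
proof
  assume l0: "lam 0 = 0"
  have "(\<forall>\<alpha>\<in>{1..m}. lam \<alpha> = 0) \<and> (\<forall>\<beta>\<in>{1..q}. \<mu> \<beta> = 0)"
    by (rule LI_zero[OF LI]) (use LI_stationary[OF LI p] l0 in simp)
  moreover have "(\<exists>\<alpha>\<in>{0..m}. lam \<alpha> \<noteq> 0) \<or> (\<exists>\<beta>\<in>{1..q}. \<mu> \<beta> \<noteq> 0)"
    using p by (simp add: pontryagin_triple_def)
  ultimately obtain \<alpha> where "\<alpha> \<le> m" "lam \<alpha> \<noteq> 0" "\<forall>\<alpha>\<in>{1..m}. lam \<alpha> = 0" by auto
  then show False using l0 by (cases \<alpha>) auto
qed

text \<open>The difference of the end values is a combination of the differentials with index at least \<open>1\<close>, since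
  the terms with \<open>\<alpha> = 0\<close> cancel, and it is annihilated by \<open>D\<^sub>3 f\<close>. So (LI) makes the multipliers equal;
  then the difference of the costates solves the adjoint equation with end value \<open>0\<close>.\<close>

lemma LI_unique:
  fixes V :: "'y::real_normed_vector set"
  assumes LI: "LI T U f m q g h x\<^sub>0 u\<^sub>0 V \<phi> \<psi>"
    and p: "triple lam \<mu> p" "lam 0 = 1"
    and p': "triple lam' \<mu>' p'" "lam' 0 = 1"
  shows "(\<forall>\<alpha>\<in>{0..m}. lam' \<alpha> = lam \<alpha>) \<and> (\<forall>\<beta>\<in>{1..q}. \<mu>' \<beta> = \<mu> \<beta>) \<and> (\<forall>t\<in>{0..T}. p' t = p t)"
proof -
  define D where "D = DG (\<lambda>y. f T (x\<^sub>0 T) (\<psi> y)) (\<phi> (u\<^sub>0 T))"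
  have diff: "p' T - p T = (\<Sum>\<alpha>=1..m. (lam' \<alpha> - lam \<alpha>) *\<^sub>R DH (g \<alpha>) (x\<^sub>0 T)) + (\<Sum>\<beta>=1..q. (\<mu>' \<beta> - \<mu> \<beta>) *\<^sub>R DH (h \<beta>) (x\<^sub>0 T))"
    using LI_stationary(2)[OF LI p(1)] LI_stationary(2)[OF LI p'(1)] p(2) p'(2)
    by (simp add: scaleR_diff_left sum_subtractf)
  have "(p' T - p T) o\<^sub>L D = (p' T o\<^sub>L D) - (p T o\<^sub>L D)"
    by (rule blinfun_eqI) (simp add: blinfun.diff_left)
  then have z: "(p' T - p T) o\<^sub>L D = 0"
    using LI_stationary(1)[OF LI p(1)] LI_stationary(1)[OF LI p'(1)] by (simp add: D_def)
  have eq: "(\<forall>\<alpha>\<in>{1..m}. lam' \<alpha> - lam \<alpha> = 0) \<and> (\<forall>\<beta>\<in>{1..q}. \<mu>' \<beta> - \<mu> \<beta> = 0)"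
    by (rule LI_zero[OF LI z[unfolded diff D_def]])
  have zT: "p' T - p T = 0" unfolding diff using eq by simp
  have "p' t - p t = 0" if t: "t \<in> {0..T}" for t
  proof (rule adjoint_zero[OF T A_pw_cont, where p = "\<lambda>t. p' t - p t" and c = T])
    show "continuous_on {0..T} (\<lambda>t. p' t - p t)" by (intro continuous_intros triple_adjoint(1)[OF p(1)] triple_adjoint(1)[OF p'(1)])
    show "((\<lambda>r. - ((p' r - p r) o\<^sub>L A r)) has_integral (p' t - p t - (p' s - p s))) {s..t}" if st: "0 \<le> s" "s \<le> t" "t \<le> T" for s t
    proof -
      have "(\<lambda>r. - ((p' r - p r) o\<^sub>L A r)) = (\<lambda>r. - (p' r o\<^sub>L A r) - - (p r o\<^sub>L A r))"
        by (intro ext blinfun_eqI) (simp add: blinfun.diff_left blinfun.minus_left)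
      then show ?thesis
        using has_integral_diff[OF triple_adjoint(2)[OF p'(1) st] triple_adjoint(2)[OF p(1) st]]
        by (simp add: algebra_simps)
    qed
  qed (use zT T t in auto)
  moreover have "lam' \<alpha> = lam \<alpha>" if "\<alpha> \<in> {0..m}" for \<alpha>
    using that eq p(2) p'(2) by (cases \<alpha>) auto
  ultimately show ?thesis using eq by auto
qed

end

theorem corollary2p6:
  fixes T :: real
    and \<Omega> :: "'e::banach set"
    and \<xi>\<^sub>0 :: 'e
    and U :: "'u::t2_space set"
    and m q :: nat
    and f :: "real \<Rightarrow> 'e \<Rightarrow> 'u \<Rightarrow> 'e"
    and g h :: "nat \<Rightarrow> 'e \<Rightarrow> real"
    and x\<^sub>0 :: "real \<Rightarrow> 'e"
    and u\<^sub>0 :: "real \<Rightarrow> 'u"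
    and V :: "'y::real_normed_vector set"
    and \<phi> :: "'u \<Rightarrow> 'y"
    and \<psi> :: "'y \<Rightarrow> 'u"
  assumes "T > 0" and "open \<Omega>" and "\<Omega> \<noteq> {}" and "\<xi>\<^sub>0 \<in> \<Omega>" and "m \<ge> 1" and "q \<ge> 1"
    and sol: "mayer_solution T \<Omega> U \<xi>\<^sub>0 f m q g h x\<^sub>0 u\<^sub>0"
    and f_cont: "continuous_on ({0..T} \<times> \<Omega> \<times> U) (\<lambda>(t, \<xi>, \<zeta>). f t \<xi> \<zeta>)"
    and f_gateaux: "\<forall>t\<in>{0..T}. \<forall>\<xi>\<in>\<Omega>. \<forall>\<zeta>\<in>U. gateaux_differentiable (\<lambda>\<xi>. f t \<xi> \<zeta>) \<xi>"
    and f_frechet: "\<forall>t\<in>{0..T}. \<forall>\<zeta>\<in>U. (\<lambda>\<xi>. f t \<xi> \<zeta>) differentiable (at (x\<^sub>0 t))"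
    and f_frechet_cont: "continuous_on ({0..T} \<times> U) (\<lambda>(t, \<zeta>). DF (\<lambda>\<xi>. f t \<xi> \<zeta>) (x\<^sub>0 t))"
    and f_bounded: "\<forall>K M. compact K \<and> K \<noteq> {} \<and> K \<subseteq> \<Omega> \<and> compact M \<and> M \<noteq> {} \<and> M \<subseteq> U \<longrightarrow>
      bdd_above ((\<lambda>(t, \<xi>, \<zeta>). norm (DG (\<lambda>\<xi>. f t \<xi> \<zeta>) \<xi>)) ` ({0..T} \<times> K \<times> M))"
    and g_hadamard: "\<forall>\<alpha>\<in>{0..m}. hadamard_differentiable (g \<alpha>) (x\<^sub>0 T)"
    and h_cont: "\<forall>\<beta>\<in>{1..q}. \<exists>N. open N \<and> x\<^sub>0 T \<in> N \<and> N \<subseteq> \<Omega> \<and> continuous_on N (h \<beta>)"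
    and h_hadamard: "\<forall>\<beta>\<in>{1..q}. hadamard_differentiable (h \<beta>) (x\<^sub>0 T)"
  shows
    "(QC 1 m q g h (x\<^sub>0 T) \<longrightarrow>
        (\<forall>lam \<mu> p. pontryagin_triple T U f m q g h x\<^sub>0 u\<^sub>0 lam \<mu> p \<longrightarrow>
           (\<forall>t\<in>{0..T}. (lam 0, p t) \<noteq> (0, 0)))) \<and>
     (QC 0 m q g h (x\<^sub>0 T) \<longrightarrow>
        (\<forall>lam \<mu> p. pontryagin_triple T U f m q g h x\<^sub>0 u\<^sub>0 lam \<mu> p \<longrightarrow>
           (\<forall>t\<in>{0..T}. p t \<noteq> 0))) \<and>
     (QC 1 m q g h (x\<^sub>0 T) \<and> Surj T U f x\<^sub>0 u\<^sub>0 V \<phi> \<psi> \<longrightarrow>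
        (\<exists>lam \<mu> p. pontryagin_triple T U f m q g h x\<^sub>0 u\<^sub>0 lam \<mu> p \<and> lam 0 = 1)) \<and>
     (LI T U f m q g h x\<^sub>0 u\<^sub>0 V \<phi> \<psi> \<longrightarrow>
        (\<exists>lam \<mu> p. pontryagin_triple T U f m q g h x\<^sub>0 u\<^sub>0 lam \<mu> p \<and> lam 0 = 1 \<and>
           (\<forall>lam' \<mu>' p'. pontryagin_triple T U f m q g h x\<^sub>0 u\<^sub>0 lam' \<mu>' p' \<and> lam' 0 = 1 \<longrightarrow>
              (\<forall>\<alpha>\<in>{0..m}. lam' \<alpha> = lam \<alpha>) \<and> (\<forall>\<beta>\<in>{1..q}. \<mu>' \<beta> = \<mu> \<beta>) \<and> (\<forall>t\<in>{0..T}. p' t = p t))))"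
proof -
  interpret mayer_problem T \<Omega> \<xi>\<^sub>0 U m q f g h x\<^sub>0 u\<^sub>0
    by (unfold_locales; fact)
  show ?thesis
  proof (intro conjI impI)
    assume "QC 1 m q g h (x\<^sub>0 T)"
    then show "\<forall>lam \<mu> p. pontryagin_triple T U f m q g h x\<^sub>0 u\<^sub>0 lam \<mu> p \<longrightarrow> (\<forall>t\<in>{0..T}. (lam 0, p t) \<noteq> (0, 0))"
      using QC1_nondegenerate by blast
  next
    assume "QC 0 m q g h (x\<^sub>0 T)"
    then show "\<forall>lam \<mu> p. pontryagin_triple T U f m q g h x\<^sub>0 u\<^sub>0 lam \<mu> p \<longrightarrow> (\<forall>t\<in>{0..T}. p t \<noteq> 0)"
      using QC0_nondegenerate by blast
  next
    assume "QC 1 m q g h (x\<^sub>0 T) \<and> Surj T U f x\<^sub>0 u\<^sub>0 V \<phi> \<psi>"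
    then show "\<exists>lam \<mu> p. pontryagin_triple T U f m q g h x\<^sub>0 u\<^sub>0 lam \<mu> p \<and> lam 0 = 1"
      by (intro normal_triple_exists) (use Surj_normal in blast)
  next
    assume LI: "LI T U f m q g h x\<^sub>0 u\<^sub>0 V \<phi> \<psi>"
    obtain lam \<mu> p where p: "pontryagin_triple T U f m q g h x\<^sub>0 u\<^sub>0 lam \<mu> p" "lam 0 = 1"
      using normal_triple_exists LI_normal[OF LI] by blast
    show "\<exists>lam \<mu> p. pontryagin_triple T U f m q g h x\<^sub>0 u\<^sub>0 lam \<mu> p \<and> lam 0 = 1 \<and>
        (\<forall>lam' \<mu>' p'. pontryagin_triple T U f m q g h x\<^sub>0 u\<^sub>0 lam' \<mu>' p' \<and> lam' 0 = 1 \<longrightarrow>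
           (\<forall>\<alpha>\<in>{0..m}. lam' \<alpha> = lam \<alpha>) \<and> (\<forall>\<beta>\<in>{1..q}. \<mu>' \<beta> = \<mu> \<beta>) \<and> (\<forall>t\<in>{0..T}. p' t = p t))"
      using p LI_unique[OF LI p] by blast
  qed
qed

end
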